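(* There exist positive numbers $\epsilon, c, C$ such that for all large enough $n$ the odometer $u$ of the oil and water process on $\mathbb{Z}$ started from $n$ oil and $n$ water particles at the origin satisfies (i) $$\mathbb{P}\Big(\sup_{x\in\mathbb{Z}} u(x) > C n^{4/3}\Big) < e^{-n^{\epsilon}},$$ (ii) $$\mathbb{P}\Big(\inf_{x\in\mathbb{Z}:\,|x|\le c n^{1/3}} u(x) < c n^{4/3}\Big) < e^{-n^{\epsilon}}.$$
   Context: Oil and water process. Fix an integer $n\ge 1$ and let $(X^x_k, Y^x_k)_{x\in\mathbb{Z}, k\ge 1}$ be independent random variables, each uniform on $\{+1,-1\}$. For $x\in\mathbb{Z}$ and $t=0,1,2,\dots$ let $\eta_1(x,t)$ and $\eta_2(x,t)$ be the numbers of oil and water particles at $x$ at time $t$. Initially there are $n$ oil and $n$ water particles at the origin and none elsewhere. At time $t$, if some site $x$ has $\min(\eta_1(x,t),\eta_2(x,t))\ge 1$, let $x_t$ be the leftmost (smallest) such site; $x_t$ fires: if this is the $k$-th firing of $x_t$, one oil particle moves from $x_t$ to $x_t+X^{x_t}_k$ and one water particle moves from $x_t$ to $x_t+Y^{x_t}_k$, giving the configuration at time $t+1$. If there is no such site, the process has stopped; let $\tau$ be the first time at which this happens ($\tau$ is almost surely finite). (The number of firings at each site and the final configuration do not depend on the order in which legal firings are performed; the leftmost rule is a convention.) The odometer $u:\mathbb{Z}\to\mathbb{N}$ is the random function $u(x)=\#\{0\le t<\tau : x_t=x\}$, the total number of times $x$ fires. It depends on $n$. *)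

theory Defs
  imports "HOL-Probability.Probability"
begin

text \<open>A state consists of the numbers of oil and water particles at each site and the number
  of times each site has fired so far. The last component determines which entry of the
  stacks the next firing of a site uses.\<close>

record ow_state =
  oil :: "int \<Rightarrow> nat"
  water :: "int \<Rightarrow> nat"
  fired :: "int \<Rightarrow> nat"

definition initial_state :: "nat \<Rightarrow> ow_state" where
  "initial_state n =
     \<lparr>oil = (\<lambda>x. if x = 0 then n else 0), water = (\<lambda>x. if x = 0 then n else 0), fired = (\<lambda>_. 0)\<rparr>"

definition can_fire :: "ow_state \<Rightarrow> int \<Rightarrow> bool" where
  "can_fire s x \<longleftrightarrow> min (oil s x) (water s x) \<ge> 1"

definition stopped :: "ow_state \<Rightarrow> bool" where
  "stopped s \<longleftrightarrow> (\<nexists>x. can_fire s x)"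

text \<open>Only finitely many sites are occupied in a reachable state, so the least site exists
  unless the state is stopped.\<close>

definition leftmost :: "ow_state \<Rightarrow> int" where
  "leftmost s = (LEAST x. can_fire s x)"

definition move_particle :: "int \<Rightarrow> int \<Rightarrow> (int \<Rightarrow> nat) \<Rightarrow> int \<Rightarrow> nat" where
  "move_particle x y \<eta> = (let \<eta>' = \<eta>(x := \<eta> x - 1) in \<eta>'(y := \<eta>' y + 1))"

text \<open>The stacks are indexed from \<open>k = 1\<close>: \<open>X x k\<close> and \<open>Y x k\<close> are the displacements of the oil
  and the water particle in the \<open>k\<close>-th firing of \<open>x\<close>; the entries with \<open>k = 0\<close> are never used.\<close>

definition step :: "(int \<Rightarrow> nat \<Rightarrow> int) \<Rightarrow> (int \<Rightarrow> nat \<Rightarrow> int) \<Rightarrow> ow_state \<Rightarrow> ow_state" where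
  "step X Y s =
     (if stopped s then s
      else let x = leftmost s; k = fired s x + 1 in
        \<lparr>oil = move_particle x (x + X x k) (oil s),
         water = move_particle x (x + Y x k) (water s),
         fired = (fired s)(x := k)\<rparr>)"

definition state_at ::
  "nat \<Rightarrow> (int \<Rightarrow> nat \<Rightarrow> int) \<Rightarrow> (int \<Rightarrow> nat \<Rightarrow> int) \<Rightarrow> nat \<Rightarrow> ow_state" where
  "state_at n X Y t = (step X Y ^^ t) (initial_state n)"

text \<open>The stopping time, with value \<open>\<infinity>\<close> if the process never stops.\<close>

definition stop_time :: "nat \<Rightarrow> (int \<Rightarrow> nat \<Rightarrow> int) \<Rightarrow> (int \<Rightarrow> nat \<Rightarrow> int) \<Rightarrow> enat" where
  "stop_time n X Y = (INF t\<in>{t. stopped (state_at n X Y t)}. enat t)"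

definition firing_times ::
  "nat \<Rightarrow> (int \<Rightarrow> nat \<Rightarrow> int) \<Rightarrow> (int \<Rightarrow> nat \<Rightarrow> int) \<Rightarrow> int \<Rightarrow> nat set" where
  "firing_times n X Y x =
     {t. enat t < stop_time n X Y \<and> leftmost (state_at n X Y t) = x}"

text \<open>The value \<open>\<infinity>\<close> is only possible on the null event that the process never stops.\<close>

definition odometer ::
  "nat \<Rightarrow> (int \<Rightarrow> nat \<Rightarrow> int) \<Rightarrow> (int \<Rightarrow> nat \<Rightarrow> int) \<Rightarrow> int \<Rightarrow> enat" where
  "odometer n X Y x =
     (if finite (firing_times n X Y x) then enat (card (firing_times n X Y x)) else \<infinity>)"

text \<open>Independence is joint over both families: the index \<open>(True, x, k)\<close> stands for \<open>X x k\<close> and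
  \<open>(False, x, k)\<close> for \<open>Y x k\<close>.\<close>

locale oil_water_stacks = prob_space M for M :: "'a measure" +
  fixes X Y :: "int \<Rightarrow> nat \<Rightarrow> 'a \<Rightarrow> int"
  assumes indep_stacks:
    "indep_vars (\<lambda>_. count_space UNIV)
       (\<lambda>(b, x, k). if b then X x k else Y x k) (UNIV \<times> UNIV \<times> {1..})"
  and uniform_X:
    "k \<ge> 1 \<Longrightarrow> distr M (count_space UNIV) (X x k) = measure_pmf (pmf_of_set {1, -1})"
  and uniform_Y:
    "k \<ge> 1 \<Longrightarrow> distr M (count_space UNIV) (Y x k) = measure_pmf (pmf_of_set {1, -1})"

end

theory Submission
  imports Defs "HOL-Real_Asymp.Real_Asymp"
begin

text \<open>Let \<open>u\<close> be the odometer and let \<open>S\<close> and \<open>Z\<close> be half the difference and half the sum of the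
  oil and water walks of a site. Oil minus water at \<open>x\<close> is \<open>S\<close> at \<open>x - 1\<close> minus \<open>S\<close> at \<open>x + 1\<close>, each
  evaluated at its own odometer, and its absolute value \<open>d\<close> at \<open>x\<close> is at most the number \<open>N\<close> of
  particles there, with equality once the process has stopped. Up to the noise \<open>Z\<close>, the slope
  \<open>u (x + 1) - u x\<close> is the number of particles to the left of the edge (minus \<open>2 n\<close> to the right of the
  origin); it is thus at most of order \<open>n\<close>, and its increments are at least \<open>d\<close>.

  Upper bound: at the first time at which some \<open>u x\<close> reaches a large multiple \<open>H\<close> of \<open>n\<close> to the power
  \<open>4/3\<close>, \<open>u\<close> lies in a narrow window below \<open>H\<close> on a stretch of order \<open>n\<close> to the power \<open>1/3\<close> ending at
  \<open>x\<close>. For two sites and all odometer values in this window, the two values of \<open>S\<close> differ by order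
  \<open>sqrt H\<close> with probability bounded below, so on a positive fraction of the stretch \<open>d\<close> has this
  order, and the sum of \<open>d\<close> would exceed \<open>2 n\<close>. As the window does not depend on the
  trajectory, only a union bound over \<open>x\<close> is needed. That only polynomially many sites matter follows from
  the exponential potential \<open>\<Sum>x. oil x * cosh (\<theta> x)\<close>, whose mean grows by a factor of at most
  \<open>cosh \<theta>\<close> per firing.

  Lower bound: if \<open>u\<close> is small near the origin, then \<open>d\<close>, bounded by the maxima of \<open>\<bar>S\<bar>\<close> over a range
  that is fixed in advance, has a small sum near the origin, so the slope of \<open>u\<close> stays of order \<open>n\<close> on
  one side of the origin until \<open>u\<close> is negative.\<close>

section \<open>Functions of independent signs\<close>

text \<open>The values 1 and -1 are required at every point, not just almost surely, so a function
  of finitely many signs takes finitely many values. For a variable with these values, mean zero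
  means uniform.\<close>

locale sign_family = prob_space M for M :: "'a measure" +
  fixes \<xi> :: "'i \<Rightarrow> 'a \<Rightarrow> int" and I :: "'i set"
  assumes indep_signs: "indep_vars (\<lambda>_. count_space UNIV) \<xi> I"
    and sign_values: "\<xi> i \<omega> \<in> {1, -1}"
    and sign_mean: "i \<in> I \<Longrightarrow> expectation (\<lambda>\<omega>. real_of_int (\<xi> i \<omega>)) = 0"
begin

abbreviation \<sigma> :: "'i \<Rightarrow> 'a \<Rightarrow> real" where
  "\<sigma> i \<omega> \<equiv> real_of_int (\<xi> i \<omega>)"

text \<open>A pointwise counterpart of measurability with respect to the signs in \<open>J\<close>.
  It makes sense for any codomain; for finite \<open>J\<close> it yields measurability,
  integrability and independence below.\<close>

definition depends :: "'i set \<Rightarrow> ('a \<Rightarrow> 'b) \<Rightarrow> bool" where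
  "depends J F \<longleftrightarrow>
    (\<forall>\<omega>\<in>space M. \<forall>\<omega>'\<in>space M. (\<forall>i\<in>J. \<xi> i \<omega> = \<xi> i \<omega>') \<longrightarrow> F \<omega> = F \<omega>')"

lemma dependsI:
  assumes "\<And>\<omega> \<omega>'. \<omega> \<in> space M \<Longrightarrow> \<omega>' \<in> space M \<Longrightarrow> (\<And>i. i \<in> J \<Longrightarrow> \<xi> i \<omega> = \<xi> i \<omega>') \<Longrightarrow> F \<omega> = F \<omega>'"
  shows "depends J F"
  using assms unfolding depends_def by blast

lemma dependsD:
  "depends J F \<Longrightarrow> \<omega> \<in> space M \<Longrightarrow> \<omega>' \<in> space M \<Longrightarrow> (\<And>i. i \<in> J \<Longrightarrow> \<xi> i \<omega> = \<xi> i \<omega>') \<Longrightarrow> F \<omega> = F \<omega>'"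
  unfolding depends_def by blast

lemma depends_factor:
  assumes "depends J F"
  shows "\<exists>f. \<forall>\<omega>\<in>space M. F \<omega> = f (restrict (\<lambda>i. \<xi> i \<omega>) J)"
proof (intro exI ballI)
  let ?r = "\<lambda>\<omega>. restrict (\<lambda>i. \<xi> i \<omega>) J"
  fix \<omega> assume \<omega>: "\<omega> \<in> space M"
  \<comment> \<open>A representative of the fibre of \<open>\<omega>\<close>, chosen from the sign
    pattern alone.\<close>
  define \<omega>' where "\<omega>' = (SOME \<omega>'. \<omega>' \<in> space M \<and> ?r \<omega>' = ?r \<omega>)"
  have "\<omega>' \<in> space M \<and> ?r \<omega>' = ?r \<omega>"
    unfolding \<omega>'_def by (rule someI[of _ \<omega>]) (use \<omega> in auto)
  then have 1: "\<omega>' \<in> space M" and 2: "?r \<omega>' = ?r \<omega>" by auto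
  have "\<xi> i \<omega> = \<xi> i \<omega>'" if "i \<in> J" for i
    using fun_cong[OF 2, of i] that by simp
  then have "F \<omega> = F \<omega>'"
    by (rule dependsD[OF assms \<omega> 1])
  then show "F \<omega> = (\<lambda>g. F (SOME \<omega>'. \<omega>' \<in> space M \<and> ?r \<omega>' = g)) (?r \<omega>)"
    by (simp only: \<omega>'_def)
qed

lemma depends_mono: "depends J F \<Longrightarrow> J \<subseteq> K \<Longrightarrow> depends K F"
  unfolding depends_def by blast

lemma finite_sign_product_space:
  assumes "finite J"
  shows "PiM J (\<lambda>_. count_space (UNIV :: int set)) = count_space (PiE J (\<lambda>_. UNIV))"
  by (rule count_space_PiM_finite[OF assms, of "\<lambda>_. UNIV"]) simp

text \<open>Restrictions of the signs to disjoint blocks are independent. A finite block has a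
  discrete product space, so every function of its sign pattern is measurable.\<close>

lemma indep_blocks:
  fixes F :: "'j \<Rightarrow> 'a \<Rightarrow> real"
  assumes "\<And>j. j \<in> J \<Longrightarrow> finite (L j)" "\<And>j. j \<in> J \<Longrightarrow> L j \<subseteq> I"
    and "disjoint_family_on L J" "\<And>j. j \<in> J \<Longrightarrow> depends (L j) (F j)"
  shows "indep_vars (\<lambda>_. borel) F J"
proof -
  have *: "\<forall>j\<in>J. \<exists>f. \<forall>\<omega>\<in>space M. F j \<omega> = f (restrict (\<lambda>i. \<xi> i \<omega>) (L j))"
    by (intro ballI depends_factor assms(4))
  obtain f where f: "\<forall>j\<in>J. \<forall>\<omega>\<in>space M. F j \<omega> = f j (restrict (\<lambda>i. \<xi> i \<omega>) (L j))"
    using bchoice[OF *] by auto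
  have "indep_vars (\<lambda>j. PiM (L j) (\<lambda>_. count_space UNIV)) (\<lambda>j \<omega>. restrict (\<lambda>i. \<xi> i \<omega>) (L j)) J"
    by (rule indep_vars_restrict[OF indep_signs]) (use assms in auto)
  then have "indep_vars (\<lambda>_. borel) (\<lambda>j \<omega>. f j (restrict (\<lambda>i. \<xi> i \<omega>) (L j))) J"
    by (rule indep_vars_compose2) (use assms(1) in \<open>simp add: finite_sign_product_space\<close>)
  \<comment> \<open>\<open>F j\<close> and its factorisation agree on \<open>space M\<close> only,
    so independence is transferred through preimages.\<close>
  moreover have "{F j -` A \<inter> space M |A. A \<in> sets borel}
      = {(\<lambda>\<omega>. f j (restrict (\<lambda>i. \<xi> i \<omega>) (L j))) -` A \<inter> space M |A. A \<in> sets borel}" if "j \<in> J" for j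
  proof -
    have "F j -` A \<inter> space M = (\<lambda>\<omega>. f j (restrict (\<lambda>i. \<xi> i \<omega>) (L j))) -` A \<inter> space M" for A
      using f that by auto
    then show ?thesis by simp
  qed
  moreover have "F j \<in> borel_measurable M \<longleftrightarrow> (\<lambda>\<omega>. f j (restrict (\<lambda>i. \<xi> i \<omega>) (L j))) \<in> borel_measurable M"
    if "j \<in> J" for j
    by (rule measurable_cong) (use f that in auto)
  ultimately show ?thesis
    unfolding indep_vars_def2 by (simp cong: indep_sets_cong)
qed

lemma depends_measurable:
  assumes "finite J" "J \<subseteq> I" "depends J F" "\<And>\<omega>. \<omega> \<in> space M \<Longrightarrow> F \<omega> \<in> space N"
  shows "F \<in> measurable M N"
proof -
  obtain f where f: "\<forall>\<omega>\<in>space M. F \<omega> = f (restrict (\<lambda>i. \<xi> i \<omega>) J)"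
    using depends_factor[OF assms(3)] ..
  let ?r = "\<lambda>\<omega>. restrict (\<lambda>i. \<xi> i \<omega>) J"
  have rm: "?r \<in> measurable M (count_space (PiE J (\<lambda>_. UNIV)))"
    unfolding finite_sign_product_space[OF assms(1), symmetric]
    using indep_signs assms(2) by (intro measurable_restrict) (auto simp: indep_vars_def)
  have "F -` A \<inter> space M = ?r -` {g \<in> PiE J (\<lambda>_. UNIV). f g \<in> A} \<inter> space M" for A
    using f by auto
  moreover have "?r -` {g \<in> PiE J (\<lambda>_. UNIV). f g \<in> A} \<inter> space M \<in> sets M" for A
    by (rule measurable_sets[OF rm]) auto
  ultimately show ?thesis
    using assms(4) by (intro measurableI) auto
qed

lemma depends_event:
  assumes "finite J" "J \<subseteq> I" "depends J P"
  shows "{\<omega> \<in> space M. P \<omega>} \<in> events"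
  using depends_measurable[OF assms, of "count_space UNIV"] by (simp add: pred_def)

lemma depends_integrable:
  fixes F :: "'a \<Rightarrow> real"
  assumes "finite J" "J \<subseteq> I" "depends J F"
  shows "integrable M F"
proof -
  obtain f where f: "\<forall>\<omega>\<in>space M. F \<omega> = f (restrict (\<lambda>i. \<xi> i \<omega>) J)"
    using depends_factor[OF assms(3)] ..
  let ?C = "PiE J (\<lambda>_. {1, -1 :: int})"
  have fin: "finite ?C" using assms(1) by (intro finite_PiE) auto
  \<comment> \<open>The sum over all sign patterns dominates the value at the pattern that
    occurs.\<close>
  have "norm (F \<omega>) \<le> (\<Sum>g\<in>?C. \<bar>f g\<bar>)" if "\<omega> \<in> space M" for \<omega>
    unfolding f[rule_format, OF that] real_norm_def
    using fin by (intro member_le_sum restrict_PiE_iff[THEN iffD2] ballI sign_values) auto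
  then show ?thesis
    using depends_measurable[OF assms, of borel]
    by (intro integrable_const_bound[where B = "\<Sum>g\<in>?C. \<bar>f g\<bar>"]) (auto intro!: AE_I2)
qed

lemma expectation_indep_mult:
  fixes F G :: "'a \<Rightarrow> real"
  assumes "finite J" "J \<subseteq> I" "depends J F" "finite K" "K \<subseteq> I" "depends K G" "J \<inter> K = {}"
  shows "expectation (\<lambda>\<omega>. F \<omega> * G \<omega>) = expectation F * expectation G"
proof -
  have "indep_vars (\<lambda>_. borel) (\<lambda>b. if b then F else G) UNIV"
    by (rule indep_blocks[where L = "\<lambda>b. if b then J else K"])
       (use assms in \<open>auto simp: disjoint_family_on_def\<close>)
  then have "indep_var borel F borel G"
    unfolding indep_var_def
    by (rule indep_vars_cong[THEN iffD1, rotated 3]) (auto split: bool.split)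
  then show ?thesis
    using assms by (intro indep_var_lebesgue_integral) (auto intro: depends_integrable)
qed

lemma depends_sign: "depends {i} (\<xi> i)" "depends {i} (\<sigma> i)"
  by (auto intro: dependsI)

text \<open>Takes the place of conditional expectation: a martingale increment appears as a sign
  times a factor that ignores this sign.\<close>

lemma fresh_sign:
  fixes F :: "'a \<Rightarrow> real"
  assumes "finite J" "J \<subseteq> I" "depends J F" "i \<in> I" "i \<notin> J"
  shows "expectation (\<lambda>\<omega>. F \<omega> * \<sigma> i \<omega>) = 0"
  using expectation_indep_mult[OF assms(1-3), of "{i}" "\<sigma> i"] assms(4,5)
  by (simp add: depends_sign sign_mean)

lemma sign_square [simp]: "\<sigma> i \<omega> * \<sigma> i \<omega> = 1" "(\<sigma> i \<omega>)\<^sup>2 = 1"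
  using sign_values[of i \<omega>] by auto

lemma depends_weighted_sum: "depends J (\<lambda>\<omega>. \<Sum>i\<in>J. c i * \<sigma> i \<omega>)"
  by (auto intro!: dependsI sum.cong)

text \<open>Signs are added one at a time, and terms odd in the new sign vanish by
  \<open>fresh_sign\<close>. The two moments are treated jointly because the recursion for the
  fourth contains the second.\<close>

lemma weighted_sum_moments:
  assumes "finite J" "J \<subseteq> I"
  shows "expectation (\<lambda>\<omega>. (\<Sum>i\<in>J. c i * \<sigma> i \<omega>)\<^sup>2) = (\<Sum>i\<in>J. (c i)\<^sup>2)"
    and "expectation (\<lambda>\<omega>. (\<Sum>i\<in>J. c i * \<sigma> i \<omega>)^4) \<le> 3 * (\<Sum>i\<in>J. (c i)\<^sup>2)\<^sup>2"
proof -
  have "expectation (\<lambda>\<omega>. (\<Sum>i\<in>J. c i * \<sigma> i \<omega>)\<^sup>2) = (\<Sum>i\<in>J. (c i)\<^sup>2)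
    \<and> expectation (\<lambda>\<omega>. (\<Sum>i\<in>J. c i * \<sigma> i \<omega>)^4) \<le> 3 * (\<Sum>i\<in>J. (c i)\<^sup>2)\<^sup>2"
    using assms
  proof (induction rule: finite_induct)
    case empty
    then show ?case by simp
  next
    case (insert j J)
    define W where "W \<omega> = (\<Sum>i\<in>J. c i * \<sigma> i \<omega>)" for \<omega>
    define v where "v = (\<Sum>i\<in>J. (c i)\<^sup>2)"
    have dW: "depends J (\<lambda>\<omega>. f (W \<omega>))" for f :: "real \<Rightarrow> real"
      unfolding W_def by (auto intro!: dependsI sum.cong arg_cong[where f = f])
    have J: "J \<subseteq> I" "j \<in> I" using insert by auto
    note I [simp] = depends_integrable[OF \<open>finite J\<close> J(1) dW]
    have dWj: "depends (insert j J) (\<lambda>\<omega>. f (W \<omega>) (\<sigma> j \<omega>))" for f :: "real \<Rightarrow> real \<Rightarrow> real"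
      unfolding W_def by (auto intro!: dependsI sum.cong arg_cong2[where f = f])
    have Ij [simp]: "integrable M (\<lambda>\<omega>. f (W \<omega>) (\<sigma> j \<omega>))" for f :: "real \<Rightarrow> real \<Rightarrow> real"
      by (rule depends_integrable[OF _ _ dWj]) (use insert in auto)
    have 0: "expectation (\<lambda>\<omega>. f (W \<omega>) * \<sigma> j \<omega>) = 0" for f
      by (rule fresh_sign[OF \<open>finite J\<close> J(1) dW J(2)]) (use insert in auto)
    have s2: "(\<Sum>i\<in>insert j J. c i * \<sigma> i \<omega>)\<^sup>2 = (W \<omega>)\<^sup>2 + 2 * c j * (W \<omega> * \<sigma> j \<omega>) + (c j)\<^sup>2" for \<omega>
      using insert(1,2) by (simp add: W_def[symmetric] power2_sum power_mult_distrib algebra_simps)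
    have s4: "(\<Sum>i\<in>insert j J. c i * \<sigma> i \<omega>)^4 = (W \<omega>)^4 + 4 * c j * ((W \<omega>)^3 * \<sigma> j \<omega>)
        + 6 * (c j)\<^sup>2 * (W \<omega>)\<^sup>2 + 4 * (c j)^3 * (W \<omega> * \<sigma> j \<omega>) + (c j)^4" for \<omega>
      using insert(1,2) sign_values[of j \<omega>]
      by (auto simp: W_def[symmetric]) (simp_all add: algebra_simps power4_eq_xxxx power3_eq_cube power2_eq_square)
    have IH: "expectation (\<lambda>\<omega>. (W \<omega>)\<^sup>2) = v" "expectation (\<lambda>\<omega>. (W \<omega>)^4) \<le> 3 * v\<^sup>2"
      using insert by (auto simp: W_def v_def)
    have "expectation (\<lambda>\<omega>. (\<Sum>i\<in>insert j J. c i * \<sigma> i \<omega>)\<^sup>2) = v + (c j)\<^sup>2"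
      unfolding s2 using IH(1) 0[of "\<lambda>x. x"] Ij[of "\<lambda>x y. x * y"] I[of "\<lambda>x. x\<^sup>2"]
      by (simp add: prob_space)
    moreover have "expectation (\<lambda>\<omega>. (\<Sum>i\<in>insert j J. c i * \<sigma> i \<omega>)^4)
        = expectation (\<lambda>\<omega>. (W \<omega>)^4) + 6 * (c j)\<^sup>2 * v + (c j)^4"
      unfolding s4 using IH(1) 0[of "\<lambda>x. x"] 0[of "\<lambda>x. x^3"] Ij[of "\<lambda>x y. x * y"] Ij[of "\<lambda>x y. x^3 * y"]
        I[of "\<lambda>x. x\<^sup>2"] I[of "\<lambda>x. x^4"]
      by (simp add: prob_space)
    moreover have "3 * v\<^sup>2 + 6 * (c j)\<^sup>2 * v + (c j)^4 \<le> 3 * (v + (c j)\<^sup>2)\<^sup>2"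
    proof -
      have "3 * (v + (c j)\<^sup>2)\<^sup>2 = 3 * v\<^sup>2 + 6 * (c j)\<^sup>2 * v + (c j)^4 + 2 * (c j)^4"
        by (simp add: algebra_simps power2_eq_square power4_eq_xxxx)
      moreover have "(c j)^4 \<ge> 0" by simp
      ultimately show ?thesis by linarith
    qed
    ultimately show ?case
      using insert(1,2) IH(2) by (simp add: v_def algebra_simps)
  qed
  then show "expectation (\<lambda>\<omega>. (\<Sum>i\<in>J. c i * \<sigma> i \<omega>)\<^sup>2) = (\<Sum>i\<in>J. (c i)\<^sup>2)"
    and "expectation (\<lambda>\<omega>. (\<Sum>i\<in>J. c i * \<sigma> i \<omega>)^4) \<le> 3 * (\<Sum>i\<in>J. (c i)\<^sup>2)\<^sup>2"
    by auto
qed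

end

section \<open>Running maxima and maximal inequalities\<close>

definition running_max :: "(nat \<Rightarrow> real) \<Rightarrow> nat \<Rightarrow> real" where
  "running_max s n = Max (s ` {..n})"

lemma running_max_0 [simp]: "running_max s 0 = s 0"
  by (simp add: running_max_def)

lemma running_max_Suc: "running_max s (Suc n) = max (s (Suc n)) (running_max s n)"
  by (simp add: running_max_def atMost_Suc)

lemma running_max_ge: "k \<le> n \<Longrightarrow> s k \<le> running_max s n"
  by (simp add: running_max_def)

lemma running_max_attained: "\<exists>k\<le>n. running_max s n = s k"
proof -
  have "running_max s n \<in> s ` {..n}"
    unfolding running_max_def by (rule Max_in) auto
  then show ?thesis by auto
qed

lemma running_max_cong: "(\<And>k. k \<le> n \<Longrightarrow> s k = s' k) \<Longrightarrow> running_max s n = running_max s' n"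
  unfolding running_max_def by (intro arg_cong[where f = Max] image_cong) auto

text \<open>A pathwise form of Doob's maximal inequality in \<open>L\<^sup>2\<close>: the sum on the right-hand side is a
  martingale transform and drops out on taking expectations.\<close>

lemma pathwise_doob_aux:
  assumes "s 0 = 0"
  shows "(running_max s n)\<^sup>2
    \<le> 2 * running_max s n * s n - 2 * (\<Sum>k<n. running_max s k * (s (Suc k) - s k))"
proof (induction n)
  case 0
  then show ?case using assms by simp
next
  case (Suc n)
  let ?m = "running_max s n"
  show ?case
  proof (cases "s (Suc n) \<le> ?m")
    case True
    then show ?thesis
      using Suc by (simp add: running_max_Suc max_def algebra_simps)
  next
    case False
    then have "running_max s (Suc n) = s (Suc n)"
      by (simp add: running_max_Suc)
    \<comment> \<open>At a new maximum, what remains to be shown after the induction hypothesis is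
      that this square is nonnegative.\<close>
    moreover have "(s (Suc n) - ?m)\<^sup>2 \<ge> 0" by simp
    ultimately show ?thesis
      using Suc by (simp add: power2_eq_square algebra_simps)
  qed
qed

text \<open>With \<open>m\<close> the maximum, \<open>(m - 2 * s n)\<^sup>2 \<ge> 0\<close> bounds
  the product \<open>2 * m * s n\<close> by \<open>m\<^sup>2 / 2 + 2 * (s n)\<^sup>2\<close>, whence
  Doob's constant 4.\<close>

lemma pathwise_doob:
  assumes "s 0 = 0"
  shows "(running_max s n)\<^sup>2
    \<le> 4 * (s n)\<^sup>2 - 4 * (\<Sum>k<n. running_max s k * (s (Suc k) - s k))"
proof -
  have "(running_max s n - 2 * s n)\<^sup>2 \<ge> 0" by simp
  with pathwise_doob_aux[of s, OF assms, of n] show ?thesis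
    by (simp add: power2_eq_square algebra_simps)
qed

context sign_family
begin

lemma hoeffding_signs:
  assumes "finite J" "J \<subseteq> I" "(\<Sum>i\<in>J. (c i)\<^sup>2) \<le> v" "v > 0" "a \<ge> 0"
  shows "prob {\<omega> \<in> space M. \<bar>\<Sum>i\<in>J. c i * \<sigma> i \<omega>\<bar> \<ge> a} \<le> 2 * exp (- (a\<^sup>2 / (2 * v)))"
proof (cases "(\<Sum>i\<in>J. (c i)\<^sup>2) > 0")
  case True
  have ind: "indep_vars (\<lambda>_. borel) (\<lambda>i \<omega>. c i * \<sigma> i \<omega>) J"
    by (rule indep_blocks[where L = "\<lambda>i. {i}"])
       (use assms in \<open>auto simp: disjoint_family_on_def intro!: dependsI\<close>)
  interpret hb: indep_interval_bounded_random_variables M J "\<lambda>i \<omega>. c i * \<sigma> i \<omega>" "\<lambda>i. - \<bar>c i\<bar>" "\<lambda>i. \<bar>c i\<bar>"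
  proof
    fix i assume "i \<in> J"
    have "c i * \<sigma> i \<omega> \<in> {- \<bar>c i\<bar>..\<bar>c i\<bar>}" for \<omega>
      using sign_values[of i \<omega>] by (auto simp: abs_if)
    then show "AE \<omega> in M. c i * \<sigma> i \<omega> \<in> {- \<bar>c i\<bar>..\<bar>c i\<bar>}"
      by (intro AE_I2)
  qed (use assms(1) ind in auto)
  define \<mu> where "\<mu> = (\<Sum>i\<in>J. expectation (\<lambda>\<omega>. c i * \<sigma> i \<omega>))"
  interpret hh: Hoeffding_ineq M J "\<lambda>i \<omega>. c i * \<sigma> i \<omega>" "\<lambda>i. - \<bar>c i\<bar>" "\<lambda>i. \<bar>c i\<bar>" \<mu>
    by unfold_locales (simp add: \<mu>_def)
  have \<mu>0: "\<mu> = 0"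
    unfolding \<mu>_def using sign_mean assms(2) by (intro sum.neutral) auto
  have sq: "(\<bar>c i\<bar> - - \<bar>c i\<bar>)\<^sup>2 = 4 * (c i)\<^sup>2" for i
    by (simp add: power2_eq_square)
  have s: "(\<Sum>i\<in>J. (\<bar>c i\<bar> - - \<bar>c i\<bar>)\<^sup>2) = 4 * (\<Sum>i\<in>J. (c i)\<^sup>2)"
    unfolding sq by (simp add: sum_distrib_left)
  have "prob {\<omega> \<in> space M. \<bar>(\<Sum>i\<in>J. c i * \<sigma> i \<omega>) - \<mu>\<bar> \<ge> a}
      \<le> 2 * exp (- 2 * a\<^sup>2 / (4 * (\<Sum>i\<in>J. (c i)\<^sup>2)))"
    using hh.Hoeffding_ineq_abs_ge[OF assms(5)] True unfolding s by simp
  also have "- 2 * a\<^sup>2 / (4 * (\<Sum>i\<in>J. (c i)\<^sup>2)) \<le> - (a\<^sup>2 / (2 * v))"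
    using True assms(3) by (simp add: frac_le)
  finally show ?thesis by (simp add: \<mu>0)
next
  \<comment> \<open>Degenerate case: all weights vanish, so the event is empty unless
    \<open>a = 0\<close>, where the bound equals 2.\<close>
  case False
  then have "(\<Sum>i\<in>J. (c i)\<^sup>2) = 0"
    by (meson antisym_conv1 not_le sum_nonneg zero_le_power2 antisym)
  then have c0: "\<forall>i\<in>J. c i = 0"
    using assms(1) by (simp add: sum_nonneg_eq_0_iff)
  show ?thesis
  proof (cases "a = 0")
    case True
    then show ?thesis by (simp add: prob_space)
  next
    case False
    then show ?thesis using c0 assms(5) by simp
  qed
qed

lemma hoeffding_blocks:
  fixes F :: "'j \<Rightarrow> 'a \<Rightarrow> real"
  assumes "finite J" "J \<noteq> {}" "\<And>j. j \<in> J \<Longrightarrow> finite (L j)" "\<And>j. j \<in> J \<Longrightarrow> L j \<subseteq> I"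
    and "disjoint_family_on L J" "\<And>j. j \<in> J \<Longrightarrow> depends (L j) (F j)"
    and range: "\<And>j \<omega>. j \<in> J \<Longrightarrow> \<omega> \<in> space M \<Longrightarrow> F j \<omega> \<in> {0..a}"
    and "a > 0" "\<epsilon> \<ge> 0"
  shows "prob {\<omega> \<in> space M. (\<Sum>j\<in>J. F j \<omega>) \<ge> (\<Sum>j\<in>J. expectation (F j)) + \<epsilon>}
      \<le> exp (- 2 * \<epsilon>\<^sup>2 / (real (card J) * a\<^sup>2))"
    and "prob {\<omega> \<in> space M. (\<Sum>j\<in>J. F j \<omega>) \<le> (\<Sum>j\<in>J. expectation (F j)) - \<epsilon>}
      \<le> exp (- 2 * \<epsilon>\<^sup>2 / (real (card J) * a\<^sup>2))"
proof -
  have ind: "indep_vars (\<lambda>_. borel) F J"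
    by (rule indep_blocks[where L = L]) (use assms in auto)
  interpret hb: indep_interval_bounded_random_variables M J F "\<lambda>_. 0" "\<lambda>_. a"
    by unfold_locales (use assms(1) ind range in \<open>auto intro!: AE_I2\<close>)
  interpret hh: Hoeffding_ineq M J F "\<lambda>_. 0" "\<lambda>_. a" "\<Sum>j\<in>J. expectation (F j)"
    by unfold_locales
  have pos: "(\<Sum>j\<in>J. (a - 0)\<^sup>2) > 0"
    using assms(1,2,8) by (simp add: card_gt_0_iff)
  show "prob {\<omega> \<in> space M. (\<Sum>j\<in>J. F j \<omega>) \<ge> (\<Sum>j\<in>J. expectation (F j)) + \<epsilon>}
      \<le> exp (- 2 * \<epsilon>\<^sup>2 / (real (card J) * a\<^sup>2))"
    using hh.Hoeffding_ineq_ge[OF assms(9) pos] by simp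
  show "prob {\<omega> \<in> space M. (\<Sum>j\<in>J. F j \<omega>) \<le> (\<Sum>j\<in>J. expectation (F j)) - \<epsilon>}
      \<le> exp (- 2 * \<epsilon>\<^sup>2 / (real (card J) * a\<^sup>2))"
    using hh.Hoeffding_ineq_le[OF assms(9) pos] by simp
qed

text \<open>A polynomial minorant replaces Cauchy-Schwarz: for \<open>x = W\<^sup>2 / v\<close> the
  indicator of \<open>x \<ge> 1 / 4\<close> dominates
  \<open>(x - 1 / 4) / 2 - x\<^sup>2 / 16\<close>, whose mean is at least
  \<open>3 / 8 - 3 / 16\<close> by the two moments.\<close>

lemma paley_zygmund_signs:
  assumes "finite J" "J \<subseteq> I" "(\<Sum>i\<in>J. (c i)\<^sup>2) = v" "v > 0"
  shows "prob {\<omega> \<in> space M. (\<Sum>i\<in>J. c i * \<sigma> i \<omega>)\<^sup>2 \<ge> v / 4} \<ge> 3 / 16"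
proof -
  define W where "W \<omega> = (\<Sum>i\<in>J. c i * \<sigma> i \<omega>)" for \<omega>
  define A where "A = {\<omega> \<in> space M. (W \<omega>)\<^sup>2 \<ge> v / 4}"
  have dW: "depends J (\<lambda>\<omega>. f (W \<omega>))" for f :: "real \<Rightarrow> 'c"
    unfolding W_def by (auto intro!: dependsI sum.cong arg_cong[where f = f])
  note IW = depends_integrable[OF assms(1,2) dW]
  have A: "A \<in> events"
    unfolding A_def by (rule depends_event[OF assms(1,2) dW])
  have z: "(x - 1 / 4) / 2 - x\<^sup>2 / 16 \<le> (if x \<ge> 1 / 4 then 1 else 0)" for x :: real
  proof -
    have "(x - 1 / 4) / 2 - x\<^sup>2 / 16 \<le> 1"
      using zero_le_power2[of "x - 4"] by (simp add: power2_eq_square algebra_simps)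
    moreover have "(x - 1 / 4) / 2 - x\<^sup>2 / 16 \<le> 0" if "x < 1 / 4"
    proof -
      have "(x - 1 / 4) / 2 \<le> 0" "x\<^sup>2 / 16 \<ge> 0" using that by simp_all
      then show ?thesis by linarith
    qed
    ultimately show ?thesis by auto
  qed
  have m: "expectation (\<lambda>\<omega>. (W \<omega>)\<^sup>2) = v" "expectation (\<lambda>\<omega>. (W \<omega>)^4) \<le> 3 * v\<^sup>2"
    using weighted_sum_moments[OF assms(1,2), of c] assms(3) by (auto simp: W_def)
  have "3 / 16 \<le> (expectation (\<lambda>\<omega>. (W \<omega>)\<^sup>2) / v - 1 / 4) / 2 - expectation (\<lambda>\<omega>. (W \<omega>)^4) / (16 * v\<^sup>2)"
    using m assms(4) by (simp add: field_simps)
  also have "\<dots> = expectation (\<lambda>\<omega>. ((W \<omega>)\<^sup>2 / v - 1 / 4) / 2 - (W \<omega>)^4 / (16 * v\<^sup>2))"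
    using IW[of "\<lambda>x. x\<^sup>2"] IW[of "\<lambda>x. x^4"] by (simp add: prob_space)
  also have "\<dots> \<le> expectation (indicator A)"
  proof (rule integral_mono_AE)
    show "AE \<omega> in M. ((W \<omega>)\<^sup>2 / v - 1 / 4) / 2 - (W \<omega>)^4 / (16 * v\<^sup>2) \<le> indicator A \<omega>"
    proof (rule AE_I2)
      fix \<omega> assume "\<omega> \<in> space M"
      then show "((W \<omega>)\<^sup>2 / v - 1 / 4) / 2 - (W \<omega>)^4 / (16 * v\<^sup>2) \<le> indicator A \<omega>"
        using z[of "(W \<omega>)\<^sup>2 / v"] assms(4)
        by (auto simp: A_def indicator_def power_divide field_simps split: if_splits)
    qed
  qed (use A IW[of "\<lambda>x. (x\<^sup>2 / v - 1 / 4) / 2 - x^4 / (16 * v\<^sup>2)"] in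
      \<open>auto intro!: integrable_real_indicator simp: emeasure_eq_measure\<close>)
  also have "\<dots> = prob A" using A by simp
  finally show ?thesis by (simp add: A_def W_def)
qed

text \<open>\<open>\<iota>\<close> is the order in which the signs are revealed, so the past of the
  walk is a function of an initial segment of signs.\<close>

definition walk :: "(nat \<Rightarrow> 'i) \<Rightarrow> (nat \<Rightarrow> real) \<Rightarrow> nat \<Rightarrow> 'a \<Rightarrow> real" where
  "walk \<iota> c k \<omega> = (\<Sum>j<k. c j * \<sigma> (\<iota> j) \<omega>)"

lemma depends_walk_upto:
  assumes "\<And>s s'. (\<And>k. k \<le> n \<Longrightarrow> s k = s' k) \<Longrightarrow> f s = f s'"
  shows "depends (\<iota> ` {..<n}) (\<lambda>\<omega>. f (\<lambda>k. walk \<iota> c k \<omega>))"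
  by (rule dependsI, rule assms) (auto simp: walk_def intro!: sum.cong)

text \<open>On taking expectations in \<open>pathwise_doob\<close>, each summand is a maximum over
  the past times a fresh sign and vanishes; only the final square survives.\<close>

lemma doob_walk:
  assumes "inj_on \<iota> {..<n}" "\<iota> ` {..<n} \<subseteq> I"
  shows "expectation (\<lambda>\<omega>. (running_max (\<lambda>k. walk \<iota> c k \<omega>) n)\<^sup>2) \<le> 4 * (\<Sum>j<n. (c j)\<^sup>2)"
proof -
  let ?s = "\<lambda>\<omega> k. walk \<iota> c k \<omega>"
  have int: "integrable M (\<lambda>\<omega>. f (?s \<omega>))"
    if "\<And>s s'. (\<And>k. k \<le> n \<Longrightarrow> s k = s' k) \<Longrightarrow> f s = f s'" for f :: "(nat \<Rightarrow> real) \<Rightarrow> real"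
    using assms by (intro depends_integrable[OF _ _ depends_walk_upto[where n = n]] that) auto
  have inc: "?s \<omega> (Suc k) - ?s \<omega> k = c k * \<sigma> (\<iota> k) \<omega>" for \<omega> k
    by (simp add: walk_def)
  have sq: "expectation (\<lambda>\<omega>. (?s \<omega> n)\<^sup>2) = (\<Sum>j<n. (c j)\<^sup>2)"
  proof -
    \<comment> \<open>Indexed by the signs themselves, with weights pulled back along the inverse of
      \<open>\<iota>\<close>, the walk fits \<open>weighted_sum_moments\<close>.\<close>
    have "walk \<iota> c n \<omega> = (\<Sum>i\<in>\<iota> ` {..<n}. c (the_inv_into {..<n} \<iota> i) * \<sigma> i \<omega>)" for \<omega>
      unfolding walk_def using assms(1) by (subst sum.reindex) (auto simp: the_inv_into_f_f intro!: sum.cong)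
    moreover have "(\<Sum>i\<in>\<iota> ` {..<n}. (c (the_inv_into {..<n} \<iota> i))\<^sup>2) = (\<Sum>j<n. (c j)\<^sup>2)"
      using assms(1) by (subst sum.reindex) (auto simp: the_inv_into_f_f intro!: sum.cong)
    ultimately show ?thesis
      using weighted_sum_moments(1)[of "\<iota> ` {..<n}"] assms(2) by simp
  qed
  have zero: "expectation (\<lambda>\<omega>. running_max (?s \<omega>) k * (c k * \<sigma> (\<iota> k) \<omega>)) = 0" if "k < n" for k
  proof -
    have "expectation (\<lambda>\<omega>. running_max (?s \<omega>) k * \<sigma> (\<iota> k) \<omega>) = 0"
      by (rule fresh_sign[of "\<iota> ` {..<k}"])
         (use assms(2) that inj_onD[OF assms(1), of k] in
             \<open>auto intro!: depends_walk_upto running_max_cong dest: order.strict_trans\<close>)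
    then show ?thesis by (simp add: mult.left_commute[of _ "c k"])
  qed
  have i1: "integrable M (\<lambda>\<omega>. running_max (?s \<omega>) k * (c k * \<sigma> (\<iota> k) \<omega>))" if "k < n" for k
    unfolding inc[symmetric]
    by (rule int) (use that in \<open>auto intro!: arg_cong2[where f = "(*)"] running_max_cong\<close>)
  have i2: "integrable M (\<lambda>\<omega>. (?s \<omega> n)\<^sup>2)" by (rule int) auto
  have S: "integrable M (\<lambda>\<omega>. \<Sum>k<n. running_max (?s \<omega>) k * (c k * \<sigma> (\<iota> k) \<omega>))"
    by (intro Bochner_Integration.integrable_sum i1) simp
  have S0: "expectation (\<lambda>\<omega>. \<Sum>k<n. running_max (?s \<omega>) k * (c k * \<sigma> (\<iota> k) \<omega>)) = 0"
    by (subst Bochner_Integration.integral_sum) (use i1 zero in auto)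
  have "expectation (\<lambda>\<omega>. (running_max (?s \<omega>) n)\<^sup>2)
      \<le> expectation (\<lambda>\<omega>. 4 * (?s \<omega> n)\<^sup>2 - 4 * (\<Sum>k<n. running_max (?s \<omega>) k * (c k * \<sigma> (\<iota> k) \<omega>)))"
  proof (rule integral_mono)
    show "integrable M (\<lambda>\<omega>. (running_max (?s \<omega>) n)\<^sup>2)"
      by (rule int) (auto intro!: arg_cong[where f = "\<lambda>x. x\<^sup>2"] running_max_cong)
    show "integrable M (\<lambda>\<omega>. 4 * (?s \<omega> n)\<^sup>2 - 4 * (\<Sum>k<n. running_max (?s \<omega>) k * (c k * \<sigma> (\<iota> k) \<omega>)))"
      using i2 S by simp
    show "(running_max (?s \<omega>) n)\<^sup>2 \<le> 4 * (?s \<omega> n)\<^sup>2 - 4 * (\<Sum>k<n. running_max (?s \<omega>) k * (c k * \<sigma> (\<iota> k) \<omega>))" for \<omega>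
      using pathwise_doob[of "?s \<omega>" n] by (simp add: inc walk_def[of _ _ 0])
  qed
  also have "\<dots> = 4 * (\<Sum>j<n. (c j)\<^sup>2)"
    using i2 S S0 sq by simp
  finally show ?thesis .
qed

text \<open>The maximal modulus is attained by the walk or by its negative, the walk with weights
  \<open>- c\<close>. This doubles the constant.\<close>

lemma doob_abs_walk:
  assumes "inj_on \<iota> {..<n}" "\<iota> ` {..<n} \<subseteq> I"
  shows "expectation (\<lambda>\<omega>. (running_max (\<lambda>k. \<bar>walk \<iota> c k \<omega>\<bar>) n)\<^sup>2) \<le> 8 * (\<Sum>j<n. (c j)\<^sup>2)"
proof -
  let ?s = "\<lambda>c \<omega> k. walk \<iota> c k \<omega>"
  let ?c = "\<lambda>j. - c j"
  have int: "integrable M (\<lambda>\<omega>. f (?s c \<omega>))"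
    if "\<And>s s'. (\<And>k. k \<le> n \<Longrightarrow> s k = s' k) \<Longrightarrow> f s = f s'" for f :: "(nat \<Rightarrow> real) \<Rightarrow> real" and c
    using assms by (intro depends_integrable[OF _ _ depends_walk_upto[where n = n]] that) auto
  have i: "integrable M (\<lambda>\<omega>. (running_max (?s c \<omega>) n)\<^sup>2)" for c
    by (rule int) (auto intro!: arg_cong[where f = "\<lambda>x. x\<^sup>2"] running_max_cong)
  have "expectation (\<lambda>\<omega>. (running_max (\<lambda>k. \<bar>?s c \<omega> k\<bar>) n)\<^sup>2)
      \<le> expectation (\<lambda>\<omega>. (running_max (?s c \<omega>) n)\<^sup>2 + (running_max (?s ?c \<omega>) n)\<^sup>2)"
  proof (rule integral_mono)
    show "integrable M (\<lambda>\<omega>. (running_max (\<lambda>k. \<bar>?s c \<omega> k\<bar>) n)\<^sup>2)"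
      by (rule int[of "\<lambda>s. (running_max (\<lambda>k. \<bar>s k\<bar>) n)\<^sup>2"])
         (auto intro!: arg_cong[where f = "\<lambda>x. x\<^sup>2"] running_max_cong)
    fix \<omega>
    obtain k where k: "k \<le> n" "running_max (\<lambda>k. \<bar>?s c \<omega> k\<bar>) n = \<bar>?s c \<omega> k\<bar>"
      using running_max_attained by blast
    have neg: "?s ?c \<omega> k = - ?s c \<omega> k"
      by (simp add: walk_def sum_negf)
    show "(running_max (\<lambda>k. \<bar>?s c \<omega> k\<bar>) n)\<^sup>2 \<le> (running_max (?s c \<omega>) n)\<^sup>2 + (running_max (?s ?c \<omega>) n)\<^sup>2"
    proof (cases "?s c \<omega> k \<ge> 0")
      case True
      then have "(?s c \<omega> k)\<^sup>2 \<le> (running_max (?s c \<omega>) n)\<^sup>2"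
        using running_max_ge[OF k(1), of "?s c \<omega>"] by (intro power_mono) auto
      then show ?thesis unfolding k(2) by (simp add: add_increasing2)
    next
      case False
      then have "(?s ?c \<omega> k)\<^sup>2 \<le> (running_max (?s ?c \<omega>) n)\<^sup>2"
        using running_max_ge[OF k(1), of "?s ?c \<omega>"] neg by (intro power_mono) auto
      then show ?thesis unfolding k(2) neg by (simp add: add_increasing)
    qed
  qed (use i in auto)
  also have "\<dots> \<le> 8 * (\<Sum>j<n. (c j)\<^sup>2)"
    using doob_walk[OF assms, of c] doob_walk[OF assms, of ?c] i by simp
  finally show ?thesis .
qed

lemma maximal_inequality_walk:
  assumes "inj_on \<iota> {..<n}" "\<iota> ` {..<n} \<subseteq> I" "a > 0"
  shows "prob {\<omega> \<in> space M. running_max (\<lambda>k. \<bar>walk \<iota> c k \<omega>\<bar>) n \<ge> a} \<le> 8 * (\<Sum>j<n. (c j)\<^sup>2) / a\<^sup>2"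
proof -
  let ?m = "\<lambda>\<omega>. running_max (\<lambda>k. \<bar>walk \<iota> c k \<omega>\<bar>) n"
  have dep: "depends (\<iota> ` {..<n}) (\<lambda>\<omega>. f (?m \<omega>))" for f :: "real \<Rightarrow> 'c"
    by (rule depends_walk_upto[where f = "\<lambda>s. f (running_max (\<lambda>k. \<bar>s k\<bar>) n)"])
       (auto intro!: arg_cong[where f = f] running_max_cong)
  have i: "integrable M (\<lambda>\<omega>. (?m \<omega>)\<^sup>2)"
    by (rule depends_integrable[OF _ _ dep]) (use assms in auto)
  have "?m \<omega> \<ge> 0" for \<omega>
    using running_max_ge[of 0 n "\<lambda>k. \<bar>walk \<iota> c k \<omega>\<bar>"] by linarith
  then have "?m \<omega> \<ge> a \<longleftrightarrow> (?m \<omega>)\<^sup>2 \<ge> a\<^sup>2" for \<omega>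
    using assms(3) by (simp add: abs_le_square_iff[symmetric])
  then have "prob {\<omega> \<in> space M. ?m \<omega> \<ge> a} = prob {\<omega> \<in> space M. (?m \<omega>)\<^sup>2 \<ge> a\<^sup>2}"
    by simp
  also have "\<dots> \<le> expectation (\<lambda>\<omega>. (?m \<omega>)\<^sup>2) / a\<^sup>2"
    by (rule integral_Markov_inequality_measure[OF i, of "{}"]) (use assms in auto)
  also have "\<dots> \<le> 8 * (\<Sum>j<n. (c j)\<^sup>2) / a\<^sup>2"
    by (intro divide_right_mono doob_abs_walk assms) auto
  finally show ?thesis .
qed

end

section \<open>The process for fixed stacks\<close>

definition partial_sum :: "(nat \<Rightarrow> int) \<Rightarrow> nat \<Rightarrow> int" where
  "partial_sum f k = (\<Sum>i=1..k. f i)"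

lemma partial_sum_0 [simp]: "partial_sum f 0 = 0"
  by (simp add: partial_sum_def)

lemma partial_sum_Suc: "partial_sum f (Suc k) = partial_sum f k + f (Suc k)"
  by (simp add: partial_sum_def)

text \<open>After \<open>k\<close> firings a site has sent \<open>(k + partial_sum) / 2\<close>
  particles to the right and \<open>(k - partial_sum) / 2\<close> to the left. The balance is
  doubled to stay within the integers.\<close>

definition balanced :: "nat \<Rightarrow> (int \<Rightarrow> nat \<Rightarrow> int) \<Rightarrow> (int \<Rightarrow> nat) \<Rightarrow> (int \<Rightarrow> nat) \<Rightarrow> bool" where
  "balanced n X \<eta> u \<longleftrightarrow>
    (\<forall>x. 2 * int (\<eta> x) = (if x = 0 then 2 * int n else 0)
      + (int (u (x - 1)) + partial_sum (X (x - 1)) (u (x - 1)))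
      + (int (u (x + 1)) - partial_sum (X (x + 1)) (u (x + 1))) - 2 * int (u x))"

text \<open>Only \<open>y\<close> and its two neighbours are affected. A jump to the right raises
  \<open>u + partial_sum\<close> at \<open>y\<close> by 2 and keeps \<open>u - partial_sum\<close>;
  a jump to the left does the opposite.\<close>

lemma balanced_move:
  assumes "balanced n X \<eta> u" "\<eta> y \<ge> 1" "X y (u y + 1) \<in> {1, -1}"
  shows "balanced n X (move_particle y (y + X y (u y + 1)) \<eta>) (u(y := u y + 1))"
  unfolding balanced_def
proof
  fix x
  have b: "2 * int (\<eta> x) = (if x = 0 then 2 * int n else 0)
      + (int (u (x - 1)) + partial_sum (X (x - 1)) (u (x - 1)))
      + (int (u (x + 1)) - partial_sum (X (x + 1)) (u (x + 1))) - 2 * int (u x)"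
    using assms(1) unfolding balanced_def by blast
  define d where "d = X y (u y + 1)"
  have d: "d = 1 \<or> d = -1" using assms(3) by (simp add: d_def)
  consider "x = y" | "x = y + 1" | "x = y - 1" | "x \<noteq> y" "x - 1 \<noteq> y" "x + 1 \<noteq> y"
    by linarith
  then show "2 * int (move_particle y (y + X y (u y + 1)) \<eta> x) = (if x = 0 then 2 * int n else 0)
      + (int ((u(y := u y + 1)) (x - 1)) + partial_sum (X (x - 1)) ((u(y := u y + 1)) (x - 1)))
      + (int ((u(y := u y + 1)) (x + 1)) - partial_sum (X (x + 1)) ((u(y := u y + 1)) (x + 1)))
      - 2 * int ((u(y := u y + 1)) x)"
  proof cases
    case 1
    have "int (move_particle y (y + d) \<eta> y) = int (\<eta> y) - 1"
      using d assms(2) by (elim disjE) (simp_all add: move_particle_def Let_def of_nat_diff)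
    then show ?thesis
      using b 1 by (simp add: d_def)
  next
    case 2
    have "int (move_particle y (y + d) \<eta> (y + 1)) = int (\<eta> (y + 1)) + (if d = 1 then 1 else 0)"
      using d by (elim disjE) (simp_all add: move_particle_def Let_def)
    then show ?thesis
      using b d by (elim disjE) (simp_all add: 2 d_def partial_sum_Suc)
  next
    case 3
    have "int (move_particle y (y + d) \<eta> (y - 1)) = int (\<eta> (y - 1)) + (if d = 1 then 0 else 1)"
      using d by (elim disjE) (simp_all add: move_particle_def Let_def)
    then show ?thesis
      using b d by (elim disjE) (simp_all add: 3 d_def partial_sum_Suc)
  next
    case 4
    then have "move_particle y (y + d) \<eta> x = \<eta> x"
      using d by (elim disjE) (simp_all add: move_particle_def Let_def)
    then show ?thesis
      using b 4 by (simp add: d_def)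
  qed
qed

lemma state_at_0 [simp]: "state_at n X Y 0 = initial_state n"
  by (simp add: state_at_def)

lemma state_at_Suc: "state_at n X Y (Suc t) = step X Y (state_at n X Y t)"
  by (simp add: state_at_def)

lemma step_stopped: "stopped s \<Longrightarrow> step X Y s = s"
  by (simp add: step_def)

lemma step_not_stopped:
  assumes "\<not> stopped s"
  shows "oil (step X Y s) = move_particle (leftmost s) (leftmost s + X (leftmost s) (fired s (leftmost s) + 1)) (oil s)"
    and "water (step X Y s) = move_particle (leftmost s) (leftmost s + Y (leftmost s) (fired s (leftmost s) + 1)) (water s)"
    and "fired (step X Y s) = (fired s)(leftmost s := fired s (leftmost s) + 1)"
  using assms by (simp_all add: step_def Let_def)

lemma fired_step_mono: "fired s x \<le> fired (step X Y s) x"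
  by (cases "stopped s") (simp_all add: step_stopped step_not_stopped)

lemma fired_step_le: "fired (step X Y s) x \<le> fired s x + 1"
  by (cases "stopped s") (simp_all add: step_stopped step_not_stopped)

lemma fired_mono: "t \<le> t' \<Longrightarrow> fired (state_at n X Y t) x \<le> fired (state_at n X Y t') x"
  by (induction t' rule: dec_induct) (auto simp: state_at_Suc intro: order_trans fired_step_mono)

lemma state_at_stopped: "t \<le> t' \<Longrightarrow> stopped (state_at n X Y t) \<Longrightarrow> state_at n X Y t' = state_at n X Y t"
  by (induction t' rule: dec_induct) (simp_all add: state_at_Suc step_stopped)

text \<open>An entry that is read is counted in \<open>fired\<close> from then on, so entries beyond
  the current counters cannot have influenced the trajectory. This is the stopping-time property of
  the stacks.\<close>

lemma state_at_cong:
  assumes "\<And>x k. 1 \<le> k \<Longrightarrow> k \<le> fired (state_at n X Y t) x \<Longrightarrow> X x k = X' x k \<and> Y x k = Y' x k"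
  shows "state_at n X' Y' t = state_at n X Y t"
  using assms
proof (induction t)
  case 0
  then show ?case by simp
next
  case (Suc t)
  let ?s = "state_at n X Y t"
  have IH: "state_at n X' Y' t = ?s"
  proof (rule Suc.IH)
    fix x k assume "1 \<le> k" "k \<le> fired ?s x"
    moreover have "fired ?s x \<le> fired (state_at n X Y (Suc t)) x"
      by (rule fired_mono) simp
    ultimately show "X x k = X' x k \<and> Y x k = Y' x k"
      by (intro Suc.prems) linarith+
  qed
  have "step X' Y' ?s = step X Y ?s"
  proof (cases "stopped ?s")
    case False
    let ?y = "leftmost ?s"
    have "fired (state_at n X Y (Suc t)) ?y = fired ?s ?y + 1"
      using False by (simp add: state_at_Suc step_not_stopped)
    then have "X ?y (fired ?s ?y + 1) = X' ?y (fired ?s ?y + 1) \<and> Y ?y (fired ?s ?y + 1) = Y' ?y (fired ?s ?y + 1)"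
      by (intro Suc.prems) auto
    then show ?thesis
      using False by (simp add: step_def Let_def)
  qed (simp add: step_stopped)
  then show ?case by (simp add: state_at_Suc IH)
qed

locale stacks =
  fixes n :: nat and X Y :: "int \<Rightarrow> nat \<Rightarrow> int"
  assumes X_values: "X x k \<in> {1, -1}" and Y_values: "Y x k \<in> {1, -1}"
begin

abbreviation st :: "nat \<Rightarrow> ow_state" where
  "st t \<equiv> state_at n X Y t"

lemma support:
  assumes "\<bar>x\<bar> > int t"
  shows "oil (st t) x = 0" "water (st t) x = 0" "fired (st t) x = 0"
proof -
  have "\<forall>x. \<bar>x\<bar> > int t \<longrightarrow> oil (st t) x = 0 \<and> water (st t) x = 0 \<and> fired (st t) x = 0"
  proof (induction t)
    case 0
    then show ?case by (simp add: initial_state_def)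
  next
    case (Suc t)
    show ?case
    proof (cases "stopped (st t)")
      case True
      then show ?thesis using Suc by (simp add: state_at_Suc step_stopped)
    next
      case False
      let ?y = "leftmost (st t)"
      let ?C = "{x. can_fire (st t) x}"
      have "?C \<subseteq> {- int t..int t}"
      proof
        fix x assume "x \<in> ?C"
        then have "oil (st t) x \<noteq> 0" by (simp add: can_fire_def)
        then have "\<not> \<bar>x\<bar> > int t" using Suc[rule_format, of x] by linarith
        then show "x \<in> {- int t..int t}" unfolding atLeastAtMost_iff by linarith
      qed
      then have fin: "finite ?C" by (rule finite_subset) simp
      have ex: "\<exists>x. can_fire (st t) x"
        using False by (simp add: stopped_def)
      \<comment> \<open>On the integers \<open>LEAST\<close> is informative only for sets with a
        minimum; the bounded support of the particles supplies it.\<close>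
      have "?y = Min ?C"
        unfolding leftmost_def by (rule Least_Min[OF fin ex])
      then have "can_fire (st t) ?y"
        using Min_in[OF fin] ex by auto
      then have "oil (st t) ?y \<noteq> 0" unfolding can_fire_def by linarith
      then have "\<not> \<bar>?y\<bar> > int t" using Suc[rule_format, of ?y] by linarith
      then have y: "\<bar>?y\<bar> \<le> int t" by simp
      have move: "move_particle ?y z \<eta> x = 0"
        if "\<eta> x = 0" "\<bar>z\<bar> \<le> int t + 1" "\<bar>x\<bar> > int (Suc t)" for z x \<eta>
      proof -
        have "x \<noteq> ?y" "x \<noteq> z" using that(2,3) y by linarith+
        then show ?thesis using that(1) by (simp add: move_particle_def)
      qed
      have d: "\<bar>?y + X ?y k\<bar> \<le> int t + 1" "\<bar>?y + Y ?y k\<bar> \<le> int t + 1" for k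
        using y X_values[of ?y k] Y_values[of ?y k] by auto
      show ?thesis
      proof (intro allI impI)
        fix x assume x: "\<bar>x\<bar> > int (Suc t)"
        then have z: "oil (st t) x = 0" "water (st t) x = 0" "fired (st t) x = 0"
          using Suc[rule_format, of x] by linarith+
        have "x \<noteq> ?y" using x y by linarith
        then show "oil (st (Suc t)) x = 0 \<and> water (st (Suc t)) x = 0 \<and> fired (st (Suc t)) x = 0"
          unfolding state_at_Suc step_not_stopped[OF False]
          using move[where \<eta> = "oil (st t)", OF z(1) d(1) x] move[where \<eta> = "water (st t)", OF z(2) d(2) x] z(3)
          by simp
      qed
    qed
  qed
  then show "oil (st t) x = 0" "water (st t) x = 0" "fired (st t) x = 0"
    using assms by auto
qed

lemma leftmost_can_fire:
  assumes "\<not> stopped (st t)"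
  shows "oil (st t) (leftmost (st t)) \<ge> 1" "water (st t) (leftmost (st t)) \<ge> 1"
proof -
  let ?C = "{x. can_fire (st t) x}"
  have "?C \<subseteq> {- int t..int t}"
  proof
    fix x assume "x \<in> ?C"
    then have "oil (st t) x \<noteq> 0" by (simp add: can_fire_def)
    then have "\<not> \<bar>x\<bar> > int t" using support(1)[of t x] by linarith
    then show "x \<in> {- int t..int t}" unfolding atLeastAtMost_iff by linarith
  qed
  then have fin: "finite ?C" by (rule finite_subset) simp
  have ex: "\<exists>x. can_fire (st t) x"
    using assms by (simp add: stopped_def)
  have "leftmost (st t) = Min ?C"
    unfolding leftmost_def by (rule Least_Min[OF fin ex])
  then have "can_fire (st t) (leftmost (st t))"
    using Min_in[OF fin] ex by auto
  then show "oil (st t) (leftmost (st t)) \<ge> 1" "water (st t) (leftmost (st t)) \<ge> 1"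
    by (simp_all add: can_fire_def)
qed

lemma fired_le: "fired (st t) x \<le> t"
proof (induction t)
  case (Suc t)
  then show ?case
    using fired_step_le[of X Y "st t" x] by (simp add: state_at_Suc)
qed (simp add: initial_state_def)

lemma balanced_state:
  "balanced n X (oil (st t)) (fired (st t))" "balanced n Y (water (st t)) (fired (st t))"
proof (induction t)
  case 0
  {
    case 1
    then show ?case by (simp add: balanced_def initial_state_def)
  next
    case 2
    then show ?case by (simp add: balanced_def initial_state_def)
  }
next
  case (Suc t)
  {
    case 1
    show ?case
    proof (cases "stopped (st t)")
      case True
      then show ?thesis using Suc.IH(1) by (simp add: state_at_Suc step_stopped)
    next
      case False
      show ?thesis
        unfolding state_at_Suc step_not_stopped[OF False]
        by (rule balanced_move[OF Suc.IH(1) leftmost_can_fire(1)[OF False] X_values])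
    qed
  next
    case 2
    show ?case
    proof (cases "stopped (st t)")
      case True
      then show ?thesis using Suc.IH(2) by (simp add: state_at_Suc step_stopped)
    next
      case False
      show ?thesis
        unfolding state_at_Suc step_not_stopped[OF False]
        by (rule balanced_move[OF Suc.IH(2) leftmost_can_fire(2)[OF False] Y_values])
    qed
  }
qed

text \<open>Each step before stopping is one firing. Set against a bound on the single counters,
  this will force the process to stop.\<close>

lemma total_fired:
  assumes "\<And>j. j < t \<Longrightarrow> \<not> stopped (st j)" "t \<le> L"
  shows "(\<Sum>x\<in>{- int L..int L}. fired (st t) x) = t"
  using assms
proof (induction t)
  case 0
  then show ?case by (simp add: initial_state_def)
next
  case (Suc t)
  have ns: "\<not> stopped (st t)" using Suc.prems by simp
  let ?y = "leftmost (st t)"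
  have "\<not> \<bar>?y\<bar> > int t"
    using leftmost_can_fire(1)[OF ns] support(1)[of t ?y] by linarith
  then have y: "?y \<in> {- int L..int L}"
    unfolding atLeastAtMost_iff using Suc.prems(2) by linarith
  have "(\<Sum>x\<in>{- int L..int L}. fired (st (Suc t)) x)
      = (\<Sum>x\<in>{- int L..int L}. fired (st t) x + (if x = ?y then 1 else 0))"
    using ns by (intro sum.cong) (simp_all add: state_at_Suc step_not_stopped)
  also have "\<dots> = Suc t"
    using Suc y by (simp add: sum.distrib)
  finally show ?case .
qed

lemma fired_had_oil:
  assumes "fired (st t) x > 0"
  shows "\<exists>j<t. oil (st j) x \<ge> 1"
  using assms
proof (induction t)
  case 0
  then show ?case by (simp add: initial_state_def)
next
  case (Suc t)
  show ?case
  proof (cases "fired (st t) x > 0")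
    case True
    then show ?thesis using Suc.IH less_SucI by blast
  next
    case False
    then have "\<not> stopped (st t)" "x = leftmost (st t)"
      using Suc.prems by (auto simp: state_at_Suc step_def Let_def split: if_splits)
    then show ?thesis using leftmost_can_fire(1) by blast
  qed
qed

text \<open>The state is frozen from the first stopped time \<open>\<tau>\<close> on, and up to
  \<open>\<tau>\<close> the counters count the firing times. Hence any stopped time \<open>T\<close>
  may be used.\<close>

lemma odometer_eq_fired:
  assumes "stopped (st T)"
  shows "odometer n X Y x = enat (fired (st T) x)"
proof -
  define \<tau> where "\<tau> = (LEAST t. stopped (st t))"
  have \<tau>: "stopped (st \<tau>)"
    unfolding \<tau>_def using assms by (rule LeastI)
  have less: "\<not> stopped (st j)" if "j < \<tau>" for j
    using that not_less_Least unfolding \<tau>_def by blast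
  have "\<tau> \<le> t" if "stopped (st t)" for t
    using that unfolding \<tau>_def by (rule Least_le)
  then have "stop_time n X Y = enat \<tau>"
    unfolding stop_time_def using \<tau> by (intro antisym INF_lower INF_greatest) auto
  then have ft: "firing_times n X Y x = {t. t < \<tau> \<and> leftmost (st t) = x}"
    by (simp add: firing_times_def)
  have "card {t. t < m \<and> leftmost (st t) = x} = fired (st m) x" if "m \<le> \<tau>" for m
    using that
  proof (induction m)
    case 0
    then show ?case by (simp add: initial_state_def)
  next
    case (Suc m)
    have "{t. t < Suc m \<and> leftmost (st t) = x}
        = {t. t < m \<and> leftmost (st t) = x} \<union> (if leftmost (st m) = x then {m} else {})"
      by (auto simp: less_Suc_eq)
    moreover have "\<not> stopped (st m)" using less Suc.prems by simp
    moreover have "card {t. t < m \<and> leftmost (st t) = x} = fired (st m) x"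
      using Suc by simp
    ultimately show ?case
      by (cases "leftmost (st m) = x") (simp_all add: state_at_Suc step_not_stopped card_Un_disjoint)
  qed
  from this[of \<tau>] have "card (firing_times n X Y x) = fired (st \<tau>) x"
    by (simp add: ft)
  moreover have "\<tau> \<le> T"
    unfolding \<tau>_def using assms by (rule Least_le)
  then have "st T = st \<tau>"
    using \<tau> by (rule state_at_stopped)
  moreover have "finite (firing_times n X Y x)" by (simp add: ft)
  ultimately show ?thesis by (simp add: odometer_def)
qed

end

section \<open>Deterministic estimates for the shape of an odometer\<close>

text \<open>In a profile, \<open>u\<close> is the odometer, \<open>S\<close> and \<open>Z\<close> are half the difference and half the sum of
  the oil and water walks of a site, both stopped at \<open>u\<close>, and \<open>N\<close> is the number of particles of
  either type at a site. The first two assumptions express that the sum and the difference of the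
  numbers of oil and water particles at a site are determined by what its neighbours sent out.\<close>

locale profile =
  fixes n :: real and u S Z N :: "int \<Rightarrow> real"
  assumes N_eq: "N x = (if x = 0 then 2 * n else 0) + u (x - 1) + u (x + 1) - 2 * u x + Z (x - 1) - Z (x + 1)"
    and N_ge: "\<bar>S (x - 1) - S (x + 1)\<bar> \<le> N x"
    and u_nonneg: "u x \<ge> 0"
    and far: "\<exists>L>0. \<forall>x. \<bar>x\<bar> \<ge> L \<longrightarrow> u x = 0 \<and> Z x = 0"
begin

text \<open>The number of particles in \<open>{..x}\<close>, written as a net flux through the edge from \<open>x\<close> to
  \<open>x + 1\<close>.\<close>

definition flux :: "int \<Rightarrow> real" where
  "flux x = u (x + 1) - u x - Z x - Z (x + 1) + (if x \<ge> 0 then 2 * n else 0)"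

lemma flux_diff: "flux x - flux (x - 1) = N x"
  unfolding flux_def N_eq by auto

lemma N_nonneg: "N x \<ge> 0"
  using N_ge[of x] by linarith

lemma sum_N: "a \<le> b \<Longrightarrow> (\<Sum>x\<in>{a<..b}. N x) = flux b - flux a"
proof (induction b rule: int_ge_induct)
  case base
  then show ?case by simp
next
  case (step b)
  have "{a<..b + 1} = insert (b + 1) {a<..b}" using step by auto
  then show ?case using step flux_diff[of "b + 1"] by simp
qed

lemma flux_mono: "a \<le> b \<Longrightarrow> flux a \<le> flux b"
  using sum_N[of a b] sum_nonneg[of "{a<..b}" N] N_nonneg by simp

text \<open>The flux is monotone; by \<open>far\<close> it is 0 far to the left, and far to the
  right only the source term \<open>2 * n\<close> is left.\<close>

lemma flux_bounds: "0 \<le> flux x" "flux x \<le> 2 * n"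
proof -
  obtain L where L: "L > 0" "\<And>x. \<bar>x\<bar> \<ge> L \<Longrightarrow> u x = 0 \<and> Z x = 0"
    using far by blast
  have "flux (min x (- L - 1)) = 0"
    using L(1) L(2)[of "min x (- L - 1)"] L(2)[of "min x (- L - 1) + 1"] by (simp add: flux_def)
  then show "0 \<le> flux x"
    using flux_mono[of "min x (- L - 1)" x] by simp
  have "flux (max x L) = 2 * n"
    using L(1) L(2)[of "max x L"] L(2)[of "max x L + 1"] by (simp add: flux_def)
  then show "flux x \<le> 2 * n"
    using flux_mono[of x "max x L"] by simp
qed

lemma sum_N_le:
  assumes "finite F"
  shows "(\<Sum>x\<in>F. N x) \<le> 2 * n"
proof -
  obtain K where K: "\<And>x. x \<in> F \<Longrightarrow> \<bar>x\<bar> \<le> K"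
    using finite_imageI[OF assms, of abs] by (metis finite_has_maximal2 image_eqI Max_ge)
  define K' where "K' = \<bar>K\<bar> + 1"
  have "(\<Sum>x\<in>F. N x) \<le> (\<Sum>x\<in>{- K'<..K'}. N x)"
    using N_nonneg K by (intro sum_mono2) (fastforce simp: K'_def)+
  also have "\<dots> = flux K' - flux (- K')"
    by (rule sum_N) (simp add: K'_def)
  also have "\<dots> \<le> 2 * n"
    using flux_bounds[of K'] flux_bounds[of "- K'"] by linarith
  finally show ?thesis .
qed

lemma slope: "u (x + 1) - u x = flux x + Z x + Z (x + 1) - (if x \<ge> 0 then 2 * n else 0)"
  by (simp add: flux_def)

lemma slope_bound: "\<bar>u (x + 1) - u x\<bar> \<le> 2 * n + \<bar>Z x\<bar> + \<bar>Z (x + 1)\<bar>"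
  using slope[of x] flux_bounds[of x] by (auto simp: abs_if split: if_splits)

text \<open>Each edge contributes at most \<open>2 * n\<close> from the flux and
  \<open>n / 2\<close> from the noise at either end.\<close>

lemma slope_chain:
  assumes "a \<le> b" "\<And>y. a \<le> y \<Longrightarrow> y \<le> b \<Longrightarrow> \<bar>Z y\<bar> \<le> n / 2"
  shows "\<bar>u b - u a\<bar> \<le> 3 * n * real_of_int (b - a)"
  using assms
proof (induction b rule: int_ge_induct)
  case base
  then show ?case by simp
next
  case (step b)
  have "\<bar>u b - u a\<bar> \<le> 3 * n * real_of_int (b - a)" using step by simp
  moreover have "\<bar>u (b + 1) - u b\<bar> \<le> 3 * n"
    using slope_bound[of b] step.prems[of b] step.prems[of "b + 1"] step.hyps by simp
  ultimately show ?case by (simp add: algebra_simps)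
qed

text \<open>The \<open>j\<close>-th pair flanks the site \<open>x - 4 * j - 2\<close>, which thus
  holds at least \<open>a\<close> particles, and these middle sites are distinct. Spacing 4 keeps
  the pairs disjoint as well, which later gives independence.\<close>

lemma discrepant_sites:
  fixes G :: "nat set"
  assumes "finite G" "\<And>j. j \<in> G \<Longrightarrow> \<bar>S (x - 4 * int j - 3) - S (x - 4 * int j - 1)\<bar> \<ge> a"
  shows "real (card G) * a \<le> 2 * n"
proof -
  let ?f = "\<lambda>j. x - 4 * int j - 2"
  have "real (card G) * a = (\<Sum>j\<in>G. a)" by simp
  also have "\<dots> \<le> (\<Sum>j\<in>G. N (?f j))"
    using assms(2) N_ge[of "?f _"] by (intro sum_mono) (force intro: order_trans)
  also have "\<dots> = (\<Sum>y\<in>?f ` G. N y)"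
    by (subst sum.reindex) (auto simp: inj_on_def)
  also have "\<dots> \<le> 2 * n"
    using assms(1) by (intro sum_N_le) auto
  finally show ?thesis .
qed

text \<open>Left of the origin the flux only makes \<open>u\<close> decrease outwards, so an outward
  step can raise \<open>u\<close> by no more than the noise \<open>n / 16 + n / 16\<close>.\<close>

lemma growth_left:
  assumes "\<And>x. - l \<le> x \<Longrightarrow> x \<le> 0 \<Longrightarrow> \<bar>Z x\<bar> \<le> n / 16" "- l \<le> x" "x \<le> 0"
  shows "u x \<le> u 0 + n / 8 * real_of_int (- x)"
  using assms(3,2)
proof (induction x rule: int_le_induct)
  case base
  then show ?case by simp
next
  case (step x)
  have "u (x - 1 + 1) - u (x - 1) = flux (x - 1) + Z (x - 1) + Z (x - 1 + 1) - (if x - 1 \<ge> 0 then 2 * n else 0)"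
    by (rule slope)
  then have "u x - u (x - 1) = flux (x - 1) + Z (x - 1) + Z x"
    using step.hyps by simp
  moreover have "\<bar>Z x\<bar> \<le> n / 16" "\<bar>Z (x - 1)\<bar> \<le> n / 16"
    by (rule assms(1); use step.hyps step.prems in simp)+
  moreover have "u x \<le> u 0 + n / 8 * real_of_int (- x)"
    using step by simp
  moreover have "n / 8 * real_of_int (- (x - 1)) = n / 8 * real_of_int (- x) + n / 8"
    by (simp add: field_simps)
  ultimately show ?case
    using flux_bounds(1)[of "x - 1"] by linarith
qed

text \<open>With few particles in \<open>{- l..-1}\<close> the flux stays above \<open>n / 4\<close>
  there. Noise takes away at most \<open>n / 8\<close>, so \<open>u\<close> loses at least
  \<open>n / 8\<close> per outward step and is still nonnegative at \<open>- l\<close>.\<close>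

lemma drop_left:
  assumes "l \<ge> 0" "\<And>x. - l \<le> x \<Longrightarrow> x \<le> 0 \<Longrightarrow> \<bar>Z x\<bar> \<le> n / 16"
    and "(\<Sum>y\<in>{- l..-1}. N y) \<le> n / 4" "flux (- 1) \<ge> n / 2"
  shows "u 0 \<ge> real_of_int l * n / 8"
proof -
  have fl: "flux x \<ge> n / 4" if "- l \<le> x" "x \<le> - 1" for x
  proof -
    have "(\<Sum>y\<in>{x<..-1}. N y) \<le> (\<Sum>y\<in>{- l..-1}. N y)"
      using that N_nonneg by (intro sum_mono2) auto
    then show ?thesis using sum_N[OF that(2)] assms(3,4) by simp
  qed
  have "u 0 - u x \<ge> n / 8 * real_of_int (- x)" if "- l \<le> x" "x \<le> 0" for x
    using that(2,1)
  proof (induction x rule: int_le_induct)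
    case base
    then show ?case by simp
  next
    case (step x)
    have "u (x - 1 + 1) - u (x - 1) = flux (x - 1) + Z (x - 1) + Z (x - 1 + 1) - (if x - 1 \<ge> 0 then 2 * n else 0)"
      by (rule slope)
    then have "u x - u (x - 1) = flux (x - 1) + Z (x - 1) + Z x"
      using step.hyps by simp
    moreover have "\<bar>Z x\<bar> \<le> n / 16" "\<bar>Z (x - 1)\<bar> \<le> n / 16"
      by (rule assms(2); use step.hyps step.prems in simp)+
    moreover have "u 0 - u x \<ge> n / 8 * real_of_int (- x)"
      using step by simp
    moreover have "flux (x - 1) \<ge> n / 4"
      using step by (intro fl) auto
    moreover have "n / 8 * real_of_int (- (x - 1)) = n / 8 * real_of_int (- x) + n / 8"
      by (simp add: field_simps)
    ultimately show ?case by linarith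
  qed
  from this[of "- l"] assms(1) u_nonneg[of "- l"] show ?thesis
    by (simp add: algebra_simps)
qed

text \<open>Exchanging left and right reverses every walk, hence the signs of \<open>S\<close> and
  \<open>Z\<close>.\<close>

lemma reflected: "profile n (\<lambda>x. u (- x)) (\<lambda>x. - S (- x)) (\<lambda>x. - Z (- x)) (\<lambda>x. N (- x))"
proof
  fix x
  show "N (- x) = (if x = 0 then 2 * n else 0) + u (- (x - 1)) + u (- (x + 1)) - 2 * u (- x)
      + - Z (- (x - 1)) - - Z (- (x + 1))"
  proof -
    have "- (x - 1) = - x + 1" "- (x + 1) = - x - 1" by simp_all
    then show ?thesis using N_eq[of "- x"] by simp
  qed
  show "\<bar>- S (- (x - 1)) - - S (- (x + 1))\<bar> \<le> N (- x)"
  proof -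
    have "- (x - 1) = - x + 1" "- (x + 1) = - x - 1" by simp_all
    then show ?thesis using N_ge[of "- x"] by simp
  qed
  obtain L where L: "L > 0" "\<And>x. \<bar>x\<bar> \<ge> L \<Longrightarrow> u x = 0 \<and> Z x = 0"
    using far by blast
  then show "\<exists>L>0. \<forall>x. \<bar>x\<bar> \<ge> L \<longrightarrow> u (- x) = 0 \<and> - Z (- x) = 0"
    by (intro exI[of _ L]) auto
qed (rule u_nonneg)

text \<open>Of the total \<open>2 * n\<close>, few particles sit at the origin, so at least one of
  its sides carries \<open>n / 2\<close>; the right side is handled by reflection.\<close>

lemma drop:
  assumes "l \<ge> 0" "\<And>x. \<bar>x\<bar> \<le> l \<Longrightarrow> \<bar>Z x\<bar> \<le> n / 16" "(\<Sum>y\<in>{- l..l}. N y) \<le> n / 4"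
  shows "u 0 \<ge> real_of_int l * n / 8"
proof (cases "flux (- 1) \<ge> n / 2")
  case True
  have "(\<Sum>y\<in>{- l..-1}. N y) \<le> (\<Sum>y\<in>{- l..l}. N y)"
    using assms(1) N_nonneg by (intro sum_mono2) auto
  then show ?thesis
    using assms True by (intro drop_left) auto
next
  case False
  interpret r: profile n "\<lambda>x. u (- x)" "\<lambda>x. - S (- x)" "\<lambda>x. - Z (- x)" "\<lambda>x. N (- x)"
    by (rule reflected)
  have "N 0 \<le> (\<Sum>y\<in>{- l..l}. N y)"
    using assms(1) N_nonneg by (intro member_le_sum) auto
  then have "flux 0 \<le> 3 * n / 4"
    using False flux_diff[of 0] assms(3) by simp
  moreover have "n \<ge> 0" using flux_bounds[of 0] by linarith
  \<comment> \<open>The reflected flux counts the particles to the right of the origin.\<close>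
  moreover have "r.flux (- 1) = 2 * n - flux 0"
    by (simp add: r.flux_def flux_def)
  ultimately have "r.flux (- 1) \<ge> n / 2" by simp
  moreover have "(\<Sum>y\<in>{- l..-1}. N (- y)) = (\<Sum>y\<in>{1..l}. N y)"
    by (rule sum.reindex_bij_witness[of _ uminus uminus]) auto
  moreover have "(\<Sum>y\<in>{1..l}. N y) \<le> (\<Sum>y\<in>{- l..l}. N y)"
    using assms(1) N_nonneg by (intro sum_mono2) auto
  ultimately have "real_of_int l * n / 8 \<le> u (- 0)"
    using assms by (intro r.drop_left) auto
  then show ?thesis by simp
qed

lemma growth:
  assumes "\<And>x. \<bar>x\<bar> \<le> l \<Longrightarrow> \<bar>Z x\<bar> \<le> n / 16" "\<bar>x\<bar> \<le> l"
  shows "u x \<le> u 0 + n / 8 * real_of_int \<bar>x\<bar>"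
proof (cases "x \<le> 0")
  case True
  then show ?thesis
    using growth_left[of l x] assms by auto
next
  case False
  interpret r: profile n "\<lambda>x. u (- x)" "\<lambda>x. - S (- x)" "\<lambda>x. - Z (- x)" "\<lambda>x. N (- x)"
    by (rule reflected)
  show ?thesis
    using r.growth_left[of l "- x"] assms False by auto
qed

text \<open>A small value near the origin makes \<open>u\<close> at most
  \<open>227 * B * p ^ 4\<close> on the whole range, where \<open>m\<close> then controls
  \<open>S\<close>. In a stopped state this leaves few particles there, so \<open>drop\<close> makes
  \<open>u 0\<close> too large.\<close>

lemma odometer_lower_bound:
  fixes B :: real and p :: nat and m :: "int \<Rightarrow> real"
  assumes "p \<ge> 1" "B \<ge> 1" "B * real p ^ 3 \<le> n" "n \<le> 8 * B * real p ^ 3"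
    and Z: "\<And>x. \<bar>x\<bar> \<le> 202 * int p \<Longrightarrow> \<bar>Z x\<bar> \<le> n / 16"
    and m: "\<And>x. \<bar>x\<bar> \<le> 202 * int p \<Longrightarrow> u x \<le> 227 * B * real p ^ 4 \<Longrightarrow> \<bar>S x\<bar> \<le> m x"
    and m_nonneg: "\<And>x. m x \<ge> 0"
    and sum_m: "(\<Sum>x\<in>{- 202 * int p..202 * int p}. m x) \<le> n / 8"
    and stable: "\<And>x. N x = \<bar>S (x - 1) - S (x + 1)\<bar>"
    and x: "\<bar>x\<bar> \<le> int p"
  shows "u x \<ge> real p ^ 4"
proof (rule ccontr)
  assume "\<not> u x \<ge> real p ^ 4"
  then have ux: "u x < real p ^ 4" by simp
  have n0: "n \<ge> 0" using flux_bounds[of 0] by linarith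
  have np: "n * real p \<le> 8 * B * real p ^ 4"
    using mult_right_mono[OF assms(4), of "real p"] by (simp add: algebra_simps power4_eq_xxxx power3_eq_cube)
  have p4: "real p ^ 4 \<le> B * real p ^ 4" using assms(2) by (simp add: mult_le_cancel_right1)
  have Z2: "\<bar>Z y\<bar> \<le> n / 2" if "\<bar>y\<bar> \<le> 202 * int p" for y
    using Z[OF that] n0 by linarith
  have "\<bar>u 0 - u x\<bar> \<le> 3 * n * real_of_int \<bar>x\<bar>"
  proof (cases "x \<le> 0")
    case True
    then show ?thesis using slope_chain[of x 0] Z2 x by auto
  next
    case False
    then show ?thesis using slope_chain[of 0 x] Z2 x by (auto simp: abs_minus_commute)
  qed
  also have "\<dots> \<le> 3 * n * real p"
    using x n0 by (intro mult_left_mono) auto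
  \<comment> \<open>The constant is 1 from \<open>u x\<close> plus \<open>3 * 8\<close> from the
    slopes.\<close>
  finally have u0: "u 0 < 25 * B * real p ^ 4"
    using ux p4 np by linarith
  have um: "u y \<le> 227 * B * real p ^ 4" if "\<bar>y\<bar> \<le> 202 * int p" for y
  proof -
    have "u y \<le> u 0 + n / 8 * real_of_int \<bar>y\<bar>"
      by (rule growth[OF Z that])
    also have "n / 8 * real_of_int \<bar>y\<bar> \<le> n / 8 * (202 * real p)"
      using that n0 by (intro mult_left_mono) linarith+
    also have "\<dots> \<le> 202 * B * real p ^ 4" using np by simp
    finally show ?thesis using u0 by simp
  qed
  have Sm: "\<bar>S y\<bar> \<le> m y" if "\<bar>y\<bar> \<le> 202 * int p" for y
    using m[OF that um[OF that]] .
  \<comment> \<open>\<open>201 / 8 > 25\<close> gives the contradiction. The range 202 makes room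
    for the neighbours of \<open>{- ?l..?l}\<close>, and \<open>227 = 25 + 202\<close>.\<close>
  let ?l = "201 * int p"
  let ?I = "{- 202 * int p..202 * int p}"
  have "(\<Sum>y\<in>{- ?l..?l}. N y) \<le> (\<Sum>y\<in>{- ?l..?l}. m (y - 1) + m (y + 1))"
  proof (rule sum_mono)
    fix y assume "y \<in> {- ?l..?l}"
    then have "\<bar>y - 1\<bar> \<le> 202 * int p" "\<bar>y + 1\<bar> \<le> 202 * int p" using assms(1) by auto
    from Sm[OF this(1)] Sm[OF this(2)] show "N y \<le> m (y - 1) + m (y + 1)"
      unfolding stable by linarith
  qed
  also have "\<dots> = (\<Sum>y\<in>(\<lambda>y. y - 1) ` {- ?l..?l}. m y) + (\<Sum>y\<in>(\<lambda>y. y + 1) ` {- ?l..?l}. m y)"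
    by (subst (1 2) sum.reindex) (auto simp: inj_on_def sum.distrib simp del: image_add_atLeastAtMost)
  also have "\<dots> \<le> (\<Sum>y\<in>?I. m y) + (\<Sum>y\<in>?I. m y)"
    using assms(1) m_nonneg by (intro add_mono sum_mono2) auto
  also have "\<dots> \<le> n / 4" using sum_m by simp
  finally have "real_of_int ?l * n / 8 \<le> u 0"
    using Z by (intro drop) auto
  moreover have "real p * (B * real p ^ 3) \<le> real p * n"
    using assms(3) by (intro mult_left_mono) auto
  then have "B * real p ^ 4 \<le> n * real p"
    by (simp add: algebra_simps power4_eq_xxxx power3_eq_cube)
  moreover have "B * real p ^ 4 \<ge> 0" using assms(2) by simp
  ultimately show False using u0 by (simp add: algebra_simps)
qed

end

section \<open>Escape of oil particles\<close>

lemma sum_move_particle: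
  fixes f :: "int \<Rightarrow> real"
  assumes "finite A" "y \<in> A" "z \<in> A" "\<eta> y \<ge> 1" "y \<noteq> z"
  shows "(\<Sum>x\<in>A. real (move_particle y z \<eta> x) * f x) = (\<Sum>x\<in>A. real (\<eta> x) * f x) - f y + f z"
proof -
  have m: "real (move_particle y z \<eta> x) = real (\<eta> x) - (if x = y then 1 else 0) + (if x = z then 1 else 0)" for x
    using assms(4,5) by (auto simp: move_particle_def Let_def of_nat_diff)
  have "(\<Sum>x\<in>A. real (move_particle y z \<eta> x) * f x)
      = (\<Sum>x\<in>A. real (\<eta> x) * f x - (if x = y then f y else 0) + (if x = z then f z else 0))"
    unfolding m by (intro sum.cong) (auto simp: algebra_simps)
  also have "\<dots> = (\<Sum>x\<in>A. real (\<eta> x) * f x) - f y + f z"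
    using assms(1-3) by (simp add: sum.distrib sum_subtractf)
  finally show ?thesis .
qed

text \<open>Both exponentials have quadratic upper bounds on the unit interval, and their linear
  terms cancel.\<close>

lemma cosh_le_exp_square:
  fixes \<theta> :: real
  assumes "0 \<le> \<theta>" "\<theta> \<le> 1"
  shows "cosh \<theta> \<le> exp (\<theta>\<^sup>2)"
proof -
  have "exp (- \<theta>) * (1 + \<theta>) \<le> 1"
    using exp_ge_add_one_self[of \<theta>] mult_left_mono[of "1 + \<theta>" "exp \<theta>" "exp (- \<theta>)"]
    by (simp add: exp_minus_inverse mult.commute)
  \<comment> \<open>The product is \<open>1 + \<theta> ^ 3\<close>.\<close>
  moreover have "1 \<le> (1 - \<theta> + \<theta>\<^sup>2) * (1 + \<theta>)"
    using assms by (simp add: algebra_simps power2_eq_square)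
  ultimately have "exp (- \<theta>) * (1 + \<theta>) \<le> (1 - \<theta> + \<theta>\<^sup>2) * (1 + \<theta>)" by linarith
  then have "exp (- \<theta>) \<le> 1 - \<theta> + \<theta>\<^sup>2"
    using assms by (simp add: mult_le_cancel_right)
  moreover have "exp \<theta> \<le> 1 + \<theta> + \<theta>\<^sup>2"
    using assms by (intro exp_bound) auto
  ultimately have "cosh \<theta> \<le> 1 + \<theta>\<^sup>2"
    by (simp add: cosh_field_def)
  also have "\<dots> \<le> exp (\<theta>\<^sup>2)"
    by (rule exp_ge_add_one_self)
  finally show ?thesis .
qed

locale sign_stacks = sign_family M \<xi> "UNIV \<times> UNIV \<times> {1..}"
  for M :: "'a measure" and \<xi> :: "bool \<times> int \<times> nat \<Rightarrow> 'a \<Rightarrow> int"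
begin

abbreviation state :: "nat \<Rightarrow> 'a \<Rightarrow> nat \<Rightarrow> ow_state" where
  "state n \<omega> t \<equiv> state_at n (\<lambda>x k. \<xi> (True, x, k) \<omega>) (\<lambda>x k. \<xi> (False, x, k) \<omega>) t"

lemma stacks_signs: "stacks (\<lambda>x k. \<xi> (True, x, k) \<omega>) (\<lambda>x k. \<xi> (False, x, k) \<omega>)"
  using sign_values by unfold_locales

lemmas state_support = stacks.support[OF stacks_signs]
  and state_fired_le = stacks.fired_le[OF stacks_signs]
  and state_leftmost = stacks.leftmost_can_fire[OF stacks_signs]

text \<open>A deterministic finite set containing every stack entry that can be read within
  \<open>t\<close> steps.\<close>

definition entries :: "nat \<Rightarrow> (bool \<times> int \<times> nat) set" where
  "entries t = UNIV \<times> {- int t..int t} \<times> {1..t}"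

lemma finite_entries [simp]: "finite (entries t)"
  by (simp add: entries_def)

lemma entries_subset: "entries t \<subseteq> UNIV \<times> UNIV \<times> {1..}"
  by (auto simp: entries_def)

lemma used_entry:
  assumes "1 \<le> k" "k \<le> fired (state n \<omega> t) x"
  shows "(b, x, k) \<in> entries t"
proof -
  have "\<not> int t < \<bar>x\<bar>"
    using state_support(3)[of t x n \<omega>] assms by linarith
  moreover have "k \<le> t"
    using state_fired_le[of n \<omega> t x] assms(2) by linarith
  ultimately show ?thesis
    using assms(1) by (auto simp: entries_def)
qed

lemma depends_state: "depends (entries t) (\<lambda>\<omega>. f (state n \<omega> t))"
proof (rule dependsI)
  fix \<omega> \<omega>' assume *: "\<And>i. i \<in> entries t \<Longrightarrow> \<xi> i \<omega> = \<xi> i \<omega>'"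
  have "state n \<omega>' t = state n \<omega> t"
    using used_entry by (intro state_at_cong conjI *)
  then show "f (state n \<omega> t) = f (state n \<omega>' t)" by simp
qed

definition fires :: "nat \<Rightarrow> int \<Rightarrow> nat \<Rightarrow> nat \<Rightarrow> 'a \<Rightarrow> bool" where
  "fires n x k t \<omega> \<longleftrightarrow> \<not> stopped (state n \<omega> t) \<and> leftmost (state n \<omega> t) = x
    \<and> fired (state n \<omega> t) x + 1 = k"

text \<open>Hence the stack entry used by a firing is still uniform given the past.\<close>

lemma depends_fires: "depends (entries t - {(b, x, k)}) (fires n x k t)"
proof -
  have imp: "fires n x k t \<omega>'"
    if f: "fires n x k t \<omega>" and *: "\<And>i. i \<in> entries t - {(b, x, k)} \<Longrightarrow> \<xi> i \<omega> = \<xi> i \<omega>'" for \<omega> \<omega>'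
  proof -
    have "state n \<omega>' t = state n \<omega> t"
    proof (rule state_at_cong)
      fix y j assume j: "1 \<le> j" "j \<le> fired (state n \<omega> t) y"
      \<comment> \<open>Before its \<open>k\<close>-th firing, \<open>x\<close> has read only the
        entries up to \<open>k - 1\<close>.\<close>
      then have "(y, j) \<noteq> (x, k)" using f by (auto simp: fires_def)
      then show "\<xi> (True, y, j) \<omega> = \<xi> (True, y, j) \<omega>' \<and> \<xi> (False, y, j) \<omega> = \<xi> (False, y, j) \<omega>'"
        using used_entry[OF j] by (intro conjI *) auto
    qed
    then show ?thesis using f by (simp add: fires_def)
  qed
  show ?thesis
  proof (rule dependsI)
    fix \<omega> \<omega>' assume "\<And>i. i \<in> entries t - {(b, x, k)} \<Longrightarrow> \<xi> i \<omega> = \<xi> i \<omega>'"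
    then show "fires n x k t \<omega> = fires n x k t \<omega>'"
      using imp[of \<omega> \<omega>'] imp[of \<omega>' \<omega>] by (metis (no_types, lifting))
  qed
qed

text \<open>For \<open>t \<le> L\<close> the truncation loses nothing, as all oil is within distance
  \<open>t\<close> of the origin.\<close>

definition potential :: "real \<Rightarrow> nat \<Rightarrow> nat \<Rightarrow> nat \<Rightarrow> 'a \<Rightarrow> real" where
  "potential \<theta> L n t \<omega> = (\<Sum>x\<in>{- int L..int L}. real (oil (state n \<omega> t) x) * cosh (\<theta> * real_of_int x))"

text \<open>At most one summand is nonzero. Summing over all candidates for the current firing
  replaces a random stack index by fixed ones, each giving a coefficient from the past times a fresh
  sign.\<close>

definition potential_noise :: "real \<Rightarrow> nat \<Rightarrow> nat \<Rightarrow> 'a \<Rightarrow> real" where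
  "potential_noise \<theta> n t \<omega> = (\<Sum>(x, k)\<in>{- int t..int t} \<times> {1..Suc t}.
     (if fires n x k t \<omega> then sinh \<theta> * sinh (\<theta> * real_of_int x) else 0) * \<sigma> (True, x, k) \<omega>)"

text \<open>By the addition formula a firing at \<open>y\<close> adds
  \<open>(cosh \<theta> - 1) * cosh (\<theta> * y)\<close> and a term linear in the sign. The first
  is at most \<open>cosh \<theta> - 1\<close> times the potential because \<open>y\<close> holds an
  oil particle.\<close>

lemma potential_step:
  assumes "Suc t \<le> L"
  shows "potential \<theta> L n (Suc t) \<omega> \<le> cosh \<theta> * potential \<theta> L n t \<omega> + potential_noise \<theta> n t \<omega>"
proof (cases "stopped (state n \<omega> t)")
  case True
  have "potential \<theta> L n t \<omega> \<ge> 0"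
    unfolding potential_def by (intro sum_nonneg mult_nonneg_nonneg) auto
  then have "potential \<theta> L n t \<omega> \<le> cosh \<theta> * potential \<theta> L n t \<omega>"
    using cosh_real_ge_1[of \<theta>] by (simp add: mult_le_cancel_right1)
  moreover have "potential_noise \<theta> n t \<omega> = 0"
    unfolding potential_noise_def using True by (intro sum.neutral) (auto simp: fires_def)
  ultimately show ?thesis
    using True by (simp add: potential_def state_at_Suc step_stopped)
next
  case False
  define y where "y = leftmost (state n \<omega> t)"
  define k where "k = fired (state n \<omega> t) y + 1"
  define d where "d = \<xi> (True, y, k) \<omega>"
  have oil: "oil (state n \<omega> t) y \<ge> 1"
    using state_leftmost(1)[OF False] by (simp add: y_def)
  have d: "d = 1 \<or> d = -1"
    using sign_values[of "(True, y, k)" \<omega>] by (simp add: d_def)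
  have "\<not> int t < \<bar>y\<bar>"
    using state_support(1)[of t y n \<omega>] oil by linarith
  then have yt: "y \<in> {- int t..int t}" by auto
  then have yL: "y \<in> {- int L..int L}" "y + d \<in> {- int L..int L}"
    using d assms by auto
  have kt: "k \<in> {1..Suc t}"
    using state_fired_le[of n \<omega> t y] by (simp add: k_def)
  let ?c = "\<lambda>x. cosh (\<theta> * real_of_int x)"
  have fires: "fires n x j t \<omega> \<longleftrightarrow> (x, j) = (y, k)" for x j
    using False by (auto simp: fires_def y_def k_def)
  have "potential_noise \<theta> n t \<omega> = (\<Sum>p\<in>{- int t..int t} \<times> {1..Suc t}.
      if p = (y, k) then sinh \<theta> * sinh (\<theta> * real_of_int y) * \<sigma> (True, y, k) \<omega> else 0)"
    unfolding potential_noise_def fires by (intro sum.cong) (auto split: if_splits)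
  also have "\<dots> = sinh \<theta> * sinh (\<theta> * real_of_int y) * real_of_int d"
    using yt kt by (simp add: d_def)
  finally have noise: "potential_noise \<theta> n t \<omega> = sinh \<theta> * sinh (\<theta> * real_of_int y) * real_of_int d" .
  have "potential \<theta> L n (Suc t) \<omega> = potential \<theta> L n t \<omega> - ?c y + ?c (y + d)"
    unfolding potential_def state_at_Suc step_not_stopped(1)[OF False]
    using sum_move_particle[of "{- int L..int L}" y "y + d" "oil (state n \<omega> t)" ?c] yL oil d
    by (auto simp: y_def k_def d_def)
  also have "?c (y + d) = cosh \<theta> * ?c y + sinh \<theta> * sinh (\<theta> * real_of_int y) * real_of_int d"
    using d by (auto simp: distrib_left right_diff_distrib cosh_add cosh_diff)
  finally have "potential \<theta> L n (Suc t) \<omega>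
      = potential \<theta> L n t \<omega> + (cosh \<theta> - 1) * ?c y + potential_noise \<theta> n t \<omega>"
    unfolding noise by (simp add: algebra_simps)
  moreover have "?c y \<le> potential \<theta> L n t \<omega>"
  proof -
    have "?c y \<le> real (oil (state n \<omega> t) y) * ?c y"
      using oil mult_right_mono[of 1 "real (oil (state n \<omega> t) y)" "?c y"] by simp
    also have "\<dots> \<le> potential \<theta> L n t \<omega>"
      unfolding potential_def by (rule member_le_sum) (use yL in auto)
    finally show ?thesis .
  qed
  then have "(cosh \<theta> - 1) * ?c y \<le> (cosh \<theta> - 1) * potential \<theta> L n t \<omega>"
    by (intro mult_left_mono) (simp_all add: cosh_real_ge_1)
  ultimately show ?thesis
    by (simp add: algebra_simps)
qed

lemma integrable_potential: "integrable M (potential \<theta> L n t)"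
  unfolding potential_def
  by (rule depends_integrable[OF finite_entries entries_subset depends_state])

text \<open>Each summand falls under \<open>fresh_sign\<close>, as \<open>depends_fires\<close>
  removes the entry being read from the past.\<close>

lemma potential_noise_mean_zero:
  "integrable M (potential_noise \<theta> n t)" "expectation (potential_noise \<theta> n t) = 0"
proof -
  let ?f = "\<lambda>p \<omega>. case p of (x, k) \<Rightarrow>
    (if fires n x k t \<omega> then sinh \<theta> * sinh (\<theta> * real_of_int x) else 0) * \<sigma> (True, x, k) \<omega>"
  let ?P = "{- int t..int t} \<times> {1..Suc t}"
  have *: "integrable M (?f (x, k)) \<and> expectation (?f (x, k)) = 0" if k: "k \<ge> 1" for x k
  proof -
    let ?J = "entries t - {(True, x, k)}" and ?i = "(True, x, k)"
    let ?g = "\<lambda>\<omega>. if fires n x k t \<omega> then sinh \<theta> * sinh (\<theta> * real_of_int x) else 0"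
    have dep: "depends ?J ?g"
      using depends_fires[of t True x k n] unfolding depends_def by metis
    have sub: "?J \<subseteq> UNIV \<times> UNIV \<times> {1..}" using entries_subset[of t] by blast
    have "expectation (\<lambda>\<omega>. ?g \<omega> * \<sigma> ?i \<omega>) = 0"
      by (rule fresh_sign[OF _ sub dep]) (use k in auto)
    moreover have "depends (insert ?i (entries t)) (\<lambda>\<omega>. ?g \<omega> * \<sigma> ?i \<omega>)"
      by (rule dependsI, rule arg_cong2[where f = "(*)"], rule dependsD[OF dep]) auto
    then have "integrable M (\<lambda>\<omega>. ?g \<omega> * \<sigma> ?i \<omega>)"
      by (rule depends_integrable[rotated 2]) (use k entries_subset[of t] in auto)
    ultimately show ?thesis by simp
  qed
  have **: "integrable M (?f p)" "expectation (?f p) = 0" if "p \<in> ?P" for p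
    using that * by (cases p; force)+
  have eq: "potential_noise \<theta> n t = (\<lambda>\<omega>. \<Sum>p\<in>?P. ?f p \<omega>)"
    by (simp add: potential_noise_def fun_eq_iff)
  show "integrable M (potential_noise \<theta> n t)"
    unfolding eq by (intro Bochner_Integration.integrable_sum **)
  show "expectation (potential_noise \<theta> n t) = 0"
    unfolding eq by (subst Bochner_Integration.integral_sum) (use ** in auto)
qed

lemma expectation_potential:
  assumes "t \<le> L"
  shows "expectation (potential \<theta> L n t) \<le> real n * cosh \<theta> ^ t"
  using assms
proof (induction t)
  case 0
  have "potential \<theta> L n 0 \<omega> = (\<Sum>x\<in>{- int L..int L}. if x = 0 then real n else 0)" for \<omega>
    unfolding potential_def by (intro sum.cong) (auto simp: initial_state_def)
  then show ?case by (simp add: prob_space)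
next
  case (Suc t)
  have "expectation (potential \<theta> L n (Suc t))
      \<le> expectation (\<lambda>\<omega>. cosh \<theta> * potential \<theta> L n t \<omega> + potential_noise \<theta> n t \<omega>)"
    by (intro integral_mono integrable_potential Bochner_Integration.integrable_add
          integrable_mult_right potential_noise_mean_zero potential_step Suc.prems)
  also have "\<dots> = cosh \<theta> * expectation (potential \<theta> L n t)"
    using integrable_potential[of \<theta> L n t] potential_noise_mean_zero[of \<theta> n t] by simp
  also have "\<dots> \<le> cosh \<theta> * (real n * cosh \<theta> ^ t)"
    using Suc by (intro mult_left_mono) auto
  finally show ?case by (simp add: algebra_simps)
qed

definition escapes :: "nat \<Rightarrow> nat \<Rightarrow> nat \<Rightarrow> 'a \<Rightarrow> bool" where
  "escapes n r T \<omega> \<longleftrightarrow> (\<exists>t\<le>T. \<exists>x. \<bar>x\<bar> > int r \<and> oil (state n \<omega> t) x \<ge> 1)"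

lemma escapes_measurable: "{\<omega> \<in> space M. escapes n r T \<omega>} \<in> events"
proof -
  have ev: "{\<omega> \<in> space M. \<exists>x. \<bar>x\<bar> > int r \<and> oil (state n \<omega> t) x \<ge> 1} \<in> events" for t
    by (rule depends_event[OF finite_entries[of t] entries_subset
          depends_state[where f = "\<lambda>s. \<exists>x. \<bar>x\<bar> > int r \<and> oil s x \<ge> 1"]])
  have "{\<omega> \<in> space M. escapes n r T \<omega>}
      = (\<Union>t\<in>{..T}. {\<omega> \<in> space M. \<exists>x. \<bar>x\<bar> > int r \<and> oil (state n \<omega> t) x \<ge> 1})"
    by (auto simp: escapes_def)
  also have "\<dots> \<in> events"
    by (intro sets.finite_UN ev) simp
  finally show ?thesis .
qed

text \<open>One oil particle beyond \<open>r\<close> already makes the potential at least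
  \<open>cosh (\<theta> * r)\<close>. Markov's inequality is used at each time and followed by a
  union bound over times.\<close>

lemma prob_escapes:
  assumes "H \<ge> 1" "real T \<le> 3 * real r * H"
  shows "prob {\<omega> \<in> space M. escapes n r T \<omega>} \<le> (real T + 1) * (2 * real n * exp (- (real r / (12 * H))))"
proof -
  \<comment> \<open>The minimiser of \<open>3 * r * H * \<theta>\<^sup>2 - \<theta> * r\<close>,
    with minimum \<open>- r / (12 * H)\<close>.\<close>
  define \<theta> where "\<theta> = 1 / (6 * H)"
  have \<theta>: "0 \<le> \<theta>" "\<theta> \<le> 1" using assms(1) by (auto simp: \<theta>_def)
  define A where "A t = {\<omega> \<in> space M. potential \<theta> T n t \<omega> \<ge> cosh (\<theta> * real r)}" for t
  have A: "A t \<in> events" for t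
    unfolding A_def potential_def
    by (rule depends_event[OF finite_entries entries_subset depends_state])
  have pos: "potential \<theta> T n t \<omega> \<ge> 0" for t \<omega>
    unfolding potential_def by (intro sum_nonneg mult_nonneg_nonneg) auto
  have pA: "prob (A t) \<le> 2 * real n * exp (- (real r / (12 * H)))" if "t \<le> T" for t
  proof -
    have "prob (A t) \<le> expectation (potential \<theta> T n t) / cosh (\<theta> * real r)"
      unfolding A_def
      by (rule integral_Markov_inequality_measure[OF integrable_potential, of "{}"]) (use pos in auto)
    also have "\<dots> \<le> (real n * exp (\<theta>\<^sup>2) ^ T) / (exp (\<theta> * real r) / 2)"
    proof (rule frac_le)
      have "cosh \<theta> ^ t \<le> exp (\<theta>\<^sup>2) ^ t"
        by (intro power_mono cosh_le_exp_square \<theta>) auto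
      also have "\<dots> \<le> exp (\<theta>\<^sup>2) ^ T"
        using that by (intro power_increasing) auto
      finally show "expectation (potential \<theta> T n t) \<le> real n * exp (\<theta>\<^sup>2) ^ T"
        using expectation_potential[OF that, of \<theta> n] by (meson mult_left_mono of_nat_0_le_iff order_trans)
      show "exp (\<theta> * real r) / 2 \<le> cosh (\<theta> * real r)"
        by (simp add: cosh_field_def)
    qed auto
    also have "\<dots> = 2 * real n * exp (\<theta>\<^sup>2 * real T - \<theta> * real r)"
      by (simp add: exp_diff exp_of_nat_mult[symmetric] mult.commute)
    also have "\<dots> \<le> 2 * real n * exp (- (real r / (12 * H)))"
    proof -
      have "\<theta>\<^sup>2 * real T \<le> \<theta>\<^sup>2 * (3 * real r * H)"
        using assms(2) by (intro mult_left_mono) auto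
      also have "\<dots> = real r / (12 * H)"
        using assms(1) by (simp add: \<theta>_def power2_eq_square)
      finally have "\<theta>\<^sup>2 * real T - \<theta> * real r \<le> - (real r / (12 * H))"
        using assms(1) by (simp add: \<theta>_def field_simps)
      then show ?thesis by (intro mult_left_mono) auto
    qed
    finally show ?thesis .
  qed
  have "{\<omega> \<in> space M. escapes n r T \<omega>} \<subseteq> (\<Union>t\<in>{..T}. A t)"
  proof
    fix \<omega> assume "\<omega> \<in> {\<omega> \<in> space M. escapes n r T \<omega>}"
    then obtain t x where tx: "t \<le> T" "\<bar>x\<bar> > int r" "oil (state n \<omega> t) x \<ge> 1" and \<omega>: "\<omega> \<in> space M"
      by (auto simp: escapes_def)
    have "\<not> int t < \<bar>x\<bar>"
      using state_support(1)[of t x n \<omega>] tx(3) by linarith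
    then have x: "x \<in> {- int T..int T}" using tx(1) by auto
    have "\<bar>\<theta> * real r\<bar> \<le> \<bar>\<theta> * real_of_int x\<bar>"
      using \<theta>(1) tx(2) by (simp add: abs_mult mult_left_mono)
    then have "cosh (\<theta> * real r) \<le> cosh (\<theta> * real_of_int x)"
      using cosh_real_nonneg_le_iff[of "\<bar>\<theta> * real r\<bar>" "\<bar>\<theta> * real_of_int x\<bar>"] by simp
    also have "\<dots> \<le> real (oil (state n \<omega> t) x) * cosh (\<theta> * real_of_int x)"
      using tx(3) mult_right_mono[of 1 "real (oil (state n \<omega> t) x)" "cosh (\<theta> * real_of_int x)"] by simp
    also have "\<dots> \<le> potential \<theta> T n t \<omega>"
      unfolding potential_def by (rule member_le_sum) (use x in auto)
    finally show "\<omega> \<in> (\<Union>t\<in>{..T}. A t)"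
      using tx(1) \<omega> by (auto simp: A_def)
  qed
  then have "prob {\<omega> \<in> space M. escapes n r T \<omega>} \<le> prob (\<Union>t\<in>{..T}. A t)"
    using A by (intro finite_measure_mono) auto
  also have "\<dots> \<le> (\<Sum>t\<in>{..T}. prob (A t))"
    using A by (intro finite_measure_subadditive_finite) auto
  also have "\<dots> \<le> (\<Sum>t\<in>{..T}. 2 * real n * exp (- (real r / (12 * H))))"
    by (intro sum_mono pA) auto
  also have "\<dots> = (real T + 1) * (2 * real n * exp (- (real r / (12 * H))))"
    by simp
  finally show ?thesis .
qed

section \<open>Probabilities of static events\<close>

definition S_at :: "'a \<Rightarrow> int \<Rightarrow> nat \<Rightarrow> real" where
  "S_at \<omega> x k = (real_of_int (partial_sum (\<lambda>j. \<xi> (True, x, j) \<omega>) k)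
    - real_of_int (partial_sum (\<lambda>j. \<xi> (False, x, j) \<omega>) k)) / 2"

definition Z_at :: "'a \<Rightarrow> int \<Rightarrow> nat \<Rightarrow> real" where
  "Z_at \<omega> x k = (real_of_int (partial_sum (\<lambda>j. \<xi> (True, x, j) \<omega>) k)
    + real_of_int (partial_sum (\<lambda>j. \<xi> (False, x, j) \<omega>) k)) / 2"

lemma S_at_0 [simp]: "S_at \<omega> x 0 = 0"
  by (simp add: S_at_def)

lemma S_at_Suc: "S_at \<omega> x (Suc k) = S_at \<omega> x k + (\<sigma> (True, x, Suc k) \<omega> - \<sigma> (False, x, Suc k) \<omega>) / 2"
  by (simp add: S_at_def partial_sum_Suc field_simps)

definition site :: "int \<Rightarrow> nat \<Rightarrow> (bool \<times> int \<times> nat) set" where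
  "site x k = UNIV \<times> {x} \<times> {1..k}"

lemma finite_site [simp]: "finite (site x k)"
  by (simp add: site_def)

lemma site_subset: "site x k \<subseteq> UNIV \<times> UNIV \<times> {1..}"
  by (auto simp: site_def)

lemma sum_site: "(\<Sum>i\<in>site x k. f i) = (\<Sum>j=1..k. f (True, x, j)) + (\<Sum>j=1..k. f (False, x, j))"
proof -
  have "site x k = (\<lambda>j. (True, x, j)) ` {1..k} \<union> (\<lambda>j. (False, x, j)) ` {1..k}"
    by (auto simp: site_def image_iff)
  then show ?thesis
    by (simp add: sum.union_disjoint sum.reindex inj_on_def image_iff disjoint_iff)
qed

lemma S_at_eq_sum: "S_at \<omega> x k = (\<Sum>i\<in>site x k. (if fst i then 1 / 2 else - 1 / 2) * \<sigma> i \<omega>)"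
  unfolding sum_site
  by (simp add: S_at_def partial_sum_def sum_distrib_left[symmetric] sum_negf sum_divide_distrib[symmetric]
      diff_divide_distrib)

lemma Z_at_eq_sum: "Z_at \<omega> x k = (\<Sum>i\<in>site x k. 1 / 2 * \<sigma> i \<omega>)"
  unfolding sum_site
  by (simp add: Z_at_def partial_sum_def sum_distrib_left[symmetric] sum_divide_distrib[symmetric]
      add_divide_distrib)

lemma S_at_cong:
  assumes "\<And>i. i \<in> site x m \<Longrightarrow> \<xi> i \<omega> = \<xi> i \<omega>'" "k \<le> m"
  shows "S_at \<omega> x k = S_at \<omega>' x k"
  unfolding S_at_eq_sum using assms by (intro sum.cong) (auto simp: site_def)

text \<open>\<open>Z_at\<close> at \<open>k\<close> is a sum of \<open>2 * k\<close> signs of weight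
  \<open>1 / 2\<close>, with variance \<open>k / 2\<close>. Since the odometer is random, all
  \<open>k \<le> H\<close> are covered, by a union bound.\<close>

lemma prob_Z_large:
  assumes "H \<ge> 1" "a \<ge> 0"
  shows "prob {\<omega> \<in> space M. \<exists>x\<in>{- int R..int R}. \<exists>k\<le>H. \<bar>Z_at \<omega> x k\<bar> \<ge> a}
      \<le> (2 * real R + 1) * (real H + 1) * (2 * exp (- (a\<^sup>2 / real H)))"
    and "{\<omega> \<in> space M. \<exists>x\<in>{- int R..int R}. \<exists>k\<le>H. \<bar>Z_at \<omega> x k\<bar> \<ge> a} \<in> events"
proof -
  define A where "A = (\<lambda>(x, k). {\<omega> \<in> space M. \<bar>Z_at \<omega> x k\<bar> \<ge> a})"
  let ?P = "{- int R..int R} \<times> {..H}"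
  have A: "A p \<in> events" for p
  proof -
    obtain x k where p: "p = (x, k)" by force
    have "depends (site x k) (\<lambda>\<omega>. \<bar>Z_at \<omega> x k\<bar> \<ge> a)"
      unfolding Z_at_eq_sum using depends_weighted_sum[of "site x k" "\<lambda>_. 1 / 2"]
      unfolding depends_def by metis
    then show ?thesis
      unfolding A_def p by (auto intro: depends_event[OF finite_site site_subset])
  qed
  have pA: "prob (A p) \<le> 2 * exp (- (a\<^sup>2 / real H))" if p: "p \<in> ?P" for p
  proof -
    obtain x k where xk: "p = (x, k)" "k \<le> H" using p by force
    have "prob (A p) \<le> 2 * exp (- (a\<^sup>2 / (2 * (real H / 2))))"
      unfolding A_def xk(1) prod.case Z_at_eq_sum
      by (rule hoeffding_signs[OF finite_site site_subset])
         (use assms xk(2) in \<open>auto simp: site_def power2_eq_square card_cartesian_product\<close>)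
    then show ?thesis by simp
  qed
  have eq: "{\<omega> \<in> space M. \<exists>x\<in>{- int R..int R}. \<exists>k\<le>H. \<bar>Z_at \<omega> x k\<bar> \<ge> a} = (\<Union>p\<in>?P. A p)"
    by (auto simp: A_def)
  show "{\<omega> \<in> space M. \<exists>x\<in>{- int R..int R}. \<exists>k\<le>H. \<bar>Z_at \<omega> x k\<bar> \<ge> a} \<in> events"
    unfolding eq using A by (intro sets.finite_UN) auto
  have "prob (\<Union>p\<in>?P. A p) \<le> (\<Sum>p\<in>?P. prob (A p))"
    using A by (intro finite_measure_subadditive_finite) auto
  also have "\<dots> \<le> (\<Sum>p\<in>?P. 2 * exp (- (a\<^sup>2 / real H)))"
    by (rule sum_mono[OF pA])
  also have "\<dots> = (2 * real R + 1) * (real H + 1) * (2 * exp (- (a\<^sup>2 / real H)))"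
    by (simp add: card_cartesian_product algebra_simps)
  finally show "prob {\<omega> \<in> space M. \<exists>x\<in>{- int R..int R}. \<exists>k\<le>H. \<bar>Z_at \<omega> x k\<bar> \<ge> a}
      \<le> (2 * real R + 1) * (real H + 1) * (2 * exp (- (a\<^sup>2 / real H)))"
    unfolding eq .
qed

section \<open>Fluctuation and separation of \<open>S\<close> over windows of odometer
  values\<close>

definition site_index :: "int \<Rightarrow> nat \<Rightarrow> nat \<Rightarrow> bool \<times> int \<times> nat" where
  "site_index x K j = (even j, x, K + j div 2 + 1)"

text \<open>\<open>site_index\<close> interleaves the oil and water signs of \<open>x\<close> beyond
  index \<open>K\<close>; with these alternating weights the walk at the even times is the increment
  of \<open>S_at\<close> from \<open>K\<close> on.\<close>

definition site_coeff :: "nat \<Rightarrow> real" where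
  "site_coeff j = (if even j then 1 / 2 else - 1 / 2)"

lemma inj_site_index: "inj_on (site_index x K) A"
  by (auto simp: inj_on_def site_index_def) (metis even_two_times_div_two odd_two_times_div_two_succ)

lemma site_index_image: "site_index x K ` {..<2 * w} \<subseteq> site x (K + w)"
  by (auto simp: site_index_def site_def)

lemma site_index_image': "site_index x K ` A \<subseteq> UNIV \<times> UNIV \<times> {1..}"
  by (auto simp: site_index_def)

lemma sum_site_coeff: "(\<Sum>j<2 * w. (site_coeff j)\<^sup>2) = real w / 2"
proof -
  have c: "(site_coeff j)\<^sup>2 = 1 / 4" for j
    by (simp add: site_coeff_def power2_eq_square)
  show ?thesis unfolding c by simp
qed

lemma walk_site: "walk (site_index x K) site_coeff (2 * k) \<omega> = S_at \<omega> x (K + k) - S_at \<omega> x K"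
proof (induction k)
  case 0
  then show ?case by (simp add: walk_def)
next
  case (Suc k)
  have "walk (site_index x K) site_coeff (2 * Suc k) \<omega> = walk (site_index x K) site_coeff (2 * k) \<omega>
      + (\<sigma> (True, x, Suc (K + k)) \<omega> - \<sigma> (False, x, Suc (K + k)) \<omega>) / 2"
    by (simp add: walk_def site_index_def site_coeff_def field_simps)
  then show ?case using Suc by (simp add: S_at_Suc)
qed

text \<open>The half steps at odd times are included, so this bounds the oscillation of
  \<open>S_at\<close> over the window from above.\<close>

definition fluctuation :: "int \<Rightarrow> nat \<Rightarrow> nat \<Rightarrow> 'a \<Rightarrow> real" where
  "fluctuation x K w \<omega> = running_max (\<lambda>k. \<bar>walk (site_index x K) site_coeff k \<omega>\<bar>) (2 * w)"

lemma fluctuation_ge: "i \<le> w \<Longrightarrow> \<bar>S_at \<omega> x (K + i) - S_at \<omega> x K\<bar> \<le> fluctuation x K w \<omega>"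
  unfolding fluctuation_def walk_site[symmetric] by (rule running_max_ge) simp

lemma fluctuation_nonneg: "fluctuation x K w \<omega> \<ge> 0"
  using fluctuation_ge[of 0 w \<omega> x K] by linarith

lemma depends_fluctuation: "depends (site x (K + w)) (\<lambda>\<omega>. f (fluctuation x K w \<omega>))"
  unfolding fluctuation_def
  by (rule depends_mono[OF depends_walk_upto site_index_image])
     (auto intro!: arg_cong[where f = f] running_max_cong)

lemma prob_fluctuation:
  assumes "a > 0"
  shows "prob {\<omega> \<in> space M. fluctuation x K w \<omega> \<ge> a} \<le> 4 * real w / a\<^sup>2"
  using maximal_inequality_walk[where n = "2 * w" and c = site_coeff,
      OF inj_site_index[of x K] site_index_image' assms]
  by (simp add: fluctuation_def sum_site_coeff)

text \<open>Quantifying over all values in the window decouples the event from the actual odometer,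
  which is correlated with the stacks.\<close>

definition separated :: "nat \<Rightarrow> nat \<Rightarrow> int \<Rightarrow> int \<Rightarrow> 'a \<Rightarrow> bool" where
  "separated K w x x' \<omega> \<longleftrightarrow>
    (\<forall>k\<in>{K..K + w}. \<forall>l\<in>{K..K + w}. \<bar>S_at \<omega> x k - S_at \<omega> x' l\<bar> \<ge> sqrt (real K) / 4)"

lemma depends_separated: "depends (site x (K + w) \<union> site x' (K + w)) (separated K w x x')"
proof (rule dependsI)
  fix \<omega> \<omega>' assume *: "\<And>i. i \<in> site x (K + w) \<union> site x' (K + w) \<Longrightarrow> \<xi> i \<omega> = \<xi> i \<omega>'"
  have "S_at \<omega> x k = S_at \<omega>' x k" "S_at \<omega> x' k = S_at \<omega>' x' k" if "k \<in> {K..K + w}" for k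
    using that * by (auto intro!: S_at_cong[where m = "K + w"])
  then show "separated K w x x' \<omega> = separated K w x x' \<omega>'"
    by (simp add: separated_def)
qed

text \<open>At \<open>K\<close> the difference has variance \<open>K\<close>, so it is at least
  \<open>sqrt K / 2\<close> with probability at least \<open>3 / 16\<close>. Each site fluctuates by
  \<open>sqrt K / 8\<close> with probability at most \<open>256 * w / K \<le> 1 / 32\<close>.
  Subtracting twice gives \<open>sqrt K / 4\<close> and \<open>1 / 8\<close>.\<close>

lemma prob_separated:
  assumes "x \<noteq> x'" "w \<ge> 1" "K \<ge> 8192 * w"
  shows "prob {\<omega> \<in> space M. separated K w x x' \<omega>} \<ge> 1 / 8"
proof -
  let ?J = "site x K \<union> site x' K"
  define c :: "bool \<times> int \<times> nat \<Rightarrow> real"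
    where "c i = (if fst i then 1 / 2 else - 1 / 2) * (if fst (snd i) = x then 1 else - 1)" for i
  define V where "V \<omega> = (\<Sum>i\<in>?J. c i * \<sigma> i \<omega>)" for \<omega>
  have K: "real K > 0" using assms by simp
  have disj: "site x K \<inter> site x' K = {}" using assms(1) by (auto simp: site_def)
  have V: "V \<omega> = S_at \<omega> x K - S_at \<omega> x' K" for \<omega>
  proof -
    have "(\<Sum>i\<in>site x K. c i * \<sigma> i \<omega>) = S_at \<omega> x K"
      unfolding S_at_eq_sum by (intro sum.cong) (auto simp: c_def site_def)
    moreover have "(\<Sum>i\<in>site x' K. c i * \<sigma> i \<omega>) = - S_at \<omega> x' K"
      unfolding S_at_eq_sum sum_negf[symmetric] using assms(1) by (intro sum.cong) (auto simp: c_def site_def)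
    ultimately show ?thesis
      unfolding V_def by (simp add: sum.union_disjoint disj)
  qed
  have c2: "(c i)\<^sup>2 = 1 / 4" for i
    by (simp add: c_def power2_eq_square)
  have "(\<Sum>i\<in>?J. (c i)\<^sup>2) = real K"
    unfolding c2 by (simp add: card_Un_disjoint disj) (simp add: site_def card_cartesian_product)
  then have PZ: "prob {\<omega> \<in> space M. (V \<omega>)\<^sup>2 \<ge> real K / 4} \<ge> 3 / 16"
    unfolding V_def using K site_subset by (intro paley_zygmund_signs) auto
  define A where "A = {\<omega> \<in> space M. separated K w x x' \<omega>}"
  define B where "B y = {\<omega> \<in> space M. fluctuation y K w \<omega> \<ge> sqrt (real K) / 8}" for y
  have B: "B y \<in> events" for y
    unfolding B_def
    by (rule depends_event[OF finite_site site_subset depends_fluctuation[where f = "\<lambda>z. sqrt (real K) / 8 \<le> z"]])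
  have A: "A \<in> events"
    unfolding A_def by (rule depends_event[OF _ _ depends_separated]) (use site_subset in auto)
  have pB: "prob (B y) \<le> 1 / 32" for y
  proof -
    have "prob (B y) \<le> 4 * real w / (sqrt (real K) / 8)\<^sup>2"
      unfolding B_def using K by (intro prob_fluctuation) simp
    also have "\<dots> = 256 * real w / real K"
      by (simp add: power_divide)
    also have "\<dots> \<le> 1 / 32"
      using K assms(3) by (simp add: field_simps)
    finally show ?thesis .
  qed
  have "{\<omega> \<in> space M. (V \<omega>)\<^sup>2 \<ge> real K / 4} \<subseteq> A \<union> (B x \<union> B x')"
  proof
    fix \<omega> assume "\<omega> \<in> {\<omega> \<in> space M. (V \<omega>)\<^sup>2 \<ge> real K / 4}"
    then have \<omega>: "\<omega> \<in> space M" and v: "(V \<omega>)\<^sup>2 \<ge> real K / 4" by auto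
    have "sqrt (real K / 4) \<le> sqrt ((V \<omega>)\<^sup>2)"
      using v by (rule real_sqrt_le_mono)
    then have v': "sqrt (real K) / 2 \<le> \<bar>S_at \<omega> x K - S_at \<omega> x' K\<bar>"
      by (simp add: V real_sqrt_divide)
    show "\<omega> \<in> A \<union> (B x \<union> B x')"
    proof (rule ccontr)
      assume "\<omega> \<notin> A \<union> (B x \<union> B x')"
      then have n: "\<not> separated K w x x' \<omega>"
        and f: "fluctuation x K w \<omega> < sqrt (real K) / 8" "fluctuation x' K w \<omega> < sqrt (real K) / 8"
        using \<omega> by (auto simp: A_def B_def)
      have "\<bar>S_at \<omega> x k - S_at \<omega> x' l\<bar> \<ge> sqrt (real K) / 4" if "k \<in> {K..K + w}" "l \<in> {K..K + w}" for k l
      proof -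
        have "\<bar>S_at \<omega> x k - S_at \<omega> x K\<bar> \<le> fluctuation x K w \<omega>"
          using fluctuation_ge[of "k - K" w \<omega> x K] that(1) by auto
        moreover have "\<bar>S_at \<omega> x' l - S_at \<omega> x' K\<bar> \<le> fluctuation x' K w \<omega>"
          using fluctuation_ge[of "l - K" w \<omega> x' K] that(2) by auto
        ultimately show ?thesis using f v' by linarith
      qed
      then show False using n by (simp add: separated_def)
    qed
  qed
  then have "3 / 16 \<le> prob (A \<union> (B x \<union> B x'))"
    using PZ finite_measure_mono[of "{\<omega> \<in> space M. (V \<omega>)\<^sup>2 \<ge> real K / 4}" "A \<union> (B x \<union> B x')"] A B by auto
  also have "\<dots> \<le> prob A + (prob (B x) + prob (B x'))"
    using A B measure_Un_le[of A M "B x \<union> B x'"] measure_Un_le[of "B x" M "B x'"] by auto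
  finally show ?thesis
    using pB[of x] pB[of x'] by (simp add: A_def)
qed

definition separated_pairs :: "nat \<Rightarrow> nat \<Rightarrow> nat \<Rightarrow> int \<Rightarrow> 'a \<Rightarrow> nat set" where
  "separated_pairs K w q x \<omega> = {j. j < q \<and> separated K w (x - 4 * int j - 3) (x - 4 * int j - 1) \<omega>}"

text \<open>Different pairs use disjoint sites, so the count is a sum of independent indicators of
  mean at least \<open>1 / 8\<close>, and Hoeffding's inequality applies to a deviation of at least
  \<open>q / 16\<close>.\<close>

lemma prob_few_separated:
  assumes "q \<ge> 1" "w \<ge> 1" "K \<ge> 8192 * w"
  shows "prob {\<omega> \<in> space M. real (card (separated_pairs K w q x \<omega>)) \<le> real q / 16} \<le> exp (- (real q / 128))"
    and "{\<omega> \<in> space M. real (card (separated_pairs K w q x \<omega>)) \<le> real q / 16} \<in> events"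
proof -
  define L where "L j = site (x - 4 * int j - 3) (K + w) \<union> site (x - 4 * int j - 1) (K + w)" for j
  define F :: "nat \<Rightarrow> 'a \<Rightarrow> real"
    where "F j \<omega> = (if separated K w (x - 4 * int j - 3) (x - 4 * int j - 1) \<omega> then 1 else 0)" for j \<omega>
  have L: "finite (L j)" "L j \<subseteq> UNIV \<times> UNIV \<times> {1..}" for j
    using site_subset by (auto simp: L_def)
  have dF: "depends (L j) (F j)" for j
    using depends_separated[of "x - 4 * int j - 3" K w "x - 4 * int j - 1"]
    unfolding F_def L_def depends_def by metis
  have Fr: "0 \<le> F j \<omega>" "F j \<omega> \<le> 1" for j \<omega>
    by (simp_all add: F_def)
  have dis: "disjoint_family_on L {..<q}"
    unfolding disjoint_family_on_def L_def site_def
    by (auto; presburger)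
  have card: "(\<Sum>j<q. F j \<omega>) = real (card (separated_pairs K w q x \<omega>))" for \<omega>
  proof -
    have "(\<Sum>j<q. F j \<omega>) = (\<Sum>j\<in>separated_pairs K w q x \<omega>. 1)"
      unfolding F_def by (subst sum.inter_filter[symmetric]) (auto simp: separated_pairs_def intro!: sum.cong)
    then show ?thesis by simp
  qed
  have EF: "expectation (F j) \<ge> 1 / 8" for j
  proof -
    let ?A = "{\<omega> \<in> space M. separated K w (x - 4 * int j - 3) (x - 4 * int j - 1) \<omega>}"
    have A: "?A \<in> events"
      by (rule depends_event[OF _ _ depends_separated]) (use site_subset in auto)
    have "expectation (F j) = expectation (indicator ?A)"
      by (intro Bochner_Integration.integral_cong) (auto simp: F_def indicator_def)
    then show ?thesis
      using prob_separated[of "x - 4 * int j - 3" "x - 4 * int j - 1" w K] assms A by simp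
  qed
  \<comment> \<open>The means are known only from below; this choice puts the threshold exactly at
    \<open>q / 16\<close>.\<close>
  define \<epsilon> where "\<epsilon> = (\<Sum>j<q. expectation (F j)) - real q / 16"
  have "(\<Sum>j<q. 1 / 8 :: real) \<le> (\<Sum>j<q. expectation (F j))"
    by (rule sum_mono) (rule EF)
  then have \<epsilon>: "\<epsilon> \<ge> real q / 16" by (simp add: \<epsilon>_def)
  have "prob {\<omega> \<in> space M. (\<Sum>j<q. F j \<omega>) \<le> (\<Sum>j<q. expectation (F j)) - \<epsilon>}
      \<le> exp (- 2 * \<epsilon>\<^sup>2 / (real (card {..<q}) * 1\<^sup>2))"
    by (rule hoeffding_blocks(2)[where L = L])
       (use assms(1) L dF dis \<epsilon> Fr in \<open>auto simp: lessThan_empty_iff intro: order_trans[rotated]\<close>)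
  also have "\<dots> \<le> exp (- (real q / 128))"
  proof -
    have "(real q / 16)\<^sup>2 \<le> \<epsilon>\<^sup>2" using \<epsilon> by (intro power_mono) auto
    then have "real q * real q / 256 \<le> \<epsilon>\<^sup>2" by (simp add: power2_eq_square)
    then show ?thesis using assms(1) by (simp add: field_simps)
  qed
  finally show "prob {\<omega> \<in> space M. real (card (separated_pairs K w q x \<omega>)) \<le> real q / 16} \<le> exp (- (real q / 128))"
    by (simp add: card \<epsilon>_def)
  have "F j \<in> borel_measurable M" for j
    by (rule depends_measurable[OF L dF]) auto
  then show "{\<omega> \<in> space M. real (card (separated_pairs K w q x \<omega>)) \<le> real q / 16} \<in> events"
    unfolding card[symmetric] by measurable
qed

text \<open>The second moment is at most \<open>4 * h\<close>, and
  \<open>f \<le> f\<^sup>2 / (2 * a) + a / 2\<close> turns it into a bound for the mean.\<close>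

lemma expectation_fluctuation:
  assumes "a > 0" "a\<^sup>2 \<ge> 4 * real h"
  shows "expectation (fluctuation y K h) \<le> a"
proof -
  have int: "integrable M (\<lambda>\<omega>. f (fluctuation y K h \<omega>))" for f :: "real \<Rightarrow> real"
    by (rule depends_integrable[OF finite_site site_subset depends_fluctuation])
  have m2: "expectation (\<lambda>\<omega>. (fluctuation y K h \<omega>)\<^sup>2) \<le> 4 * real h"
    using doob_abs_walk[where n = "2 * h" and c = site_coeff, OF inj_site_index[of y K] site_index_image']
    by (simp add: fluctuation_def sum_site_coeff)
  have "expectation (fluctuation y K h) \<le> expectation (\<lambda>\<omega>. (fluctuation y K h \<omega>)\<^sup>2 / (2 * a) + a / 2)"
  proof (rule integral_mono)
    show "fluctuation y K h \<omega> \<le> (fluctuation y K h \<omega>)\<^sup>2 / (2 * a) + a / 2" for \<omega>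
      using zero_le_power2[of "fluctuation y K h \<omega> - a"] assms(1)
      by (simp add: field_simps power2_eq_square)
  qed (use int[of "\<lambda>z. z"] int[of "\<lambda>z. z\<^sup>2 / (2 * a) + a / 2"] in auto)
  also have "\<dots> = expectation (\<lambda>\<omega>. (fluctuation y K h \<omega>)\<^sup>2) / (2 * a) + a / 2"
    using int[of "\<lambda>z. z\<^sup>2"] by (simp add: prob_space)
  also have "\<dots> \<le> a\<^sup>2 / (2 * a) + a / 2"
    using m2 assms by (intro add_right_mono divide_right_mono) auto
  also have "\<dots> = a" using assms(1) by (simp add: power2_eq_square)
  finally show ?thesis .
qed

text \<open>A Gaussian tail, by Hoeffding's inequality at every time up to \<open>2 * h\<close>, is
  needed for the truncation below; the maximal inequality decays only like
  \<open>1 / a\<^sup>2\<close>.\<close>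

lemma prob_fluctuation_large:
  assumes "h \<ge> 1" "a \<ge> 0"
  shows "prob {\<omega> \<in> space M. fluctuation y K h \<omega> \<ge> a} \<le> (2 * real h + 1) * (2 * exp (- (a\<^sup>2 / real h)))"
proof -
  define A where "A k = {\<omega> \<in> space M. \<bar>walk (site_index y K) site_coeff k \<omega>\<bar> \<ge> a}" for k
  have dep: "depends (site_index y K ` {..<k}) (\<lambda>\<omega>. f (walk (site_index y K) site_coeff k \<omega>))" for k and f :: "real \<Rightarrow> 'c"
    by (rule depends_walk_upto[where f = "\<lambda>s. f (s k)"]) auto
  have A: "A k \<in> events" for k
    unfolding A_def
    by (rule depends_event[OF _ site_index_image' dep[of k "\<lambda>z. \<bar>z\<bar> \<ge> a"]]) auto
  have pA: "prob (A k) \<le> 2 * exp (- (a\<^sup>2 / real h))" if "k \<le> 2 * h" for k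
  proof -
    define d where "d i = (if fst i then 1 / 2 else - 1 / 2 :: real)" for i :: "bool \<times> int \<times> nat"
    have "walk (site_index y K) site_coeff k \<omega> = (\<Sum>i\<in>site_index y K ` {..<k}. d i * \<sigma> i \<omega>)" for \<omega>
      unfolding walk_def
      by (subst sum.reindex[OF inj_site_index]) (auto simp: d_def site_coeff_def site_index_def intro!: sum.cong)
    moreover have "prob {\<omega> \<in> space M. \<bar>\<Sum>i\<in>site_index y K ` {..<k}. d i * \<sigma> i \<omega>\<bar> \<ge> a}
        \<le> 2 * exp (- (a\<^sup>2 / (2 * (real h / 2))))"
    proof (rule hoeffding_signs)
      have d2: "(d i)\<^sup>2 = 1 / 4" for i by (simp add: d_def power2_eq_square)
      show "(\<Sum>i\<in>site_index y K ` {..<k}. (d i)\<^sup>2) \<le> real h / 2"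
        unfolding d2 using that by (simp add: card_image inj_site_index)
    qed (use assms site_index_image' in auto)
    ultimately show ?thesis by (simp add: A_def)
  qed
  have "{\<omega> \<in> space M. fluctuation y K h \<omega> \<ge> a} \<subseteq> (\<Union>k\<in>{..2 * h}. A k)"
  proof
    fix \<omega> assume "\<omega> \<in> {\<omega> \<in> space M. fluctuation y K h \<omega> \<ge> a}"
    moreover obtain k where "k \<le> 2 * h" "fluctuation y K h \<omega> = \<bar>walk (site_index y K) site_coeff k \<omega>\<bar>"
      unfolding fluctuation_def using running_max_attained by blast
    ultimately show "\<omega> \<in> (\<Union>k\<in>{..2 * h}. A k)" by (auto simp: A_def)
  qed
  then have "prob {\<omega> \<in> space M. fluctuation y K h \<omega> \<ge> a} \<le> prob (\<Union>k\<in>{..2 * h}. A k)"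
    using A by (intro finite_measure_mono) auto
  also have "\<dots> \<le> (\<Sum>k\<in>{..2 * h}. prob (A k))"
    using A by (intro finite_measure_subadditive_finite) auto
  also have "\<dots> \<le> (\<Sum>k\<in>{..2 * h}. 2 * exp (- (a\<^sup>2 / real h)))"
    by (intro sum_mono pA) auto
  also have "\<dots> = (2 * real h + 1) * (2 * exp (- (a\<^sup>2 / real h)))"
    by (simp add: algebra_simps)
  finally show ?thesis .
qed

text \<open>The maxima are truncated at \<open>a\<close> in order to apply Hoeffding's inequality to their sum.\<close>

lemma prob_fluctuation_sum:
  assumes "finite A" "A \<noteq> {}" "h \<ge> 1" "a > 0" "b > 0" "b\<^sup>2 \<ge> 4 * real h" "\<epsilon> \<ge> 0"
  shows "prob {\<omega> \<in> space M. (\<Sum>y\<in>A. fluctuation y 0 h \<omega>) \<ge> real (card A) * b + \<epsilon>}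
      \<le> exp (- 2 * \<epsilon>\<^sup>2 / (real (card A) * a\<^sup>2)) + real (card A) * ((2 * real h + 1) * (2 * exp (- (a\<^sup>2 / real h))))"
    and "{\<omega> \<in> space M. (\<Sum>y\<in>A. fluctuation y 0 h \<omega>) \<ge> real (card A) * b + \<epsilon>} \<in> events"
proof -
  define F where "F y \<omega> = min (fluctuation y 0 h \<omega>) a" for y \<omega>
  define B where "B y = {\<omega> \<in> space M. fluctuation y 0 h \<omega> \<ge> a}" for y
  define C where "C = {\<omega> \<in> space M. (\<Sum>y\<in>A. F y \<omega>) \<ge> (\<Sum>y\<in>A. expectation (F y)) + \<epsilon>}"
  note dep = depends_fluctuation[where K = 0, simplified]
  have B: "B y \<in> events" for y
    unfolding B_def
    by (rule depends_event[OF finite_site site_subset dep[where f = "\<lambda>z. a \<le> z"]])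
  have dF: "depends (site y h) (F y)" for y
    unfolding F_def by (rule dep)
  have mF [measurable]: "F y \<in> borel_measurable M" for y
    by (rule depends_measurable[OF finite_site site_subset dF]) auto
  have mf [measurable]: "fluctuation y 0 h \<in> borel_measurable M" for y
    by (rule depends_measurable[OF finite_site site_subset dep[where f = "\<lambda>z. z"]]) auto
  have C: "C \<in> events" unfolding C_def by measurable
  show "{\<omega> \<in> space M. (\<Sum>y\<in>A. fluctuation y 0 h \<omega>) \<ge> real (card A) * b + \<epsilon>} \<in> events"
    by measurable
  have pC: "prob C \<le> exp (- 2 * \<epsilon>\<^sup>2 / (real (card A) * a\<^sup>2))"
    unfolding C_def
    by (rule hoeffding_blocks(1)[where L = "\<lambda>y. site y h"])
       (use assms dF site_subset fluctuation_nonneg in \<open>auto simp: F_def disjoint_family_on_def site_def\<close>)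
  have "expectation (F y) \<le> b" for y
  proof -
    have "expectation (F y) \<le> expectation (fluctuation y 0 h)"
      by (intro integral_mono depends_integrable[OF finite_site site_subset dF]
            depends_integrable[OF finite_site site_subset dep[where f = "\<lambda>z. z"]]) (simp add: F_def)
    also have "\<dots> \<le> b" by (rule expectation_fluctuation) (use assms in auto)
    finally show ?thesis .
  qed
  then have "(\<Sum>y\<in>A. expectation (F y)) \<le> (\<Sum>y\<in>A. b)" by (intro sum_mono)
  then have EF: "(\<Sum>y\<in>A. expectation (F y)) \<le> real (card A) * b" by simp
  have "{\<omega> \<in> space M. (\<Sum>y\<in>A. fluctuation y 0 h \<omega>) \<ge> real (card A) * b + \<epsilon>} \<subseteq> C \<union> (\<Union>y\<in>A. B y)"
  proof
    fix \<omega> assume *: "\<omega> \<in> {\<omega> \<in> space M. (\<Sum>y\<in>A. fluctuation y 0 h \<omega>) \<ge> real (card A) * b + \<epsilon>}"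
    show "\<omega> \<in> C \<union> (\<Union>y\<in>A. B y)"
    \<comment> \<open>Outside the events \<open>B y\<close> truncation changes nothing.\<close>
    proof (cases "\<exists>y\<in>A. fluctuation y 0 h \<omega> \<ge> a")
      case True
      then show ?thesis using * by (auto simp: B_def)
    next
      case False
      then have "(\<Sum>y\<in>A. F y \<omega>) = (\<Sum>y\<in>A. fluctuation y 0 h \<omega>)"
        by (intro sum.cong) (auto simp: F_def)
      then show ?thesis using * EF by (auto simp: C_def)
    qed
  qed
  then have "prob {\<omega> \<in> space M. (\<Sum>y\<in>A. fluctuation y 0 h \<omega>) \<ge> real (card A) * b + \<epsilon>} \<le> prob (C \<union> (\<Union>y\<in>A. B y))"
    using B C assms(1) by (intro finite_measure_mono) auto
  also have "\<dots> \<le> prob C + prob (\<Union>y\<in>A. B y)"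
    using B C assms(1) by (intro measure_Un_le) auto
  also have "prob (\<Union>y\<in>A. B y) \<le> (\<Sum>y\<in>A. prob (B y))"
    using B assms(1) by (intro finite_measure_subadditive_finite) auto
  also have "\<dots> \<le> (\<Sum>y\<in>A. (2 * real h + 1) * (2 * exp (- (a\<^sup>2 / real h))))"
    unfolding B_def using assms by (intro sum_mono prob_fluctuation_large) auto
  finally show "prob {\<omega> \<in> space M. (\<Sum>y\<in>A. fluctuation y 0 h \<omega>) \<ge> real (card A) * b + \<epsilon>}
      \<le> exp (- 2 * \<epsilon>\<^sup>2 / (real (card A) * a\<^sup>2)) + real (card A) * ((2 * real h + 1) * (2 * exp (- (a\<^sup>2 / real h))))"
    using pC by simp
qed

section \<open>Consequences for the odometer\<close>

text \<open>Half the sum of the two doubled balances gives the number of particles, half their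
  difference gives oil minus water, whose modulus is at most that number.\<close>

lemma profile_state:
  "profile (real n) (\<lambda>x. real (fired (state n \<omega> t) x))
     (\<lambda>x. S_at \<omega> x (fired (state n \<omega> t) x)) (\<lambda>x. Z_at \<omega> x (fired (state n \<omega> t) x))
     (\<lambda>x. real (oil (state n \<omega> t) x) + real (water (state n \<omega> t) x))"
proof -
  let ?s = "state n \<omega> t"
  let ?A = "\<lambda>x. real_of_int (partial_sum (\<lambda>j. \<xi> (True, x, j) \<omega>) (fired ?s x))"
  let ?B = "\<lambda>x. real_of_int (partial_sum (\<lambda>j. \<xi> (False, x, j) \<omega>) (fired ?s x))"
  let ?u = "\<lambda>x. real (fired ?s x)"
  have o: "2 * real (oil ?s x) = (if x = 0 then 2 * real n else 0) + (?u (x - 1) + ?A (x - 1))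
      + (?u (x + 1) - ?A (x + 1)) - 2 * ?u x" for x
    using arg_cong[OF stacks.balanced_state(1)[OF stacks_signs, of n \<omega> t, unfolded balanced_def, rule_format, of x],
        of real_of_int] by (simp split: if_splits)
  have w: "2 * real (water ?s x) = (if x = 0 then 2 * real n else 0) + (?u (x - 1) + ?B (x - 1))
      + (?u (x + 1) - ?B (x + 1)) - 2 * ?u x" for x
    using arg_cong[OF stacks.balanced_state(2)[OF stacks_signs, of n \<omega> t, unfolded balanced_def, rule_format, of x],
        of real_of_int] by (simp split: if_splits)
  show ?thesis
  proof
    fix x
    show "real (oil ?s x) + real (water ?s x) = (if x = 0 then 2 * real n else 0) + ?u (x - 1) + ?u (x + 1)
        - 2 * ?u x + Z_at \<omega> (x - 1) (fired ?s (x - 1)) - Z_at \<omega> (x + 1) (fired ?s (x + 1))"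
      using o[of x] w[of x] by (simp add: Z_at_def field_simps split: if_splits)
    have "S_at \<omega> (x - 1) (fired ?s (x - 1)) - S_at \<omega> (x + 1) (fired ?s (x + 1))
        = real (oil ?s x) - real (water ?s x)"
      using o[of x] w[of x] by (simp add: S_at_def field_simps split: if_splits)
    then show "\<bar>S_at \<omega> (x - 1) (fired ?s (x - 1)) - S_at \<omega> (x + 1) (fired ?s (x + 1))\<bar>
        \<le> real (oil ?s x) + real (water ?s x)"
      by simp
    show "\<exists>L>0. \<forall>x. \<bar>x\<bar> \<ge> L \<longrightarrow> real (fired ?s x) = 0 \<and> Z_at \<omega> x (fired ?s x) = 0"
      using state_support(3)[of t] by (intro exI[of _ "int t + 1"]) (auto simp: Z_at_def)
  qed simp
qed

text \<open>In a stopped state every site lacks one of the two types, so the modulus of the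
  difference is the sum.\<close>

lemma particles_stopped:
  assumes "stopped (state n \<omega> t)"
  shows "real (oil (state n \<omega> t) x) + real (water (state n \<omega> t) x)
    = \<bar>S_at \<omega> (x - 1) (fired (state n \<omega> t) (x - 1)) - S_at \<omega> (x + 1) (fired (state n \<omega> t) (x + 1))\<bar>"
proof -
  let ?s = "state n \<omega> t"
  have "2 * int (oil ?s x) - 2 * int (water ?s x)
      = partial_sum (\<lambda>j. \<xi> (True, x - 1, j) \<omega>) (fired ?s (x - 1)) - partial_sum (\<lambda>j. \<xi> (False, x - 1, j) \<omega>) (fired ?s (x - 1))
      - (partial_sum (\<lambda>j. \<xi> (True, x + 1, j) \<omega>) (fired ?s (x + 1)) - partial_sum (\<lambda>j. \<xi> (False, x + 1, j) \<omega>) (fired ?s (x + 1)))"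
    using stacks.balanced_state[OF stacks_signs, of n \<omega> t] unfolding balanced_def by simp
  from arg_cong[OF this, of real_of_int]
  have "real (oil ?s x) - real (water ?s x)
      = S_at \<omega> (x - 1) (fired ?s (x - 1)) - S_at \<omega> (x + 1) (fired ?s (x + 1))"
    by (simp add: S_at_def field_simps)
  moreover have "\<not> can_fire ?s x" using assms by (auto simp: stopped_def)
  then have "oil ?s x = 0 \<or> water ?s x = 0" by (auto simp: can_fire_def min_def split: if_splits)
  ultimately show ?thesis by auto
qed

lemma fired_within:
  assumes "\<not> escapes n r T \<omega>" "t \<le> T" "fired (state n \<omega> t) x > 0"
  shows "\<bar>x\<bar> \<le> int r"
proof -
  obtain j where "j < t" "oil (state n \<omega> j) x \<ge> 1"
    using stacks.fired_had_oil[OF stacks_signs assms(3)] by blast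
  then show ?thesis
    using assms(1,2) unfolding escapes_def by (meson less_imp_le not_le order_less_le_trans)
qed

text \<open>If \<open>x\<close> were the first site to reach \<open>K + w\<close>, the slope bound
  would keep the \<open>4 * q\<close> sites to its left in the window, and the separated pairs among
  them would hold too many particles. \<open>K = 8192 * w\<close> matches
  \<open>prob_separated\<close>.\<close>

lemma fired_less:
  fixes q :: nat
  defines "K \<equiv> 98304 * q ^ 4" and "w \<equiv> 12 * q ^ 4"
  assumes q: "q \<ge> 1" "real n \<le> real q ^ 3" and n: "n \<ge> 1"
    and Z: "\<And>x k. \<bar>x\<bar> \<le> int r + 4 * int q \<Longrightarrow> k \<le> K + w \<Longrightarrow> \<bar>Z_at \<omega> x k\<bar> \<le> real n / 16"
    and sep: "\<And>x. \<bar>x\<bar> \<le> int r \<Longrightarrow> real (card (separated_pairs K w q x \<omega>)) > real q / 16"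
    and esc: "\<not> escapes n r T \<omega>" and "t \<le> T"
  shows "fired (state n \<omega> t) x < K + w"
  using \<open>t \<le> T\<close>
proof (induction t arbitrary: x)
  case 0
  have "K + w > 0" using q(1) by (simp add: K_def)
  then show ?case by (simp add: initial_state_def)
next
  case (Suc t)
  let ?u = "fired (state n \<omega> (Suc t))"
  \<comment> \<open>Counters grow by at most one per step, so the level is reached exactly and not
    exceeded anywhere.\<close>
  have le: "?u y \<le> K + w" for y
    using Suc.IH[of y] Suc.prems fired_step_le[of _ _ "state n \<omega> t" y] unfolding state_at_Suc
    by (meson Suc_leD add_le_cancel_right le_trans less_iff_succ_less_eq)
  show ?case
  proof (rule ccontr)
    assume "\<not> ?u x < K + w"
    then have ux: "?u x = K + w" using le[of x] by simp
    interpret profile "real n" "\<lambda>x. real (?u x)" "\<lambda>x. S_at \<omega> x (?u x)" "\<lambda>x. Z_at \<omega> x (?u x)"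
      "\<lambda>x. real (oil (state n \<omega> (Suc t)) x) + real (water (state n \<omega> (Suc t)) x)"
      by (rule profile_state)
    have "?u x > 0" using ux q(1) by (simp add: K_def)
    then have xr: "\<bar>x\<bar> \<le> int r" by (rule fired_within[OF esc Suc.prems])
    have near: "?u y \<in> {K..K + w}" if y: "x - 4 * int q \<le> y" "y \<le> x" for y
    proof -
      have "\<bar>real (?u x) - real (?u y)\<bar> \<le> 3 * real n * real_of_int (x - y)"
      proof (rule slope_chain[OF y(2)])
        fix z assume "y \<le> z" "z \<le> x"
        then have "\<bar>Z_at \<omega> z (?u z)\<bar> \<le> real n / 16"
          using xr y by (intro Z le) auto
        then show "\<bar>Z_at \<omega> z (?u z)\<bar> \<le> real n / 2" by simp
      qed
      \<comment> \<open>Slope \<open>3 * n\<close> over a stretch of length \<open>4 * q\<close>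
        fixes the width \<open>w = 12 * q ^ 4\<close>.\<close>
      also have "\<dots> \<le> 3 * real q ^ 3 * (4 * real q)"
        using y(1) q(2) y(2) by (intro mult_mono) auto
      also have "\<dots> = real w" by (simp add: w_def power4_eq_xxxx power3_eq_cube)
      finally have "real (?u y) \<ge> real K" using ux by simp
      then show ?thesis using le[of y] by simp
    qed
    let ?G = "separated_pairs K w q x \<omega>"
    have fin: "finite ?G" by (simp add: separated_pairs_def)
    have "real (card ?G) * (sqrt (real K) / 4) \<le> 2 * real n"
    proof (rule discrepant_sites[OF fin])
      fix j assume j: "j \<in> ?G"
      then have "j < q" by (simp add: separated_pairs_def)
      have "?u (x - 4 * int j - 3) \<in> {K..K + w}" "?u (x - 4 * int j - 1) \<in> {K..K + w}"
        by (rule near; use \<open>j < q\<close> in simp)+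
      then show "sqrt (real K) / 4 \<le> \<bar>S_at \<omega> (x - 4 * int j - 3) (?u (x - 4 * int j - 3))
          - S_at \<omega> (x - 4 * int j - 1) (?u (x - 4 * int j - 1))\<bar>"
        using j by (auto simp: separated_pairs_def separated_def)
    qed
    \<comment> \<open>\<open>313\<^sup>2 = 97969 \<le> 98304\<close>; the contradiction then comes
      from \<open>313 / 64 > 2\<close>.\<close>
    moreover have "sqrt (real K) \<ge> 313 * real q ^ 2"
      by (rule real_le_rsqrt) (simp add: K_def power_mult_distrib flip: power_mult)
    then have "real q / 16 * (313 * real q ^ 2 / 4) \<le> real (card ?G) * (sqrt (real K) / 4)"
      using sep[OF xr] by (intro mult_mono) auto
    ultimately have "313 / 64 * real q ^ 3 \<le> 2 * real n"
      by (simp add: power2_eq_square power3_eq_cube)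
    moreover have "real q ^ 3 > 0" using q(1) by simp
    ultimately show False using q(2) by linarith
  qed
qed

text \<open>Pigeonhole: \<open>T\<close> firings do not fit on \<open>2 * r + 1\<close> sites firing
  fewer than \<open>H\<close> times each.\<close>

lemma stopped_by:
  assumes "H \<ge> 1" "\<not> escapes n r T \<omega>" "\<And>x. fired (state n \<omega> T) x < H" "T = (2 * r + 1) * H"
  shows "stopped (state n \<omega> T)"
proof (rule ccontr)
  assume ns: "\<not> stopped (state n \<omega> T)"
  have "\<not> stopped (state n \<omega> j)" if "j < T" for j
  proof
    assume "stopped (state n \<omega> j)"
    then have "state n \<omega> T = state n \<omega> j"
      by (rule state_at_stopped[OF less_imp_le[OF that]])
    with \<open>stopped (state n \<omega> j)\<close> ns show False by metis
  qed
  then have total: "(\<Sum>x\<in>{- int T..int T}. fired (state n \<omega> T) x) = T"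
    by (intro stacks.total_fired[OF stacks_signs]) simp_all
  have "(\<Sum>x\<in>{- int T..int T}. fired (state n \<omega> T) x)
      = (\<Sum>x\<in>{- int T..int T} \<inter> {- int r..int r}. fired (state n \<omega> T) x)"
  proof (rule sum.mono_neutral_right)
    show "\<forall>x\<in>{- int T..int T} - {- int T..int T} \<inter> {- int r..int r}. fired (state n \<omega> T) x = 0"
    proof
      fix x assume "x \<in> {- int T..int T} - {- int T..int T} \<inter> {- int r..int r}"
      then have "\<not> \<bar>x\<bar> \<le> int r" by auto
      then show "fired (state n \<omega> T) x = 0"
        using fired_within[OF assms(2) order_refl, of x] by linarith
    qed
  qed auto
  also have "\<dots> \<le> (\<Sum>x\<in>{- int r..int r}. fired (state n \<omega> T) x)"
    by (rule sum_mono2) auto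
  also have "\<dots> \<le> (\<Sum>x\<in>{- int r..int r}. H - 1)"
  proof (rule sum_mono)
    show "fired (state n \<omega> T) x \<le> H - 1" for x
      using assms(3)[of x] by linarith
  qed
  also have "\<dots> = (2 * r + 1) * (H - 1)" by (simp add: nat_add_distrib nat_mult_distrib)
  also have "\<dots> < (2 * r + 1) * H"
    using assms(1) by (intro mult_strict_left_mono) linarith+
  finally show False using assms(4) total by simp
qed

text \<open>\<open>S_at\<close> starts at 0, so \<open>fluctuation y 0 h\<close> serves as the bound
  \<open>m\<close> of \<open>odometer_lower_bound\<close>: it is fixed in advance and valid for
  every odometer value up to \<open>h\<close>.\<close>

lemma fired_ge:
  fixes p B :: nat
  defines "h \<equiv> 227 * B * p ^ 4"
  assumes "p \<ge> 1" "B \<ge> 1" "real B * real p ^ 3 \<le> real n" "real n \<le> 8 * real B * real p ^ 3"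
    and Z: "\<And>x k. \<bar>x\<bar> \<le> 202 * int p \<Longrightarrow> k \<le> H \<Longrightarrow> \<bar>Z_at \<omega> x k\<bar> \<le> real n / 16"
    and "stopped (state n \<omega> T)" "\<And>x. fired (state n \<omega> T) x \<le> H"
    and sum: "(\<Sum>y\<in>{- 202 * int p..202 * int p}. fluctuation y 0 h \<omega>) \<le> real n / 8"
    and "\<bar>x\<bar> \<le> int p"
  shows "real (fired (state n \<omega> T) x) \<ge> real p ^ 4"
proof -
  let ?u = "fired (state n \<omega> T)"
  interpret profile "real n" "\<lambda>x. real (?u x)" "\<lambda>x. S_at \<omega> x (?u x)" "\<lambda>x. Z_at \<omega> x (?u x)"
    "\<lambda>x. real (oil (state n \<omega> T) x) + real (water (state n \<omega> T) x)"
    by (rule profile_state)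
  show ?thesis
  proof (rule odometer_lower_bound[where B = "real B" and m = "\<lambda>y. fluctuation y 0 h \<omega>"])
    show "\<bar>S_at \<omega> y (?u y)\<bar> \<le> fluctuation y 0 h \<omega>" if "real (?u y) \<le> 227 * real B * real p ^ 4" for y
    proof -
      have "real (?u y) \<le> real h" using that by (simp add: h_def)
      then have "?u y \<le> h" by simp
      from fluctuation_ge[OF this, of \<omega> y 0] show ?thesis by simp
    qed
    show "\<bar>Z_at \<omega> y (?u y)\<bar> \<le> real n / 16" if "\<bar>y\<bar> \<le> 202 * int p" for y
      by (rule Z[OF that assms(8)])
    show "real (oil (state n \<omega> T) y) + real (water (state n \<omega> T) y)
        = \<bar>S_at \<omega> (y - 1) (?u (y - 1)) - S_at \<omega> (y + 1) (?u (y + 1))\<bar>" for y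
      by (rule particles_stopped[OF assms(7)])
  qed (use assms(2-5,10) sum fluctuation_nonneg in simp_all)
qed

end

section \<open>Choice of scales and exceptional events\<close>

definition upper_scale :: "nat \<Rightarrow> nat" where
  "upper_scale n = nat \<lceil>real n powr (1 / 3)\<rceil>"

text \<open>\<open>4000 ^ 3 = 64000000000\<close> is the constant \<open>B\<close> of the lower
  bound.\<close>

definition lower_scale :: "nat \<Rightarrow> nat" where
  "lower_scale n = nat \<lfloor>real n powr (1 / 3) / 4000\<rfloor>"

definition max_odometer :: "nat \<Rightarrow> nat" where
  "max_odometer n = 98304 * upper_scale n ^ 4 + 12 * upper_scale n ^ 4"

text \<open>The number of steps in \<open>stopped_by\<close> for the radius
  \<open>n\<^sup>2\<close>, which exceeds \<open>max_odometer\<close> by a factor of order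
  \<open>n powr (2 / 3)\<close> and so makes escape unlikely.\<close>

definition horizon :: "nat \<Rightarrow> nat" where
  "horizon n = (2 * n\<^sup>2 + 1) * max_odometer n"

lemma powr_third_power:
  assumes "n \<ge> 1"
  shows "(real n powr (1 / 3)) ^ 3 = real n" "(real n powr (1 / 3)) ^ 4 = real n powr (4 / 3)"
    "real n powr (1 / 10) = (real n powr (1 / 3)) powr (3 / 10)"
  using assms by (simp_all add: powr_powr flip: powr_numeral)

text \<open>Rounding up costs at most a factor 2, and
  \<open>1573056 = 2 ^ 4 * (98304 + 12)\<close>.\<close>

lemma upper_scale_bounds:
  assumes "n \<ge> 1"
  shows "upper_scale n \<ge> 1" "real n powr (1 / 3) \<le> real (upper_scale n)"
    "real (upper_scale n) \<le> 2 * real n powr (1 / 3)" "real n \<le> real (upper_scale n) ^ 3"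
    "real (max_odometer n) \<le> 1573056 * (real n powr (1 / 3)) ^ 4"
proof -
  let ?z = "real n powr (1 / 3)"
  have z: "?z \<ge> 1" using assms by (intro ge_one_powr_ge_zero) auto
  show 1: "?z \<le> real (upper_scale n)"
    unfolding upper_scale_def by (rule real_nat_ceiling_ge)
  with z show "upper_scale n \<ge> 1" by linarith
  have "real (upper_scale n) < ?z + 1"
    unfolding upper_scale_def using z by linarith
  with z show 2: "real (upper_scale n) \<le> 2 * ?z" by linarith
  have "?z ^ 3 \<le> real (upper_scale n) ^ 3"
    using 1 by (intro power_mono) auto
  then show "real n \<le> real (upper_scale n) ^ 3"
    using powr_third_power(1)[OF assms] by simp
  have "real (upper_scale n) ^ 4 \<le> (2 * ?z) ^ 4"
    using 2 by (intro power_mono) auto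
  then show "real (max_odometer n) \<le> 1573056 * ?z ^ 4"
    by (simp add: max_odometer_def power_mult_distrib)
qed

text \<open>From 8000 on, rounding down loses at most a factor 2, hence the factor
  \<open>8 = 2 ^ 3\<close> in the last bound.\<close>

lemma lower_scale_bounds:
  assumes "real n powr (1 / 3) \<ge> 8000"
  shows "lower_scale n \<ge> 1" "real n powr (1 / 3) / 8000 \<le> real (lower_scale n)"
    "real (lower_scale n) \<le> real n powr (1 / 3) / 4000"
    "64000000000 * real (lower_scale n) ^ 3 \<le> real n"
    "real n \<le> 8 * 64000000000 * real (lower_scale n) ^ 3"
proof -
  let ?z = "real n powr (1 / 3)"
  have n: "n \<ge> 1" using assms by (cases n) auto
  have "real (lower_scale n) > ?z / 4000 - 1"
    unfolding lower_scale_def using assms by linarith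
  with assms show 1: "?z / 8000 \<le> real (lower_scale n)" by linarith
  with assms show "lower_scale n \<ge> 1" by linarith
  show 2: "real (lower_scale n) \<le> ?z / 4000"
    unfolding lower_scale_def using assms by linarith
  have "real (lower_scale n) ^ 3 \<le> (?z / 4000) ^ 3"
    using 2 by (intro power_mono) auto
  then show "64000000000 * real (lower_scale n) ^ 3 \<le> real n"
    using powr_third_power(1)[OF n] by (simp add: power_divide)
  have "(?z / 8000) ^ 3 \<le> real (lower_scale n) ^ 3"
    using 1 by (intro power_mono) auto
  then show "real n \<le> 8 * 64000000000 * real (lower_scale n) ^ 3"
    using powr_third_power(1)[OF n] by (simp add: power_divide)
qed

context sign_stacks
begin

text \<open>Radius \<open>2 * n\<^sup>2\<close> instead of \<open>n\<^sup>2\<close> leaves room for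
  the stretch to the left of a site in \<open>fired_less\<close>.\<close>

definition noise_event :: "nat \<Rightarrow> 'a set" where
  "noise_event n = {\<omega> \<in> space M. \<exists>x\<in>{- int (2 * n\<^sup>2)..int (2 * n\<^sup>2)}. \<exists>k\<le>max_odometer n.
     \<bar>Z_at \<omega> x k\<bar> \<ge> real n / 16}"

definition flat_event :: "nat \<Rightarrow> 'a set" where
  "flat_event n = (\<Union>x\<in>{- int (n\<^sup>2)..int (n\<^sup>2)}. {\<omega> \<in> space M.
     real (card (separated_pairs (98304 * upper_scale n ^ 4) (12 * upper_scale n ^ 4) (upper_scale n) x \<omega>))
       \<le> real (upper_scale n) / 16})"

definition escape_event :: "nat \<Rightarrow> 'a set" where
  "escape_event n = {\<omega> \<in> space M. escapes n (n\<^sup>2) (horizon n) \<omega>}"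

text \<open>The first term of the threshold bounds the mean of the sum, the second is the allowed
  deviation. Together they stay below \<open>n / 8\<close>.\<close>

definition fluctuation_event :: "nat \<Rightarrow> 'a set" where
  "fluctuation_event n = {\<omega> \<in> space M.
     (\<Sum>y\<in>{- 202 * int (lower_scale n)..202 * int (lower_scale n)}.
        fluctuation y 0 (227 * 64000000000 * lower_scale n ^ 4) \<omega>)
     \<ge> real (card {- 202 * int (lower_scale n)..202 * int (lower_scale n)}) * (8000000 * real (lower_scale n) ^ 2)
       + 4000000000 * real (lower_scale n) ^ 3}"

definition bad_event :: "nat \<Rightarrow> 'a set" where
  "bad_event n = noise_event n \<union> flat_event n \<union> escape_event n \<union> fluctuation_event n"

text \<open>The deterministic estimates in sequence: no escape and enough separated pairs bound the
  counters, this forces stopping by the horizon, and the stopped state gives the lower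
  bound.\<close>

lemma outside_bad_event:
  assumes n: "real n powr (1 / 3) \<ge> 8000" and \<omega>: "\<omega> \<in> space M" "\<omega> \<notin> bad_event n"
  shows "stopped (state n \<omega> (horizon n))"
    and "fired (state n \<omega> (horizon n)) x \<le> max_odometer n"
    and "\<bar>x\<bar> \<le> int (lower_scale n) \<Longrightarrow> real (fired (state n \<omega> (horizon n)) x) \<ge> real (lower_scale n) ^ 4"
proof -
  have n1: "n \<ge> 1" using n by (cases n) auto
  note q = upper_scale_bounds[OF n1]
  note p = lower_scale_bounds[OF n]
  let ?z = "real n powr (1 / 3)"
  \<comment> \<open>Makes \<open>4 * q\<close> and \<open>202 * p\<close> at most \<open>n\<close>,
    so all sites used lie in the range of \<open>noise_event\<close>.\<close>
  have zn: "?z * 64000000 \<le> real n"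
  proof -
    have "8000\<^sup>2 \<le> ?z\<^sup>2" using n by (intro power_mono) auto
    then have "?z * 64000000 \<le> ?z * ?z\<^sup>2" using n by (intro mult_left_mono) auto
    then show ?thesis
      using powr_third_power(1)[OF n1] by (simp add: power2_eq_square power3_eq_cube)
  qed
  then have "real (upper_scale n) * 4 \<le> real n" "202 * real (lower_scale n) \<le> real n"
    using q(3) p(3) n by linarith+
  then have qn: "upper_scale n * 4 \<le> n" "202 * lower_scale n \<le> n"
    using of_nat_le_iff[where ?'a = real] by (metis of_nat_mult of_nat_numeral)+
  have nn: "n \<le> n\<^sup>2" by (simp add: power2_eq_square)
  have Z: "\<bar>Z_at \<omega> x k\<bar> \<le> real n / 16" if "\<bar>x\<bar> \<le> int (2 * n\<^sup>2)" "k \<le> max_odometer n" for x k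
  proof (rule ccontr)
    assume "\<not> \<bar>Z_at \<omega> x k\<bar> \<le> real n / 16"
    moreover have "x \<in> {- int (2 * n\<^sup>2)..int (2 * n\<^sup>2)}" using that(1) by auto
    ultimately have "\<omega> \<in> noise_event n"
      unfolding noise_event_def using that(2) \<omega>(1) by (smt (verit) mem_Collect_eq)
    then show False using \<omega>(2) by (simp add: bad_event_def)
  qed
  have esc: "\<not> escapes n (n\<^sup>2) (horizon n) \<omega>"
    using \<omega> by (simp add: bad_event_def escape_event_def)
  have less: "fired (state n \<omega> (horizon n)) x < max_odometer n" for x
    unfolding max_odometer_def
  proof (rule fired_less[OF q(1,4) n1 _ _ esc order_refl])
    show "\<bar>Z_at \<omega> x k\<bar> \<le> real n / 16"
      if "\<bar>x\<bar> \<le> int (n\<^sup>2) + 4 * int (upper_scale n)"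
        "k \<le> 98304 * upper_scale n ^ 4 + 12 * upper_scale n ^ 4" for x k
    proof (rule Z)
      have "4 * int (upper_scale n) \<le> int (n\<^sup>2)" using qn(1) nn by linarith
      then show "\<bar>x\<bar> \<le> int (2 * n\<^sup>2)" using that(1) by linarith
    qed (use that(2) in \<open>simp add: max_odometer_def\<close>)
    show "real (upper_scale n) / 16
        < real (card (separated_pairs (98304 * upper_scale n ^ 4) (12 * upper_scale n ^ 4) (upper_scale n) x \<omega>))"
      if "\<bar>x\<bar> \<le> int (n\<^sup>2)" for x
    proof (rule ccontr)
      assume a: "\<not> ?thesis"
      have "x \<in> {- int (n\<^sup>2)..int (n\<^sup>2)}" using that by auto
      then have "\<omega> \<in> flat_event n"
        unfolding flat_event_def using a \<omega>(1) by (intro UN_I[of x]) auto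
      then show False using \<omega>(2) by (simp add: bad_event_def)
    qed
  qed
  then show "fired (state n \<omega> (horizon n)) x \<le> max_odometer n"
    by (rule less_imp_le)
  have max: "max_odometer n \<ge> 1" using q(1) by (simp add: max_odometer_def)
  show st: "stopped (state n \<omega> (horizon n))"
    by (rule stopped_by[OF max esc less]) (simp add: horizon_def)
  let ?A = "{- 202 * int (lower_scale n)..202 * int (lower_scale n)}"
  show "real (fired (state n \<omega> (horizon n)) x) \<ge> real (lower_scale n) ^ 4" if "\<bar>x\<bar> \<le> int (lower_scale n)"
  proof (rule fired_ge[where B = 64000000000 and H = "max_odometer n"])
    show "\<bar>Z_at \<omega> x k\<bar> \<le> real n / 16" if "\<bar>x\<bar> \<le> 202 * int (lower_scale n)" "k \<le> max_odometer n" for x k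
    proof (rule Z[OF _ that(2)])
      show "\<bar>x\<bar> \<le> int (2 * n\<^sup>2)" using that(1) qn(2) nn by linarith
    qed
    have "(\<Sum>y\<in>?A. fluctuation y 0 (227 * 64000000000 * lower_scale n ^ 4) \<omega>)
        < real (card ?A) * (8000000 * real (lower_scale n) ^ 2) + 4000000000 * real (lower_scale n) ^ 3"
      using \<omega> by (auto simp: bad_event_def fluctuation_event_def not_le)
    also have "\<dots> \<le> (405 * real (lower_scale n)) * (8000000 * real (lower_scale n) ^ 2) + 4000000000 * real (lower_scale n) ^ 3"
      using p(1) by (intro add_right_mono mult_right_mono) auto
    \<comment> \<open>\<open>405 * 8000000 + 4000000000 \<le> 64000000000 / 8\<close>.\<close>
    also have "\<dots> \<le> real n / 8"
      using p(4) by (simp add: power2_eq_square power3_eq_cube)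
    finally show "(\<Sum>y\<in>?A. fluctuation y 0 (227 * 64000000000 * lower_scale n ^ 4) \<omega>) \<le> real n / 8"
      by simp
  qed (use p st less that in \<open>auto intro: less_imp_le\<close>)
qed

lemma bad_event_measurable:
  assumes "n \<ge> 1"
  shows "noise_event n \<in> events" "flat_event n \<in> events" "escape_event n \<in> events"
    "lower_scale n \<ge> 1 \<Longrightarrow> fluctuation_event n \<in> events"
proof -
  note q = upper_scale_bounds[OF assms]
  have max: "max_odometer n \<ge> 1" using q(1) by (simp add: max_odometer_def)
  show "noise_event n \<in> events"
    unfolding noise_event_def by (rule prob_Z_large(2)[OF max]) simp
  show "flat_event n \<in> events"
    unfolding flat_event_def using q(1)
    by (intro sets.finite_UN ballI prob_few_separated(2)) auto
  show "escape_event n \<in> events"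
    unfolding escape_event_def by (rule escapes_measurable)
  show "fluctuation_event n \<in> events" if "lower_scale n \<ge> 1"
    unfolding fluctuation_event_def using that
    by (intro prob_fluctuation_sum(2)[where a = 1]) (auto simp: power_mult_distrib simp flip: power_mult)
qed

text \<open>All bounds are stated in \<open>z\<close>, where \<open>n = z ^ 3\<close> and the
  maximal odometer is of order \<open>z ^ 4\<close>; the exponent is then of order
  \<open>z ^ 6 / z ^ 4\<close>.\<close>

lemma prob_noise_event:
  assumes "n \<ge> 1"
  defines "z \<equiv> real n powr (1 / 3)"
  shows "prob (noise_event n)
    \<le> (4 * z ^ 6 + 1) * (1573056 * z ^ 4 + 1) * (2 * exp (- (z\<^sup>2 / (256 * 1573056))))"
proof -
  note q = upper_scale_bounds[OF assms(1), folded z_def]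
  have z3: "real n = z ^ 3" using powr_third_power(1)[OF assms(1)] by (simp add: z_def)
  have z: "z > 0" using assms by simp
  have max: "max_odometer n \<ge> 1" using q(1) by (simp add: max_odometer_def)
  have "prob (noise_event n) \<le> (2 * real (2 * n\<^sup>2) + 1) * (real (max_odometer n) + 1)
      * (2 * exp (- ((real n / 16)\<^sup>2 / real (max_odometer n))))"
    unfolding noise_event_def by (rule prob_Z_large(1)[OF max]) simp
  also have "\<dots> \<le> (4 * z ^ 6 + 1) * (1573056 * z ^ 4 + 1) * (2 * exp (- (z\<^sup>2 / (256 * 1573056))))"
  proof (intro mult_mono)
    show "2 * real (2 * n\<^sup>2) + 1 \<le> 4 * z ^ 6 + 1"
      by (simp add: z3 flip: power_mult)
    have "z\<^sup>2 / (256 * 1573056) = (real n / 16)\<^sup>2 / (1573056 * z ^ 4)"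
      using z by (simp add: z3 power_divide field_simps flip: power_mult power_add)
    also have "\<dots> \<le> (real n / 16)\<^sup>2 / real (max_odometer n)"
      using q(5) max by (intro divide_left_mono) (auto intro!: mult_pos_pos z zero_less_power)
    finally show "exp (- ((real n / 16)\<^sup>2 / real (max_odometer n))) \<le> exp (- (z\<^sup>2 / (256 * 1573056)))"
      by simp
  qed (use q in auto)
  finally show ?thesis .
qed

lemma prob_flat_event:
  assumes "n \<ge> 1"
  defines "z \<equiv> real n powr (1 / 3)"
  shows "prob (flat_event n) \<le> (2 * z ^ 6 + 1) * exp (- (z / 128))"
proof -
  note q = upper_scale_bounds[OF assms(1), folded z_def]
  have z3: "real n = z ^ 3" using powr_third_power(1)[OF assms(1)] by (simp add: z_def)
  let ?E = "\<lambda>x. {\<omega> \<in> space M.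
     real (card (separated_pairs (98304 * upper_scale n ^ 4) (12 * upper_scale n ^ 4) (upper_scale n) x \<omega>))
       \<le> real (upper_scale n) / 16}"
  have E: "?E x \<in> events" "prob (?E x) \<le> exp (- (real (upper_scale n) / 128))" for x
    by (rule prob_few_separated; use q(1) in simp)+
  have "prob (flat_event n) \<le> (\<Sum>x\<in>{- int (n\<^sup>2)..int (n\<^sup>2)}. prob (?E x))"
    unfolding flat_event_def using E(1) by (intro finite_measure_subadditive_finite) auto
  also have "\<dots> \<le> (\<Sum>x\<in>{- int (n\<^sup>2)..int (n\<^sup>2)}. exp (- (z / 128)))"
  proof (rule sum_mono)
    fix x
    show "prob (?E x) \<le> exp (- (z / 128))"
      using E(2)[of x] q(2) by (smt (verit) divide_right_mono exp_le_cancel_iff)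
  qed
  also have "\<dots> = (2 * z ^ 6 + 1) * exp (- (z / 128))"
    by (simp add: z3 flip: power_mult)
  finally show ?thesis .
qed

lemma prob_escape_event:
  assumes "n \<ge> 1"
  defines "z \<equiv> real n powr (1 / 3)"
  shows "prob (escape_event n)
    \<le> ((2 * z ^ 6 + 1) * (1573056 * z ^ 4) + 1) * (2 * z ^ 3 * exp (- (z\<^sup>2 / (12 * 1573056))))"
proof -
  note q = upper_scale_bounds[OF assms(1), folded z_def]
  have z3: "real n = z ^ 3" using powr_third_power(1)[OF assms(1)] by (simp add: z_def)
  have z: "z > 0" using assms by simp
  have max: "max_odometer n \<ge> 1" using q(1) by (simp add: max_odometer_def)
  have T: "real (horizon n) = (2 * z ^ 6 + 1) * real (max_odometer n)"
    by (simp add: horizon_def z3 algebra_simps flip: power_mult)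
  have "1 \<le> real (n\<^sup>2)" using assms(1) by simp
  then have "(2 * real (n\<^sup>2) + 1) * real (max_odometer n) \<le> 3 * real (n\<^sup>2) * real (max_odometer n)"
    by (intro mult_right_mono) auto
  moreover have "real (horizon n) = (2 * real (n\<^sup>2) + 1) * real (max_odometer n)"
    by (simp add: horizon_def algebra_simps)
  ultimately have "real (horizon n) \<le> 3 * real (n\<^sup>2) * real (max_odometer n)"
    by simp
  then have "prob (escape_event n) \<le> (real (horizon n) + 1)
      * (2 * real n * exp (- (real (n\<^sup>2) / (12 * real (max_odometer n)))))"
    unfolding escape_event_def using max by (intro prob_escapes) auto
  also have "\<dots> \<le> ((2 * z ^ 6 + 1) * (1573056 * z ^ 4) + 1) * (2 * z ^ 3 * exp (- (z\<^sup>2 / (12 * 1573056))))"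
  proof (intro mult_mono)
    show "real (horizon n) + 1 \<le> (2 * z ^ 6 + 1) * (1573056 * z ^ 4) + 1"
      unfolding T using q(5) z by (intro add_right_mono mult_left_mono) auto
    have "z\<^sup>2 / (12 * 1573056) = real (n\<^sup>2) / (12 * (1573056 * z ^ 4))"
      using z by (simp add: z3 field_simps flip: power_mult power_add)
    also have "\<dots> \<le> real (n\<^sup>2) / (12 * real (max_odometer n))"
      using q(5) max z by (intro divide_left_mono mult_left_mono mult_pos_pos) auto
    finally show "exp (- (real (n\<^sup>2) / (12 * real (max_odometer n)))) \<le> exp (- (z\<^sup>2 / (12 * 1573056)))"
      by simp
  qed (use z in \<open>auto simp: z3\<close>)
  finally show ?thesis .
qed

lemma prob_fluctuation_event:
  assumes "real n powr (1 / 3) \<ge> 8000"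
  defines "z \<equiv> real n powr (1 / 3)"
  shows "prob (fluctuation_event n) \<le> exp (- (sqrt (z / 8000)))
    + 405 * z * ((29056000000000 * z ^ 4 + 1) * (2 * exp (- (sqrt (z / 8000) / 14528000000000))))"
proof -
  note p = lower_scale_bounds[OF assms(1), folded z_def]
  define P where "P = real (lower_scale n)"
  \<comment> \<open>Slightly above the typical size \<open>P\<^sup>2\<close> of the maxima: both the
    Hoeffding exponent \<open>P ^ 6 / (P * a\<^sup>2)\<close> and the truncation exponent
    \<open>a\<^sup>2 / P ^ 4\<close> become of order \<open>sqrt P\<close>.\<close>
  define a where "a = P\<^sup>2 * sqrt (sqrt P)"
  let ?A = "{- 202 * int (lower_scale n)..202 * int (lower_scale n)}"
  let ?h = "227 * 64000000000 * lower_scale n ^ 4"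
  have P: "P \<ge> 1" "z / 8000 \<le> P" "P \<le> z" using p assms(1) by (auto simp: P_def z_def)
  have card: "real (card ?A) = 404 * P + 1" by (simp add: P_def)
  have h: "real ?h = 14528000000000 * P ^ 4" by (simp add: P_def)
  have a2: "a\<^sup>2 = P ^ 4 * sqrt P"
    using P(1) by (simp add: a_def power_mult_distrib flip: power_mult)
  have a0: "a > 0" using P(1) by (simp add: a_def)
  have s: "sqrt (z / 8000) \<le> sqrt P" using P(2) by simp
  have "prob (fluctuation_event n)
      \<le> exp (- 2 * (4000000000 * P ^ 3)\<^sup>2 / (real (card ?A) * a\<^sup>2))
        + real (card ?A) * ((2 * real ?h + 1) * (2 * exp (- (a\<^sup>2 / real ?h))))"
    unfolding fluctuation_event_def P_def[symmetric]
  proof (rule prob_fluctuation_sum(1))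
    \<comment> \<open>\<open>4 * 14528 * 10 ^ 9 \<le> 64 * 10 ^ 12\<close>.\<close>
    show "4 * real ?h \<le> (8000000 * P\<^sup>2)\<^sup>2"
      unfolding h using P(1) by (simp add: power_mult_distrib flip: power_mult)
    show "?h \<ge> 1" using p(1) by simp
  qed (use P(1) a0 in auto)
  also have "\<dots> \<le> exp (- (sqrt (z / 8000)))
      + 405 * z * ((29056000000000 * z ^ 4 + 1) * (2 * exp (- (sqrt (z / 8000) / 14528000000000))))"
  proof (rule add_mono)
    have c0: "real (card ?A) * a\<^sup>2 > 0" using a0 P(1) by (simp add: card)
    have "sqrt P * a\<^sup>2 = P ^ 4 * (sqrt P * sqrt P)"
      unfolding a2 by (simp only: ac_simps)
    also have "\<dots> = P ^ 5"
      using P(1) by (simp add: numeral_eq_Suc)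
    finally have "sqrt P * (real (card ?A) * a\<^sup>2) = real (card ?A) * P ^ 5"
      by (metis mult.left_commute)
    also have "\<dots> \<le> (405 * P) * P ^ 5"
      unfolding card using P(1) by (intro mult_right_mono) auto
    also have "\<dots> = 405 * P ^ 6" by (simp add: numeral_eq_Suc)
    also have "\<dots> \<le> 2 * (4000000000 * P ^ 3)\<^sup>2"
      using P(1) by (simp add: power_mult_distrib flip: power_mult)
    finally have "sqrt P \<le> 2 * (4000000000 * P ^ 3)\<^sup>2 / (real (card ?A) * a\<^sup>2)"
      using c0 by (simp add: pos_le_divide_eq)
    with s have "sqrt (z / 8000) \<le> 2 * (4000000000 * P ^ 3)\<^sup>2 / (real (card ?A) * a\<^sup>2)"
      by (rule order_trans)
    then show "exp (- 2 * (4000000000 * P ^ 3)\<^sup>2 / (real (card ?A) * a\<^sup>2)) \<le> exp (- (sqrt (z / 8000)))"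
      by simp
    show "real (card ?A) * ((2 * real ?h + 1) * (2 * exp (- (a\<^sup>2 / real ?h))))
      \<le> 405 * z * ((29056000000000 * z ^ 4 + 1) * (2 * exp (- (sqrt (z / 8000) / 14528000000000))))"
    proof (intro mult_mono)
      show "real (card ?A) \<le> 405 * z" unfolding card using P by linarith
      have "P ^ 4 \<le> z ^ 4" using P by (intro power_mono) auto
      then show "2 * real ?h + 1 \<le> 29056000000000 * z ^ 4 + 1" unfolding h by simp
      have "a\<^sup>2 / real ?h = sqrt P / 14528000000000"
        unfolding a2 h using P(1) by simp
      then show "exp (- (a\<^sup>2 / real ?h)) \<le> exp (- (sqrt (z / 8000) / 14528000000000))"
        using s by simp
    qed (use P in auto)
  qed
  finally show ?thesis .
qed

end

section \<open>Asymptotics of the failure probability\<close>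

definition failure_bound :: "real \<Rightarrow> real" where
  "failure_bound z =
    (4 * z ^ 6 + 1) * (1573056 * z ^ 4 + 1) * (2 * exp (- (z\<^sup>2 / (256 * 1573056))))
    + (2 * z ^ 6 + 1) * exp (- (z / 128))
    + ((2 * z ^ 6 + 1) * (1573056 * z ^ 4) + 1) * (2 * z ^ 3 * exp (- (z\<^sup>2 / (12 * 1573056))))
    + (exp (- (sqrt (z / 8000)))
      + 405 * z * ((29056000000000 * z ^ 4 + 1) * (2 * exp (- (sqrt (z / 8000) / 14528000000000)))))"

text \<open>The slowest decay is \<open>exp (- const * sqrt z)\<close>, from the fluctuation sum,
  and \<open>3 / 10 < 1 / 2\<close> absorbs constants and polynomial factors.\<close>

lemma eventually_failure_bound: "\<forall>\<^sub>F z in at_top. failure_bound z < exp (- (z powr (3 / 10)))"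
  unfolding failure_bound_def by real_asymp

lemma eventually_failure_bound_nat:
  "\<forall>\<^sub>F n in sequentially. real n powr (1 / 3) \<ge> 8000
    \<and> failure_bound (real n powr (1 / 3)) < exp (- (real n powr (1 / 10)))"
proof -
  have "filterlim (\<lambda>n. real n powr (1 / 3)) at_top sequentially"
    by real_asymp
  then have "\<forall>\<^sub>F n in sequentially. real n powr (1 / 3) \<ge> 8000
    \<and> failure_bound (real n powr (1 / 3)) < exp (- ((real n powr (1 / 3)) powr (3 / 10)))"
    using eventually_conj[OF eventually_ge_at_top[of "8000 :: real"] eventually_failure_bound]
    by (rule eventually_compose_filterlim[rotated])
  with eventually_ge_at_top[of 1] show ?thesis
  proof eventually_elim
    case (elim n)
    then show ?case using powr_third_power(3)[of n] by simp
  qed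
qed

context sign_stacks
begin

lemma prob_bad_event:
  assumes "real n powr (1 / 3) \<ge> 8000"
  shows "bad_event n \<in> events" "prob (bad_event n) \<le> failure_bound (real n powr (1 / 3))"
proof -
  have n: "n \<ge> 1" using assms by (cases n) auto
  note E = bad_event_measurable[OF n]
  note F = E(4)[OF lower_scale_bounds(1)[OF assms]]
  show "bad_event n \<in> events"
    unfolding bad_event_def using E F by auto
  have "prob (bad_event n) \<le> prob (noise_event n) + prob (flat_event n) + prob (escape_event n)
      + prob (fluctuation_event n)"
    unfolding bad_event_def using E F
      measure_Un_le[of "noise_event n" M "flat_event n"]
      measure_Un_le[of "noise_event n \<union> flat_event n" M "escape_event n"]
      measure_Un_le[of "noise_event n \<union> flat_event n \<union> escape_event n" M "fluctuation_event n"]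
    by auto
  also have "\<dots> \<le> failure_bound (real n powr (1 / 3))"
    unfolding failure_bound_def
    by (intro add_mono prob_noise_event[OF n] prob_flat_event[OF n] prob_escape_event[OF n]
        prob_fluctuation_event[OF assms, unfolded])
  finally show "prob (bad_event n) \<le> failure_bound (real n powr (1 / 3))" .
qed

end

section \<open>Transfer to the given stacks\<close>

text \<open>Stack entries are only almost surely \<open>1\<close> or \<open>-1\<close>, so they are first replaced by their signs.\<close>

definition stack_sign :: "(int \<Rightarrow> nat \<Rightarrow> 'a \<Rightarrow> int) \<Rightarrow> (int \<Rightarrow> nat \<Rightarrow> 'a \<Rightarrow> int) \<Rightarrow> bool \<times> int \<times> nat \<Rightarrow> 'a \<Rightarrow> int" where
  "stack_sign X Y = (\<lambda>(b, x, k) \<omega>. if (if b then X x k \<omega> else Y x k \<omega>) = 1 then 1 else - 1)"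

lemma odometer_cong:
  assumes "\<And>x k. k \<ge> 1 \<Longrightarrow> X x k = X' x k \<and> Y x k = Y' x k"
  shows "odometer n X Y = odometer n X' Y'"
proof -
  have "state_at n X Y = state_at n X' Y'"
    using assms by (intro ext state_at_cong) auto
  then show ?thesis
    by (simp add: odometer_def firing_times_def stop_time_def fun_eq_iff)
qed

context oil_water_stacks
begin

lemma measurable_stacks:
  assumes "k \<ge> 1"
  shows "X x k \<in> measurable M (count_space UNIV)" "Y x k \<in> measurable M (count_space UNIV)"
proof -
  have "(case (b, x, k) of (b, x, k) \<Rightarrow> if b then X x k else Y x k) \<in> measurable M (count_space UNIV)" for b
    using indep_stacks assms unfolding indep_vars_def2 by (auto simp: Ball_def)
  from this[of True] this[of False]
  show "X x k \<in> measurable M (count_space UNIV)" "Y x k \<in> measurable M (count_space UNIV)" by simp_all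
qed

lemma AE_stack_values:
  "AE \<omega> in M. \<forall>x k. k \<ge> 1 \<longrightarrow> X x k \<omega> \<in> {1, -1} \<and> Y x k \<omega> \<in> {1, -1}"
proof -
  have "AE \<omega> in M. X x k \<omega> \<in> {1, -1} \<and> Y x k \<omega> \<in> {1, -1}" if k: "k \<ge> 1" for x k
  proof -
    have "AE v in measure_pmf (pmf_of_set {1, -1}). v \<in> {1, -1 :: int}"
      by (simp add: AE_measure_pmf_iff)
    then have "AE v in distr M (count_space UNIV) (X x k). v \<in> {1, -1}"
      "AE v in distr M (count_space UNIV) (Y x k). v \<in> {1, -1}"
      unfolding uniform_X[OF k] uniform_Y[OF k] by simp_all
    then show ?thesis
      using measurable_stacks[OF k, of x] by (simp add: AE_distr_iff)
  qed
  then show ?thesis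
    by (simp add: AE_all_countable)
qed

lemma sign_stacks: "sign_stacks M (stack_sign X Y)"
proof -
  let ?I = "UNIV \<times> UNIV \<times> {1..} :: (bool \<times> int \<times> nat) set"
  let ?s = "\<lambda>v :: int. if v = 1 then 1 else - 1 :: int"
  have eq: "stack_sign X Y = (\<lambda>i \<omega>. ?s ((case i of (b, x, k) \<Rightarrow> if b then X x k else Y x k) \<omega>))"
    by (auto simp: stack_sign_def fun_eq_iff)
  have 1: "indep_vars (\<lambda>_. count_space UNIV) (stack_sign X Y) ?I"
    unfolding eq by (rule indep_vars_compose2[OF indep_stacks]) simp
  have 2: "expectation (\<lambda>\<omega>. real_of_int (stack_sign X Y i \<omega>)) = 0" if i: "i \<in> ?I" for i
  proof -
    have pmf: "expectation (\<lambda>\<omega>. real_of_int (?s (V \<omega>))) = 0"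
      if "V \<in> measurable M (count_space UNIV)"
        "distr M (count_space UNIV) V = measure_pmf (pmf_of_set {1, -1})" for V
    proof -
      have "expectation (\<lambda>\<omega>. real_of_int (?s (V \<omega>)))
          = integral\<^sup>L (distr M (count_space UNIV) V) (\<lambda>v. real_of_int (?s v))"
        using that(1) by (subst integral_distr) auto
      also have "\<dots> = 0"
        unfolding that(2) by (subst integral_pmf_of_set) auto
      finally show ?thesis .
    qed
    obtain b x k where bxk: "i = (b, x, k)" "k \<ge> 1" using i by auto
    show ?thesis
      unfolding bxk(1) stack_sign_def prod.case
      using pmf[OF measurable_stacks(1)[OF bxk(2)] uniform_X[OF bxk(2)]]
        pmf[OF measurable_stacks(2)[OF bxk(2)] uniform_Y[OF bxk(2)]]
      by (cases b) simp_all
  qed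
  have 3: "stack_sign X Y i \<omega> \<in> {1, -1}" for i \<omega>
    by (simp add: stack_sign_def split_beta)
  show ?thesis
    by (intro sign_stacks.intro sign_family.intro sign_family_axioms.intro prob_space_axioms 1 2 3)
qed

text \<open>Almost every sample point outside the measurable \<open>bad_event\<close> has genuine
  sign stacks and satisfies both bounds, so each event in question is almost surely contained in
  \<open>bad_event\<close>.\<close>

lemma odometer_bounds:
  assumes n: "real n powr (1 / 3) \<ge> 8000" "failure_bound (real n powr (1 / 3)) < \<delta>"
  defines "u \<equiv> \<lambda>\<omega>. odometer n (\<lambda>x k. X x k \<omega>) (\<lambda>x k. Y x k \<omega>)"
  shows "prob {\<omega> \<in> space M. (SUP x. ereal_of_enat (u \<omega> x)) > ereal (1573056 * real n powr (4 / 3))} < \<delta>"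
    and "prob {\<omega> \<in> space M. (INF x\<in>{x. \<bar>real_of_int x\<bar> \<le> 1 / 8000 ^ 4 * real n powr (1 / 3)}.
        ereal_of_enat (u \<omega> x)) < ereal (1 / 8000 ^ 4 * real n powr (4 / 3))} < \<delta>"
proof -
  interpret S: sign_stacks M "stack_sign X Y" by (rule sign_stacks)
  let ?z = "real n powr (1 / 3)"
  let ?T = "horizon n"
  have n1: "n \<ge> 1" using n(1) by (cases n) auto
  note z4 = powr_third_power(2)[OF n1]
  note q = upper_scale_bounds[OF n1] and p = lower_scale_bounds[OF n(1)]
  have u: "u \<omega> x = enat (fired (S.state n \<omega> ?T) x)"
    if \<omega>: "\<omega> \<in> space M" "\<omega> \<notin> S.bad_event n"
      and v: "\<forall>x k. k \<ge> 1 \<longrightarrow> X x k \<omega> \<in> {1, -1} \<and> Y x k \<omega> \<in> {1, -1}" for \<omega> x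
  proof -
    have "u \<omega> = odometer n (\<lambda>x k. stack_sign X Y (True, x, k) \<omega>) (\<lambda>x k. stack_sign X Y (False, x, k) \<omega>)"
      unfolding u_def using v by (intro odometer_cong) (auto simp: stack_sign_def)
    then show ?thesis
      using stacks.odometer_eq_fired[OF S.stacks_signs S.outside_bad_event(1)[OF n(1) \<omega>]] by simp
  qed
  have le: "measure M A < \<delta>"
    if "\<And>\<omega>. \<omega> \<in> space M \<Longrightarrow> \<omega> \<notin> S.bad_event n
        \<Longrightarrow> \<forall>x k. k \<ge> 1 \<longrightarrow> X x k \<omega> \<in> {1, -1} \<and> Y x k \<omega> \<in> {1, -1} \<Longrightarrow> \<omega> \<notin> A" for A
  proof -
    have "AE \<omega> in M. \<omega> \<in> A \<longrightarrow> \<omega> \<in> S.bad_event n"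
      using AE_stack_values AE_space by eventually_elim (use that in blast)
    then have "prob A \<le> prob (S.bad_event n)"
      using S.prob_bad_event(1)[OF n(1)] by (rule finite_measure_mono_AE)
    then show ?thesis
      using S.prob_bad_event(2)[OF n(1)] n(2) by linarith
  qed
  show "prob {\<omega> \<in> space M. (SUP x. ereal_of_enat (u \<omega> x)) > ereal (1573056 * real n powr (4 / 3))} < \<delta>"
  proof (rule le)
    fix \<omega> assume \<omega>: "\<omega> \<in> space M" "\<omega> \<notin> S.bad_event n"
      and v: "\<forall>x k. k \<ge> 1 \<longrightarrow> X x k \<omega> \<in> {1, -1} \<and> Y x k \<omega> \<in> {1, -1}"
    have "ereal_of_enat (u \<omega> x) \<le> ereal (1573056 * real n powr (4 / 3))" for x
    proof -
      have "real (fired (S.state n \<omega> ?T) x) \<le> real (max_odometer n)"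
        using S.outside_bad_event(2)[OF n(1) \<omega>] by simp
      also have "\<dots> \<le> 1573056 * real n powr (4 / 3)" using q(5) by (simp add: z4)
      finally show ?thesis by (simp add: u[OF \<omega> v])
    qed
    then have "(SUP x. ereal_of_enat (u \<omega> x)) \<le> ereal (1573056 * real n powr (4 / 3))"
      by (intro SUP_least)
    then show "\<omega> \<notin> {\<omega> \<in> space M. (SUP x. ereal_of_enat (u \<omega> x)) > ereal (1573056 * real n powr (4 / 3))}"
      by (simp add: not_less)
  qed
  let ?X = "{x. \<bar>real_of_int x\<bar> \<le> 1 / 8000 ^ 4 * real n powr (1 / 3)}"
  show "prob {\<omega> \<in> space M. (INF x\<in>?X. ereal_of_enat (u \<omega> x)) < ereal (1 / 8000 ^ 4 * real n powr (4 / 3))} < \<delta>"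
  proof (rule le)
    fix \<omega> assume \<omega>: "\<omega> \<in> space M" "\<omega> \<notin> S.bad_event n"
      and v: "\<forall>x k. k \<ge> 1 \<longrightarrow> X x k \<omega> \<in> {1, -1} \<and> Y x k \<omega> \<in> {1, -1}"
    have "ereal (1 / 8000 ^ 4 * real n powr (4 / 3)) \<le> ereal_of_enat (u \<omega> x)" if x: "x \<in> ?X" for x
    proof -
      \<comment> \<open>A single constant serves for range and height: it is below
        \<open>1 / 8000\<close>, and its product with \<open>?z ^ 4\<close> is
        \<open>(?z / 8000) ^ 4\<close>.\<close>
      have "1 / 8000 ^ 4 * ?z \<le> ?z / 8000" by simp
      then have "\<bar>real_of_int x\<bar> \<le> real (lower_scale n)"
        using x p(2) by simp
      then have "\<bar>x\<bar> \<le> int (lower_scale n)" by linarith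
      then have "real (lower_scale n) ^ 4 \<le> real (fired (S.state n \<omega> ?T) x)"
        by (rule S.outside_bad_event(3)[OF n(1) \<omega>])
      moreover have "(?z / 8000) ^ 4 \<le> real (lower_scale n) ^ 4"
        using p(2) by (intro power_mono) auto
      moreover have "1 / 8000 ^ 4 * real n powr (4 / 3) = (?z / 8000) ^ 4"
        by (simp only: z4 power_divide mult_1 times_divide_eq_left)
      ultimately have "1 / 8000 ^ 4 * real n powr (4 / 3) \<le> real (fired (S.state n \<omega> ?T) x)"
        by linarith
      then show ?thesis by (simp add: u[OF \<omega> v])
    qed
    then have "ereal (1 / 8000 ^ 4 * real n powr (4 / 3)) \<le> (INF x\<in>?X. ereal_of_enat (u \<omega> x))"
      by (intro INF_greatest)
    then show "\<omega> \<notin> {\<omega> \<in> space M. (INF x\<in>?X. ereal_of_enat (u \<omega> x)) < ereal (1 / 8000 ^ 4 * real n powr (4 / 3))}"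
      by (simp add: not_less)
  qed
qed

end

theorem theorem1p1:
  "\<exists>\<epsilon> c C :: real. \<epsilon> > 0 \<and> c > 0 \<and> C > 0 \<and>
    (\<forall>\<^sub>F n in sequentially.
      \<forall>(M :: 'a measure) X Y. oil_water_stacks M X Y \<longrightarrow>
        (let u = (\<lambda>\<omega>. odometer n (\<lambda>x k. X x k \<omega>) (\<lambda>x k. Y x k \<omega>)) in
          measure M {\<omega> \<in> space M.
              (SUP x. ereal_of_enat (u \<omega> x)) > ereal (C * real n powr (4/3))}
            < exp (- (real n powr \<epsilon>)) \<and>
          measure M {\<omega> \<in> space M.
              (INF x\<in>{x. \<bar>real_of_int x\<bar> \<le> c * real n powr (1/3)}. ereal_of_enat (u \<omega> x))
                < ereal (c * real n powr (4/3))}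
            < exp (- (real n powr \<epsilon>))))"
proof -
  let ?C = "1573056 :: real" and ?c = "1 / 8000 ^ 4 :: real"
  have "\<forall>\<^sub>F n in sequentially.
      \<forall>(M :: 'a measure) X Y. oil_water_stacks M X Y \<longrightarrow>
        (let u = (\<lambda>\<omega>. odometer n (\<lambda>x k. X x k \<omega>) (\<lambda>x k. Y x k \<omega>)) in
          measure M {\<omega> \<in> space M. (SUP x. ereal_of_enat (u \<omega> x)) > ereal (?C * real n powr (4/3))}
            < exp (- (real n powr (1/10))) \<and>
          measure M {\<omega> \<in> space M.
              (INF x\<in>{x. \<bar>real_of_int x\<bar> \<le> ?c * real n powr (1/3)}. ereal_of_enat (u \<omega> x))
                < ereal (?c * real n powr (4/3))}
            < exp (- (real n powr (1/10))))"
    using eventually_failure_bound_nat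
  proof eventually_elim
    case (elim n)
    show ?case
    proof (intro allI impI)
      fix M :: "'a measure" and X Y assume "oil_water_stacks M X Y"
      note bounds = oil_water_stacks.odometer_bounds[OF this conjunct1[OF elim] conjunct2[OF elim]]
      show "let u = (\<lambda>\<omega>. odometer n (\<lambda>x k. X x k \<omega>) (\<lambda>x k. Y x k \<omega>)) in
          measure M {\<omega> \<in> space M. (SUP x. ereal_of_enat (u \<omega> x)) > ereal (?C * real n powr (4/3))}
            < exp (- (real n powr (1/10))) \<and>
          measure M {\<omega> \<in> space M.
              (INF x\<in>{x. \<bar>real_of_int x\<bar> \<le> ?c * real n powr (1/3)}. ereal_of_enat (u \<omega> x))
                < ereal (?c * real n powr (4/3))}
            < exp (- (real n powr (1/10)))"
        unfolding Let_def by (rule conjI[OF bounds])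
    qed
  qed
  moreover have "1 / 10 > (0 :: real)" "?c > 0" "?C > 0" by simp_all
  ultimately show ?thesis by blast
qed

end
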